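(* Let $\gamma\subset\mathbb{C}$ be a Dini smooth Jordan curve of length $l$, let $D$ be the bounded domain with $\partial D=\gamma$, and let $F:\mathbf{T}\to\gamma$ be an orientation preserving Lipschitz weak homeomorphism of the unit circle $\mathbf{T}$ onto $\gamma$, with $F(e^{it})=g(f(t))$, where $g$ is the arc length parametrization of $\gamma$ and $f$ is nondecreasing, as described in the context. Let $w=P[F]$ be the Poisson extension of $F$ to the unit disk $\mathbf{U}$. Then the function $$T(e^{i\tau})=\frac{1}{2\pi}\int_0^{2\pi}\frac{\mathrm{Re}\left[\overline{\bigl(g(f(t))-g(f(\tau))\bigr)}\cdot i\,g'(f(\tau))\right]}{2\sin^2\frac{t-\tau}{2}}\,dt$$ is a (well-defined) continuous function on $\mathbf{T}$, and $$J_w(\zeta)=|\partial_t F(\zeta)|\,T(\zeta)\quad\text{for a.e. }\zeta=e^{it}\in\mathbf{T}.$$ Moreover, if $T(\zeta)>0$ for every $\zeta\in\mathbf{T}$, then $w=P[F]$ is a diffeomorphism of $\mathbf{U}$ onto $D$.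
   Context: $\mathbf{U}=\{z\in\mathbb{C}:|z|<1\}$ and $\mathbf{T}=\partial\mathbf{U}$. Dini smooth curve: for a continuous function $h$ on an interval, its modulus of continuity is $\omega_h(t)=\sup_{|x-y|\le t}|h(x)-h(y)|$, and $h$ is Dini-continuous if $\int_0^k\frac{\omega_h(t)}{t}\,dt<\infty$ for some constant $k>0$. A Jordan (simple closed) curve $\gamma$ of class $C^1$ and length $l$ is Dini smooth if $g'$ is Dini-continuous. Here $g:[0,l]\to\gamma$ is the arc length parametrization of $\gamma$ ($|g'(s)|=1$ for all $s$), extended $l$-periodically to $\mathbb{R}$ (so $g$ is a $C^1$ function on $\mathbb{R}$), and positively oriented, so that $i g'(s)$ is the inner unit normal vector of $\gamma$ at $g(s)$. Weak homeomorphism: a surjective function $F:\mathbf{T}\to\gamma$ is an (orientation preserving) weak homeomorphism if $F(e^{it})=g(f(t))$ where $f:[0,2\pi]\to[0,l]$ is a nondecreasing surjective function (the starting point $g(0)$ of the parametrization being chosen as $F(1)$); $f$ is extended to $\mathbb{R}$ by $f(t+2\pi)=f(t)+l$. In particular $F$ may be constant on arcs. The weak homeomorphism is Lipschitz if $F$ is Lipschitz. Then $|\partial_tF(e^{it})|=f'(t)$ for a.e. $t$, where $\partial_tF(e^{it})$ denotes the derivative of $t\mapsto F(e^{it})$. Poisson extension: for $z=re^{i\tau}\in\mathbf{U}$, $$P[F](z)=\int_0^{2\pi}P(r,t-\tau)F(e^{it})\,dt,\qquad P(r,t)=\frac{1-r^2}{2\pi(1-2r\cos t+r^2)}.$$ Boundary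 Jacobian: for $\zeta\in\mathbf{T}$, $J_w(\zeta):=\lim_{r\to1^-}J_w(r\zeta)$, where $J_w(r\zeta)$ is the Jacobian determinant of $w$ (as a map of the real plane) at $r\zeta$; the limit exists for a.e. $\zeta\in\mathbf{T}$. *)

theory Defs
  imports "HOL-Complex_Analysis.Complex_Analysis"
begin

text \<open>
  The supremum is taken in \<^typ>\<open>ennreal\<close>, so it is meaningful for unbounded \<open>h\<close> as well.
\<close>

definition modulus_of_continuity :: "real set \<Rightarrow> (real \<Rightarrow> complex) \<Rightarrow> real \<Rightarrow> ennreal" where
  "modulus_of_continuity I h t =
     (SUP p \<in> {(x, y). x \<in> I \<and> y \<in> I \<and> \<bar>x - y\<bar> \<le> t}. ennreal (cmod (h (fst p) - h (snd p))))"

definition dini_continuous_on :: "real set \<Rightarrow> (real \<Rightarrow> complex) \<Rightarrow> bool" where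
  "dini_continuous_on I h \<longleftrightarrow>
     continuous_on I h \<and>
     (\<exists>k>0. (\<integral>\<^sup>+ t\<in>{0<..k}. modulus_of_continuity I h t / ennreal t \<partial>lborel) < \<infinity>)"

text \<open>
  \<open>g\<close> is the \<open>l\<close>-periodic extension of the positively oriented arc length parametrization of the
  Jordan curve \<open>\<gamma>\<close> of class \<open>C\<^sup>1\<close> and length \<open>l\<close>.  Positive orientation means that the curve winds
  once counterclockwise around its interior; equivalently, \<open>\<i> g'(s)\<close> is the inner unit normal at
  \<open>g(s)\<close>.  The rescaling by \<open>l\<close> is needed because library paths live on the unit interval.
\<close>

definition arclength_parametrization :: "complex set \<Rightarrow> real \<Rightarrow> (real \<Rightarrow> complex) \<Rightarrow> bool" where
  "arclength_parametrization \<gamma> l g \<longleftrightarrow>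
     0 < l \<and>
     (\<forall>s. g (s + l) = g s) \<and>
     g ` {0..l} = \<gamma> \<and>
     inj_on g {0..<l} \<and>
     g C1_differentiable_on UNIV \<and>
     (\<forall>s. cmod (vector_derivative g (at s)) = 1) \<and>
     (\<forall>z \<in> inside \<gamma>. winding_number (\<lambda>u. g (l * u)) z = 1)"

definition dini_smooth_jordan_curve :: "complex set \<Rightarrow> real \<Rightarrow> (real \<Rightarrow> complex) \<Rightarrow> bool" where
  "dini_smooth_jordan_curve \<gamma> l g \<longleftrightarrow>
     arclength_parametrization \<gamma> l g \<and>
     dini_continuous_on UNIV (\<lambda>s. vector_derivative g (at s))"

definition weak_homeomorphism ::
  "complex set \<Rightarrow> real \<Rightarrow> (real \<Rightarrow> complex) \<Rightarrow> (real \<Rightarrow> real) \<Rightarrow> (complex \<Rightarrow> complex) \<Rightarrow> bool" where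
  "weak_homeomorphism \<gamma> l g f F \<longleftrightarrow>
     F ` sphere 0 1 = \<gamma> \<and>
     mono_on {0..2*pi} f \<and>
     f ` {0..2*pi} = {0..l} \<and>
     (\<forall>t. f (t + 2*pi) = f t + l) \<and>
     (\<forall>t. F (cis t) = g (f t))"

definition poisson_kernel :: "real \<Rightarrow> real \<Rightarrow> real" where
  "poisson_kernel r t = (1 - r\<^sup>2) / (2 * pi * (1 - 2 * r * cos t + r\<^sup>2))"

text \<open>
  For \<open>z = 0\<close> the value of \<^term>\<open>Arg z\<close> is immaterial, since the kernel is then constant.
\<close>

definition poisson_extension :: "(complex \<Rightarrow> complex) \<Rightarrow> complex \<Rightarrow> complex" where
  "poisson_extension F z =
     integral {0..2*pi} (\<lambda>t. of_real (poisson_kernel (cmod z) (t - Arg z)) * F (cis t))"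

text \<open>
  The determinant of the real \<open>2 \<times> 2\<close> matrix of partial derivatives, whose columns are the
  derivative of \<open>w\<close> in the directions \<open>1\<close> and \<open>\<i>\<close>.
\<close>

definition jacobian_det :: "(complex \<Rightarrow> complex) \<Rightarrow> complex \<Rightarrow> real" where
  "jacobian_det w z =
     (let D = frechet_derivative w (at z) in Re (D 1) * Im (D \<i>) - Re (D \<i>) * Im (D 1))"

definition boundary_jacobian :: "(complex \<Rightarrow> complex) \<Rightarrow> complex \<Rightarrow> real" where
  "boundary_jacobian w \<zeta> = Lim (at_left 1) (\<lambda>r. jacobian_det w (of_real r * \<zeta>))"

text \<open>
  At the points \<open>t\<close> with \<open>t - \<tau>\<close> in \<open>2\<pi>\<int>\<close> the denominator vanishes and the value is \<open>0\<close> by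
  convention; this is a null set.
\<close>

definition T_integrand :: "(real \<Rightarrow> complex) \<Rightarrow> (real \<Rightarrow> real) \<Rightarrow> real \<Rightarrow> real \<Rightarrow> real" where
  "T_integrand g f \<tau> t =
     Re (cnj (g (f t) - g (f \<tau>)) * (\<i> * vector_derivative g (at (f \<tau>)))) / (2 * (sin ((t - \<tau>) / 2))\<^sup>2)"

text \<open>
  The function on the circle is defined via the representative of the argument in \<open>[0, 2\<pi>)\<close>; that
  the formula holds for every representative is part of its being well defined.
\<close>

definition T_function :: "(real \<Rightarrow> complex) \<Rightarrow> (real \<Rightarrow> real) \<Rightarrow> complex \<Rightarrow> real" where
  "T_function g f \<zeta> = 1 / (2 * pi) * integral {0..2*pi} (T_integrand g f (Arg2pi \<zeta>))"

text \<open>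
  \<open>C\<^sup>k\<close> maps on an open set, expressed through iterated directional derivatives.
\<close>

primrec Ck_on :: "nat \<Rightarrow> (complex \<Rightarrow> complex) \<Rightarrow> complex set \<Rightarrow> bool" where
  "Ck_on 0 h S \<longleftrightarrow> continuous_on S h"
| "Ck_on (Suc k) h S \<longleftrightarrow>
     (\<forall>x\<in>S. h differentiable at x) \<and> (\<forall>v. Ck_on k (\<lambda>x. frechet_derivative h (at x) v) S)"

definition smooth_on :: "(complex \<Rightarrow> complex) \<Rightarrow> complex set \<Rightarrow> bool" where
  "smooth_on h S \<longleftrightarrow> (\<forall>k. Ck_on k h S)"

definition diffeomorphism_onto :: "(complex \<Rightarrow> complex) \<Rightarrow> complex set \<Rightarrow> complex set \<Rightarrow> bool" where
  "diffeomorphism_onto w U D \<longleftrightarrow>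
     open U \<and> open D \<and> bij_betw w U D \<and> smooth_on w U \<and> smooth_on (the_inv_into U w) D"

end

theory Submission
  imports Defs
begin

text \<open>
Write \<open>w = h + cnj k\<close> with \<open>h\<close>, \<open>k\<close> holomorphic in the disk, \<open>w\<close> being the Poisson extension of
\<open>G(t) = g (f t)\<close>. At \<open>z = r e\<^sup>i\<^sup>\<tau>\<close> the Jacobian is \<open>|h'|\<^sup>2 - |k'|\<^sup>2\<close>, and \<open>r\<^sup>2\<close> times it is the determinant
of the two polar derivatives \<open>R = r w\<^sub>r\<close> and \<open>\<Theta> = w\<^sub>\<tau>\<close>. Both are integrals of \<open>G\<close> against
differentiated Poisson kernels of mean zero, so \<open>G\<close> may be replaced by the chord
\<open>g (f (\<tau> + x)) - g (f \<tau>)\<close>.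

The boundary Jacobian. Since \<open>g'\<close> has a modulus of continuity \<open>m\<close>, the chord differs from the
multiple \<open>(f (\<tau> + x) - f \<tau>) e\<close> of the tangent \<open>e = g' (f \<tau>)\<close> by at most \<open>|x| \<rho>(|x|)\<close> with \<open>\<rho>(x) = L m(L x)\<close>. Two
consequences: the normal component of \<open>R\<close> is an integral dominated by \<open>\<rho>(|x|) / |x|\<close>, which the Dini
condition makes integrable uniformly in \<open>r\<close>, so it extends continuously to \<open>r = 1\<close>, where it equals
\<open>T\<close>; and \<open>\<Theta> = a e + E\<close>, where \<open>a\<close> is the angular kernel applied to \<open>f\<close> itself and \<open>E\<close> is small. The
tangential part of \<open>R\<close> may blow up, but only logarithmically, and the Dini condition forces
\<open>\<rho>(y) log (1/y)\<close> to vanish as \<open>y\<close> tends to \<open>0\<close>, so \<open>E\<close> times the logarithm is negligible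
(\<open>polar_det_estimate\<close>). Hence the Jacobian tends to
\<open>f'(\<tau>) T\<close> wherever \<open>f\<close> is differentiable, which for a monotone Lipschitz function is almost everywhere.

The Jacobian inside the disk. Suppose \<open>T > 0\<close>. Blending \<open>f\<close> slightly with the linear parameter makes
it strictly increasing while, by compactness and the continuity just described, keeping the normal
component of \<open>R\<close> bounded below near the circle. The same estimates then give \<open>|k'| < |h'|\<close> on a circle
close to the boundary, and there \<open>z h'\<close> turns exactly as often as \<open>\<Theta>\<close>, hence as the tangent \<open>e\<close>, that is
once, by Hopf's theorem on turning tangents (\<open>Hopf_Umlaufsatz\<close>), and in the positive direction, since
otherwise \<open>z\<^sup>2 h'\<close> would have no zero at the origin. So \<open>h'\<close> has no zeros by the argument
principle and \<open>|k'| \<le> |h'|\<close> inside by the maximum principle. As the blending disappears, Hurwitz'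
theorem keeps \<open>h'\<close> free of zeros, and equality \<open>|k'| = |h'|\<close> at a point would make \<open>k' / h'\<close> a unimodular
constant, which forces the curve into a straight line, where \<open>T\<close> vanishes (\<open>jacobian_positive\<close>).

Global injectivity. Now \<open>w\<close> is a local diffeomorphism whose values near the circle are close to the
curve. Away from the curve it is therefore proper, thus a covering map. It cannot cover the unbounded
component since it is bounded, so it covers the interior domain, which is simply connected; hence \<open>w\<close>
is a bijection (\<open>harmonic_extension_diffeomorphism\<close>).
\<close>

section \<open>Differentiability almost everywhere of monotone Lipschitz functions\<close>

text \<open>
The one-sided Lebesgue differentiation theorem for integrals over cubes, specialised to the line.
\<close>

lemma right_derivative_of_indefinite_integral:
  fixes h :: "real \<Rightarrow> real"
  assumes int: "\<And>a b. h integrable_on {a..b}"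
    and F: "\<And>a b. a \<le> b \<Longrightarrow> F b - F a = integral {a..b} h"
  obtains N where "negligible N"
    "\<And>x. x \<notin> N \<Longrightarrow> ((\<lambda>y. (F y - F x) / (y - x)) \<longlongrightarrow> h x) (at_right x)"
proof -
  obtain N where N: "negligible N"
    "\<And>x e. \<lbrakk>x \<notin> N; 0 < e\<rbrakk> \<Longrightarrow>
        \<exists>d>0. \<forall>k. 0 < k \<and> k < d \<longrightarrow>
           norm (integral (cbox x (x + k *\<^sub>R One)) h /\<^sub>R k ^ DIM(real) - h x) < e"
    using integrable_ccontinuous_explicit[of h] int by auto
  show thesis
  proof (rule that[OF N(1)])
    fix x assume "x \<notin> N"
    show "((\<lambda>y. (F y - F x) / (y - x)) \<longlongrightarrow> h x) (at_right x)"
    proof (rule tendstoI)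
      fix e :: real assume "0 < e"
      from N(2)[OF \<open>x \<notin> N\<close> this] obtain d where d: "d > 0"
        "\<And>k. 0 < k \<and> k < d \<Longrightarrow> norm (integral {x..x+k} h / k - h x) < e"
        by (auto simp: divide_inverse_commute)
      have "dist ((F y - F x) / (y - x)) (h x) < e" if "x < y" "y < x + d" for y
        using d(2)[of "y - x"] F[of x y] that by (simp add: dist_norm)
      then show "eventually (\<lambda>y. dist ((F y - F x) / (y - x)) (h x) < e) (at_right x)"
        unfolding eventually_at_right_field using d(1) by (intro exI[of _ "x + d"]) auto
    qed
  qed
qed

lemma negligible_uminus:
  fixes S :: "real set"
  assumes "negligible S"
  shows "negligible (uminus ` S)"
proof (rule negligible_locally_Lipschitz_image[OF _ assms])
  show "\<exists>T B. open T \<and> x \<in> T \<and> (\<forall>y\<in>S \<inter> T. norm (- y - - x) \<le> B * norm (y - x))" for x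
    by (intro exI[of _ UNIV] exI[of _ 1]) auto
qed simp

text \<open>
The left-hand derivatives come from the right-hand ones by reflecting the line.
\<close>

lemma indefinite_integral_differentiable_ae:
  fixes h :: "real \<Rightarrow> real"
  assumes int: "\<And>a b. h integrable_on {a..b}"
    and F: "\<And>a b. a \<le> b \<Longrightarrow> F b - F a = integral {a..b} h"
  shows "AE t in lebesgue. (F has_real_derivative h t) (at t)"
proof -
  obtain N1 where N1: "negligible N1"
    "\<And>x. x \<notin> N1 \<Longrightarrow> ((\<lambda>y. (F y - F x) / (y - x)) \<longlongrightarrow> h x) (at_right x)"
    using right_derivative_of_indefinite_integral[OF int F] by blast
  have int': "(\<lambda>x. h (- x)) integrable_on {a..b}" for a b
    using int[of "-b" "-a"] Henstock_Kurzweil_Integration.integrable_reflect_real[of h "- a" "- b"] by simp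
  have F': "(- F (- b)) - (- F (- a)) = integral {a..b} (\<lambda>x. h (- x))" if "a \<le> b" for a b
    using F[of "-b" "-a"] that Henstock_Kurzweil_Integration.integral_reflect_real[of "- a" "- b" h] by simp
  obtain N2 where N2: "negligible N2"
    "\<And>x. x \<notin> N2 \<Longrightarrow> ((\<lambda>y. ((- F (- y)) - (- F (- x))) / (y - x)) \<longlongrightarrow> h (- x)) (at_right x)"
    using right_derivative_of_indefinite_integral[OF int' F'] by blast
  have neg: "negligible (N1 \<union> uminus ` N2)"
    using N1(1) N2(1) negligible_uminus
    by (auto simp: linear_uminus intro!: negligible_Un)
  have "(F has_real_derivative h x) (at x)" if "x \<notin> N1 \<union> uminus ` N2" for x
  proof -
    have "x \<notin> N1" "- x \<notin> N2" using that by force+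
    have "((\<lambda>y. ((- F (- y)) - (- F x)) / (y - (- x))) \<longlongrightarrow> h x) (at_right (- x))"
      using N2(2)[OF \<open>- x \<notin> N2\<close>] by simp
    then have "((\<lambda>y. (- F y + F x) / (- y + x)) \<longlongrightarrow> h x) (at_left x)"
      by (subst filterlim_at_left_to_right) simp
    moreover have "(- F y + F x) / (- y + x) = (F y - F x) / (y - x)" for y
      by (metis add.commute minus_diff_eq minus_divide_divide uminus_add_conv_diff)
    ultimately have "((\<lambda>y. (F y - F x) / (y - x)) \<longlongrightarrow> h x) (at_left x)" by simp
    with N1(2)[OF \<open>x \<notin> N1\<close>] show ?thesis
      by (simp add: has_field_derivative_iff filterlim_split_at)
  qed
  then have "{x. \<not> (F has_real_derivative h x) (at x)} \<subseteq> N1 \<union> uminus ` N2" by blast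
  with neg show ?thesis
    by (simp add: eventually_ae_filter negligible_iff_null_sets) blast
qed

text \<open>
Adding the identity makes \<open>f\<close> a homeomorphism \<open>F\<close> of the line. The image of Lebesgue measure under
its inverse is the Stieltjes measure of \<open>F\<close>; it is absolutely continuous because the Lipschitz map \<open>F\<close>
preserves null sets. So \<open>F\<close> is an indefinite integral of a Radon--Nikodym density, and the
differentiation theorem for integrals applies.
\<close>

lemma lipschitz_mono_differentiable_ae:
  fixes f :: "real \<Rightarrow> real"
  assumes mono: "mono f" and lip: "L-lipschitz_on UNIV f"
  shows "AE t in lebesgue. f differentiable at t"
proof -
  define F where "F = (\<lambda>x. f x + x)"
  have cf: "continuous_on UNIV f" using lip lipschitz_on_continuous_on by blast
  have cF: "continuous_on UNIV F" unfolding F_def by (intro continuous_intros cf)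
  have sm: "F x < F y" if "x < y" for x y
    using that monoD[OF mono, of x y] by (simp add: F_def)
  have surj: "\<exists>x. F x = y" for y
  proof -
    define a where "a = y - f 0"
    show ?thesis
    proof (cases "a \<ge> 0")
      case True
      have "F 0 \<le> y" "y \<le> F a" "0 \<le> a"
        using True monoD[OF mono True] by (auto simp: F_def a_def)
      then show ?thesis using IVT'[of F 0 y a] cF continuous_on_subset by blast
    next
      case False
      have "F a \<le> y" "y \<le> F 0" "a \<le> 0"
        using False monoD[OF mono, of a 0] by (auto simp: F_def a_def)
      then show ?thesis using IVT'[of F a y 0] cF continuous_on_subset by blast
    qed
  qed
  define G where "G = inv F"
  have "inj F" by (metis injI linorder_neqE sm less_irrefl)
  then have FG: "F (G y) = y" and GF: "G (F x) = x" for x y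
    using surj by (auto simp: G_def) (metis f_inv_into_f rangeI)
  have monoG: "mono G"
    by (metis FG monoI linorder_not_le sm)
  have G_meas[measurable]: "G \<in> borel_measurable borel"
    using borel_measurable_mono[OF monoG] .
  define M where "M = distr lborel borel G"
  have vim: "G -` A = F ` A" for A
  proof (intro equalityI subsetI)
    fix y assume "y \<in> G -` A"
    then show "y \<in> F ` A" using FG[of y] by (metis image_eqI vimageE)
  next
    fix y assume "y \<in> F ` A"
    then show "y \<in> G -` A" by (auto simp: GF)
  qed
  have emM: "emeasure M {a..b} = ennreal (F b - F a)" if "a \<le> b" for a b
  proof -
    have le: "F x \<le> F y \<longleftrightarrow> x \<le> y" for x y
      using sm[of x y] sm[of y x] by (cases x y rule: linorder_cases) auto
    have "G -` {a..b} = {F a..F b}"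
      using le[of a "G _"] le[of "G _" b] by (auto simp: FG)
    then show ?thesis
      using that sm[of a b] by (cases "a = b") (auto simp: M_def emeasure_distr)
  qed
  have ac: "absolutely_continuous lborel M"
    unfolding absolutely_continuous_def
  proof
    fix A :: "real set" assume A: "A \<in> null_sets lborel"
    then have Ab: "A \<in> sets borel" by auto
    have negA: "negligible A"
      using A by (metis negligible_iff_null_sets null_sets_completionI)
    have negF: "negligible (F ` A)"
    proof (rule negligible_locally_Lipschitz_image[OF _ negA])
      show "DIM(real) \<le> DIM(real)" by simp
      fix x assume "x \<in> A"
      have "norm (F y - F x) \<le> (L + 1) * norm (y - x)" for y
      proof -
        have "norm (F y - F x) \<le> norm (f y - f x) + norm (y - x)"
          unfolding F_def by (metis add_diff_add norm_triangle_ineq)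
        moreover have "norm (f y - f x) \<le> L * norm (y - x)"
          using lipschitz_onD[OF lip, of y x] by (simp add: dist_norm)
        ultimately show ?thesis by (simp add: algebra_simps)
      qed
      then show "\<exists>T B. open T \<and> x \<in> T \<and> (\<forall>y\<in>A \<inter> T. norm (F y - F x) \<le> B * norm (y - x))"
        by (intro exI[of _ UNIV] exI[of _ "L + 1"]) auto
    qed
    have "G -` A \<in> sets borel"
      using measurable_sets[OF G_meas Ab] by simp
    then have "F ` A \<in> null_sets lborel"
      using negF vim[of A] by (simp add: negligible_iff_null_sets null_sets_completion_iff)
    then show "A \<in> null_sets M"
      using Ab vim[of A] by (auto simp: M_def null_sets_def emeasure_distr)
  qed
  obtain k where k: "k \<in> borel_measurable lborel" "density lborel k = M"
    using sigma_finite_measure.Radon_Nikodym[OF lborel.sigma_finite_measure_axioms ac] by (auto simp: M_def)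
  have km[measurable]: "k \<in> borel_measurable borel" using k(1) by simp
  have nn: "(\<integral>\<^sup>+x. k x * indicator {a..b} x \<partial>lborel) = ennreal (F b - F a)" if "a \<le> b" for a b
  proof -
    have "(\<integral>\<^sup>+x. k x * indicator {a..b} x \<partial>lborel) = emeasure (density lborel k) {a..b}"
      by (simp add: emeasure_density)
    then show ?thesis unfolding k(2) emM[OF that] .
  qed
  have fin: "AE x in lborel. k x \<noteq> \<infinity>"
  proof -
    have "AE x in lborel. \<forall>n::nat. k x * indicator {- real n..real n} x \<noteq> \<infinity>"
      unfolding AE_all_countable
    proof
      fix n
      show "AE x in lborel. k x * indicator {- real n..real n} x \<noteq> \<infinity>"
        by (rule nn_integral_PInf_AE) (auto simp: nn)
    qed
    then show ?thesis
    proof eventually_elim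
      case (elim x)
      obtain n where "\<bar>x\<bar> \<le> real n" using real_arch_simple by blast
      then have "x \<in> {- real n..real n}" by auto
      with elim[rule_format, of n] show ?case by simp
    qed
  qed
  define h where "h x = enn2real (k x)" for x
  have hm[measurable]: "h \<in> borel_measurable borel" unfolding h_def by simp
  have hint: "(h has_integral (F b - F a)) {a..b}" if "a \<le> b" for a b
  proof -
    have "(\<integral>\<^sup>+x. ennreal (indicator {a..b} x * h x) \<partial>lborel) = (\<integral>\<^sup>+x. k x * indicator {a..b} x \<partial>lborel)"
      by (rule nn_integral_cong_AE, use fin in eventually_elim)
        (auto simp: h_def indicator_def less_top)
    then have "(\<integral>\<^sup>+x. ennreal (indicator {a..b} x * h x) \<partial>lborel) = ennreal (F b - F a)"
      using nn[OF that] by simp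
    then have "((\<lambda>x. indicator {a..b} x * h x) has_integral (F b - F a)) UNIV"
    proof (rule nn_integral_has_integral[rotated 2])
      show "0 \<le> F b - F a" using that sm[of a b] by (cases "a = b") auto
    qed (auto simp: h_def)
    moreover have "(\<lambda>x. indicator {a..b} x * h x) = (\<lambda>x. if x \<in> {a..b} then h x else 0)"
      by (auto simp: fun_eq_iff indicator_def)
    ultimately show ?thesis by (simp only: has_integral_restrict_UNIV)
  qed
  have "AE t in lebesgue. (F has_real_derivative h t) (at t)"
  proof (rule indefinite_integral_differentiable_ae)
    show "h integrable_on {a..b}" for a b
      by (cases "a \<le> b") (use hint in auto)
    show "F b - F a = integral {a..b} h" if "a \<le> b" for a b
      using hint[OF that] by (simp add: integral_unique)
  qed
  then show ?thesis
  proof eventually_elim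
    case (elim t)
    have "((\<lambda>x. F x - x) has_real_derivative (h t - 1)) (at t)"
      by (intro derivative_intros elim)
    then have "(f has_real_derivative (h t - 1)) (at t)" by (simp add: F_def)
    then show ?case unfolding real_differentiable_def by blast
  qed
qed

section \<open>The turning number of a simple closed curve\<close>

lemma derivative_of_periodic_function:
  fixes g g' :: "real \<Rightarrow> complex"
  assumes per: "\<And>s. g (s + l) = g s" and der: "\<And>s. (g has_vector_derivative g' s) (at s)"
  shows "g' (s + l) = g' s"
proof -
  have "((\<lambda>s. s + l) has_vector_derivative 1) (at s)"
    unfolding has_real_derivative_iff_has_vector_derivative[symmetric]
    by (auto intro!: derivative_eq_intros)
  from vector_diff_chain_at[OF this, of g "g' (s + l)"] der
  have "((\<lambda>s. g (s + l)) has_vector_derivative g' (s + l)) (at s)" by (simp add: o_def)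
  then show ?thesis using der[of s] per
    by (metis (no_types, lifting) ext vector_derivative_at)
qed

lemma continuous_on_mean_derivative:
  fixes g' :: "real \<Rightarrow> complex"
  assumes "continuous_on UNIV g'"
  shows "continuous_on UNIV (\<lambda>p. integral {0..1} (\<lambda>u. g' (fst p + u * snd p)))"
proof -
  have "continuous_on (UNIV \<times> cbox 0 1) (\<lambda>(p, u). g' (fst p + u * snd p))"
    unfolding split_def
    by (rule continuous_on_compose2[OF assms]) (auto intro!: continuous_intros)
  then show ?thesis
    using integral_continuous_on_param[of UNIV 0 1 "\<lambda>p u. g' (fst p + u * snd p)"] by simp
qed

text \<open>
The mean of \<open>g'\<close> over a segment is the difference quotient, but it remains meaningful and continuous
when the segment shrinks to a point.
\<close>

lemma mean_derivative_secant:
  fixes g g' :: "real \<Rightarrow> complex"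
  assumes "\<And>s. (g has_vector_derivative g' s) (at s)"
  shows "x * integral {0..1} (\<lambda>u. g' (s + u * x)) = g (s + x) - g s"
proof -
  have "((\<lambda>u. x *\<^sub>R g' (s + u * x)) has_integral (g (s + 1 * x) - g (s + 0 * x))) {0..1}"
  proof (rule fundamental_theorem_of_calculus)
    fix u :: real
    have 1: "((\<lambda>u. s + u * x) has_vector_derivative x) (at u)"
      unfolding has_real_derivative_iff_has_vector_derivative[symmetric]
      by (auto intro!: derivative_eq_intros)
    from vector_diff_chain_at[OF 1, of g "g' (s + u * x)"] assms
    have "((\<lambda>u. g (s + u * x)) has_vector_derivative (x *\<^sub>R g' (s + u * x))) (at u within {0..1})"
      by (simp add: o_def has_vector_derivative_at_within)
    then show "((\<lambda>u. g (s + u * x)) has_vector_derivative x *\<^sub>R g' (s + u * x)) (at u within {0..1})" .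
  qed simp
  from integral_unique[OF this]
  have "x *\<^sub>R integral {0..1} (\<lambda>u. g' (s + u * x)) = g (s + x) - g s"
    by simp
  then show ?thesis by (simp add: scaleR_conv_of_real)
qed

text \<open>
Two logarithms differ by a continuous function with values in a translate of \<open>2\<pi>i\<int>\<close>.
\<close>

lemma exp_eq_on_connected_imp_const_diff:
  fixes p q :: "'a::topological_space \<Rightarrow> complex"
  assumes "connected S" "continuous_on S p" "continuous_on S q"
    and "\<forall>x\<in>S. exp (p x) = c * exp (q x)" and "c \<noteq> 0"
  shows "\<exists>\<kappa>. exp \<kappa> = c \<and> (\<forall>x\<in>S. p x = q x + \<kappa>)"
proof (cases "S = {}")
  case True
  then show ?thesis using assms(5) by (intro exI[of _ "Ln c"]) auto
next
  case False
  then obtain a where a: "a \<in> S" by auto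
  have "(\<lambda>x. p x - q x) constant_on S"
  proof (rule continuous_discrete_range_constant[OF assms(1)])
    show "continuous_on S (\<lambda>x. p x - q x)" by (intro continuous_intros assms)
    fix x assume x: "x \<in> S"
    show "\<exists>e>0. \<forall>y. y \<in> S \<and> p y - q y \<noteq> p x - q x \<longrightarrow> e \<le> cmod ((p y - q y) - (p x - q x))"
    proof (intro exI conjI allI impI)
      fix y assume y: "y \<in> S \<and> p y - q y \<noteq> p x - q x"
      have "exp (p x - q x) = c" "exp (p y - q y) = c"
        using assms(4) x y by (auto simp: exp_diff)
      then have "exp (p y - q y) = exp (p x - q x)" by simp
      then obtain n :: int where n: "p y - q y = p x - q x + (of_int (2 * n) * pi) * \<i>"
        by (auto simp: exp_eq)
      then have "n \<noteq> 0" using y by auto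
      have "cmod ((p y - q y) - (p x - q x)) = 2 * pi * \<bar>real_of_int n\<bar>"
        using n by (simp add: norm_mult)
      moreover have "1 \<le> \<bar>real_of_int n\<bar>" using \<open>n \<noteq> 0\<close> by linarith
      ultimately show "2 * pi \<le> cmod ((p y - q y) - (p x - q x))"
        using pi_gt_zero by (metis mult_left_mono mult.right_neutral mult_nonneg_nonneg less_imp_le zero_le_numeral)
    qed simp
  qed
  then obtain \<kappa> where \<kappa>: "\<And>x. x \<in> S \<Longrightarrow> p x - q x = \<kappa>" unfolding constant_on_def by auto
  have "exp \<kappa> = c" using assms(4) a \<kappa>[OF a] by (auto simp: exp_diff)
  moreover have "p x = q x + \<kappa>" if "x \<in> S" for x using \<kappa>[OF that] by (simp add: algebra_simps)
  ultimately show ?thesis by blast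
qed

text \<open>
Hopf's proof. The secant directions \<open>g (s + x) - g s\<close> with \<open>0 < x < l\<close>, suitably rescaled, extend to a
nowhere vanishing continuous map \<open>\<Gamma>\<close> on the strip \<open>0 \<le> x \<le> l\<close> that equals \<open>g'\<close> on one edge and \<open>-g'\<close> on
the other. It has a logarithm there, the strip being contractible. Exchanging the two end points of a
secant changes the logarithm by a constant \<open>\<kappa>\<close>, and doing so twice is the translation by \<open>l\<close>, so the
tangent turns by \<open>2\<kappa>\<close>. The constant is read off at a lowest point of the curve, from which all
secants point into the upper half plane.
\<close>

lemma Hopf_Umlaufsatz:
  fixes g g' :: "real \<Rightarrow> complex"
  assumes l: "0 < l" and per: "\<And>s. g (s + l) = g s" and inj: "inj_on g {0..<l}"
    and der: "\<And>s. (g has_vector_derivative g' s) (at s)"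
    and cont: "continuous_on UNIV g'" and unit: "\<And>s. cmod (g' s) = 1"
  obtains \<Lambda> :: "real \<Rightarrow> complex" and \<sigma> :: real
  where "continuous_on UNIV \<Lambda>" "\<And>s. exp (\<Lambda> s) = g' s" "\<sigma> = 1 \<or> \<sigma> = -1"
    "\<And>s. \<Lambda> (s + l) = \<Lambda> s + 2 * pi * \<i> * \<sigma>"
proof -
  define q where "q s x = integral {0..1} (\<lambda>u. g' (s + u * x))" for s x :: real
  have qsec: "x * q s x = g (s + x) - g s" for s x
    unfolding q_def by (rule mean_derivative_secant[OF der])
  have q0: "q s 0 = g' s" for s by (simp add: q_def)
  have g'per: "g' (s + l) = g' s" for s
    by (rule derivative_of_periodic_function[OF per der])
  \<comment> \<open>\<open>\<Gamma> (s, x)\<close> is the secant vector times \<open>l / (x (l - x))\<close>: dividing by \<open>x\<close> alone would give \<open>0\<close>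
    at \<open>x = l\<close>\<close>
  define \<Gamma> where "\<Gamma> p = q (fst p) (snd p) - q (fst p + snd p) (l - snd p)" for p
  have qc: "continuous_on UNIV (\<lambda>p. q (fst p) (snd p))"
    unfolding q_def by (rule continuous_on_mean_derivative[OF cont])
  have \<Gamma>c: "continuous_on UNIV \<Gamma>"
  proof -
    have "continuous_on UNIV (\<lambda>p::real\<times>real. (fst p + snd p, l - snd p))"
      by (intro continuous_intros)
    from continuous_on_compose2[OF qc this] qc show ?thesis
      unfolding \<Gamma>_def by (auto intro: continuous_intros)
  qed
  have ql: "q s l = 0" for s
    using qsec[of l s] per[of s] l by simp
  have \<Gamma>0: "\<Gamma> (s, 0) = g' s" for s by (simp add: \<Gamma>_def q0 ql)
  have \<Gamma>l: "\<Gamma> (s, l) = - g' s" for s by (simp add: \<Gamma>_def q0 ql g'per)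
  have \<Gamma>in: "of_real (x * (l - x)) * \<Gamma> (s, x) = l * (g (s + x) - g s)" for s x
  proof -
    have 1: "x * q s x = g (s + x) - g s" "(l - x) * q (s + x) (l - x) = g s - g (s + x)"
      using qsec[of x s] qsec[of "l - x" "s + x"] per[of s] by auto
    have "of_real (x * (l - x)) * \<Gamma> (s, x)
       = (l - x) * (x * q s x) - x * ((l - x) * q (s + x) (l - x))"
      by (simp add: \<Gamma>_def algebra_simps)
    also have "\<dots> = l * (g (s + x) - g s)"
      unfolding 1 by (simp add: algebra_simps)
    finally show ?thesis .
  qed
  have g'nz: "g' s \<noteq> 0" for s using unit[of s] by auto
  have injl: "g (s + x) \<noteq> g s" if "0 < x" "x < l" for s x
  proof
    assume eq: "g (s + x) = g s"
    interpret periodic_fun_simple g l by unfold_locales (simp add: per)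
    define n where "n = \<lfloor>s / l\<rfloor>"
    define a where "a = s - n * l"
    have a: "0 \<le> a" "a < l"
      using floor_divide_lower[OF l, of s] floor_divide_upper[OF l, of s]
      by (auto simp: a_def n_def algebra_simps)
    have ga: "g a = g s" "g (a + x) = g (s + x)"
      using minus_of_int[of s n] minus_of_int[of "s + x" n] by (auto simp: a_def algebra_simps)
    show False
    proof (cases "a + x < l")
      case True
      then show False using inj_onD[OF inj, of "a + x" a] ga eq a that by auto
    next
      case False
      have "g (a + x - l) = g (a + x)" using per[of "a + x - l"] by simp
      then show False using inj_onD[OF inj, of "a + x - l" a] ga eq a that False by auto
    qed
  qed
  have \<Gamma>nz: "\<Gamma> (s, x) \<noteq> 0" if "0 \<le> x" "x \<le> l" for s x
  proof -
    consider "x = 0" | "x = l" | "0 < x" "x < l" using \<open>0 \<le> x\<close> \<open>x \<le> l\<close> by linarith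
    then show ?thesis
    proof cases
      case 3
      then show ?thesis using \<Gamma>in[of x s] injl[OF 3, of s] l by auto
    qed (simp_all add: \<Gamma>0 \<Gamma>l g'nz)
  qed
  have \<Gamma>sym: "\<Gamma> (s + x, l - x) = - \<Gamma> (s, x)" for s x
  proof -
    have "q (s + l) x = q s x"
      unfolding q_def by (rule integral_cong) (metis add.commute add.left_commute g'per)
    then show ?thesis by (simp add: \<Gamma>_def algebra_simps)
  qed
  define S where "S = (UNIV :: real set) \<times> {0..l}"
  have convS: "convex S" unfolding S_def by (intro convex_Times) auto
  have "continuous_on S \<Gamma>" by (rule continuous_on_subset[OF \<Gamma>c]) simp
  moreover have "\<Gamma> p \<noteq> 0" if "p \<in> S" for p
    using \<Gamma>nz[of "snd p" "fst p"] that by (simp add: S_def mem_Times_iff)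
  ultimately obtain \<Lambda>2 where \<Lambda>2: "continuous_on S \<Lambda>2" "\<And>p. p \<in> S \<Longrightarrow> \<Gamma> p = exp (\<Lambda>2 p)"
    using continuous_logarithm_on_contractible[OF _ convex_imp_contractible[OF convS]] by blast
  obtain \<kappa> where \<kappa>: "\<And>s x. 0 \<le> x \<Longrightarrow> x \<le> l \<Longrightarrow> \<Lambda>2 (s + x, l - x) = \<Lambda>2 (s, x) + \<kappa>"
  proof -
    have 1: "continuous_on S (\<lambda>p. \<Lambda>2 (fst p + snd p, l - snd p))"
      by (rule continuous_on_compose2[OF \<Lambda>2(1)]) (auto simp: S_def intro!: continuous_intros)
    have 2: "\<forall>p\<in>S. exp (\<Lambda>2 (fst p + snd p, l - snd p)) = (-1) * exp (\<Lambda>2 p)"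
    proof
      fix p assume "p \<in> S"
      then have "(fst p + snd p, l - snd p) \<in> S" by (simp add: S_def mem_Times_iff)
      from \<Lambda>2(2)[OF this] \<Lambda>2(2)[OF \<open>p \<in> S\<close>]
      show "exp (\<Lambda>2 (fst p + snd p, l - snd p)) = (-1) * exp (\<Lambda>2 p)"
        using \<Gamma>sym[of "fst p" "snd p"] by simp
    qed
    have "(-1 :: complex) \<noteq> 0" by simp
    from exp_eq_on_connected_imp_const_diff[OF convex_connected[OF convS] 1 \<Lambda>2(1) 2 this]
    obtain \<kappa> where \<kappa>: "\<forall>p\<in>S. \<Lambda>2 (fst p + snd p, l - snd p) = \<Lambda>2 p + \<kappa>"
      by blast
    have "\<Lambda>2 (s + x, l - x) = \<Lambda>2 (s, x) + \<kappa>" if "0 \<le> x" "x \<le> l" for s x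
      using bspec[OF \<kappa>, of "(s, x)"] that by (simp add: S_def)
    then show ?thesis by (rule that)
  qed
  have shift: "\<Lambda>2 (s + l, 0) = \<Lambda>2 (s, 0) + 2 * \<kappa>" for s
    using \<kappa>[of 0 s] \<kappa>[of l s] l by simp
  have gc: "continuous_on UNIV g"
    using der by (meson continuous_at_imp_continuous_on has_vector_derivative_continuous)
  \<comment> \<open>a lowest point of the curve\<close>
  obtain s0 where s0: "\<And>s. Im (g s0) \<le> Im (g s)"
  proof -
    have "continuous_on {0..l} (\<lambda>s. Im (g s))"
      by (intro continuous_intros continuous_on_subset[OF gc]) auto
    then obtain s0 where s0: "s0 \<in> {0..l}" "\<And>s. s \<in> {0..l} \<Longrightarrow> Im (g s0) \<le> Im (g s)"
      using continuous_attains_inf[of "{0..l}" "\<lambda>s. Im (g s)"] l by auto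
    interpret periodic_fun_simple g l by unfold_locales (simp add: per)
    have "Im (g s0) \<le> Im (g s)" for s
    proof -
      define n where "n = \<lfloor>s / l\<rfloor>"
      have "s - n * l \<in> {0..l}"
        using floor_divide_lower[OF l, of s] floor_divide_upper[OF l, of s]
        by (auto simp: n_def algebra_simps)
      from s0(2)[OF this] show ?thesis using minus_of_int[of s n] by simp
    qed
    then show ?thesis using that by blast
  qed
  have "Im (g' s0) = 0"
  proof -
    have "((\<lambda>s. Im (g s)) has_real_derivative Im (g' s0)) (at s0)"
      using bounded_linear.has_vector_derivative[OF bounded_linear_Im der[of s0]] by (simp add: has_real_derivative_iff_has_vector_derivative)
    then show ?thesis
      by (rule DERIV_local_min[of _ _ _ 1]) (use s0 in auto)
  qed
  then have re: "\<bar>Re (g' s0)\<bar> = 1" using unit[of s0] by (simp add: cmod_def)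
  define \<sigma> where "\<sigma> = Re (g' s0)"
  have \<sigma>: "\<sigma> = 1 \<or> \<sigma> = -1" "g' s0 = of_real \<sigma>"
    using re \<open>Im (g' s0) = 0\<close> by (auto simp: \<sigma>_def complex_eq_iff abs_if split: if_splits)
  have up: "Im (\<Gamma> (s0, x)) \<ge> 0" if "0 \<le> x" "x \<le> l" for x
  proof -
    consider "x = 0" | "x = l" | "0 < x" "x < l" using \<open>0 \<le> x\<close> \<open>x \<le> l\<close> by linarith
    then show ?thesis
    proof cases
      case 3
      have "x * (l - x) * Im (\<Gamma> (s0, x)) = l * (Im (g (s0 + x)) - Im (g s0))"
        using arg_cong[OF \<Gamma>in[of x s0], of Im]
        by (simp only: Im_complex_of_real Re_complex_of_real times_complex.sel minus_complex.sel)
      moreover have "l * (Im (g (s0 + x)) - Im (g s0)) \<ge> 0" using l s0[of "s0 + x"] by simp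
      moreover have "x * (l - x) > 0" using 3 by simp
      ultimately show ?thesis by (metis mult_pos_neg not_less)
    qed (auto simp: \<Gamma>0 \<Gamma>l \<open>Im (g' s0) = 0\<close>)
  qed
  \<comment> \<open>multiplication by \<open>-i\<close> moves the closed upper half plane to the right half plane, where the
    principal logarithm is continuous\<close>
  have nonneg: "- \<i> * \<Gamma> (s0, x) \<notin> \<real>\<^sub>\<le>\<^sub>0" if "0 \<le> x" "x \<le> l" for x
  proof
    assume "- \<i> * \<Gamma> (s0, x) \<in> \<real>\<^sub>\<le>\<^sub>0"
    then have "Im (\<Gamma> (s0, x)) \<le> 0" "Re (\<Gamma> (s0, x)) = 0"
      by (simp_all add: complex_nonpos_Reals_iff)
    then show False using up[OF that] \<Gamma>nz[OF that, of s0] by (simp add: complex_eq_iff)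
  qed
  obtain c where c: "\<And>x. x \<in> {0..l} \<Longrightarrow> \<Lambda>2 (s0, x) = Ln (- \<i> * \<Gamma> (s0, x)) + c"
  proof -
    have 1: "continuous_on {0..l} (\<lambda>x. \<Lambda>2 (s0, x))"
      by (rule continuous_on_compose2[OF \<Lambda>2(1)]) (auto simp: S_def intro!: continuous_intros)
    have 2: "continuous_on {0..l} (\<lambda>x. Ln (- \<i> * \<Gamma> (s0, x)))"
    proof (rule continuous_on_Ln')
      have "continuous_on {0..l} (\<lambda>x. \<Gamma> (s0, x))"
        by (rule continuous_on_compose2[OF \<Gamma>c]) (auto intro!: continuous_intros)
      then show "continuous_on {0..l} (\<lambda>x. - \<i> * \<Gamma> (s0, x))"
        by (rule continuous_on_mult_left)
    qed (use nonneg in auto)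
    have 3: "\<forall>x\<in>{0..l}. exp (\<Lambda>2 (s0, x)) = \<i> * exp (Ln (- \<i> * \<Gamma> (s0, x)))"
      using \<Lambda>2(2)[of "(s0, _)"] \<Gamma>nz[of _ s0] by (auto simp: S_def)
    from exp_eq_on_connected_imp_const_diff[OF connected_Icc 1 2 3 complex_i_not_zero]
    obtain c where "\<forall>x\<in>{0..l}. \<Lambda>2 (s0, x) = Ln (- \<i> * \<Gamma> (s0, x)) + c"
      by blast
    then show ?thesis using that by blast
  qed
  have "\<kappa> = Ln (\<i> * \<sigma>) - Ln (- \<i> * \<sigma>)"
    using \<kappa>[of 0 s0] c[of 0] c[of l] l \<Gamma>0[of s0] \<Gamma>l[of s0] \<sigma>(2) by simp
  also have "\<dots> = \<i> * pi * \<sigma>"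
    using \<sigma>(1) by (auto simp: Ln_ii Ln_minus_ii)
  finally have \<kappa>v: "2 * \<kappa> = 2 * pi * \<i> * \<sigma>" by simp
  show ?thesis
  proof (rule that[of "\<lambda>s. \<Lambda>2 (s, 0)" \<sigma>])
    show "continuous_on UNIV (\<lambda>s. \<Lambda>2 (s, 0))"
      by (rule continuous_on_compose2[OF \<Lambda>2(1)]) (use l in \<open>auto simp: S_def intro!: continuous_intros\<close>)
    show "exp (\<Lambda>2 (s, 0)) = g' s" for s
      using \<Lambda>2(2)[of "(s, 0)"] l \<Gamma>0[of s] by (auto simp: S_def)
    show "\<Lambda>2 (s + l, 0) = \<Lambda>2 (s, 0) + 2 * pi * \<i> * \<sigma>" for s
      using shift[of s] \<kappa>v by simp
  qed (use \<sigma> in auto)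
qed

section \<open>Zeros and the argument along a circle\<close>

text \<open>
A closed logarithm along the circle says that the image curve does not wind around \<open>0\<close>; by the
argument principle the number of zeros inside is then \<open>0\<close>.
\<close>

lemma no_zeros_if_periodic_logarithm:
  fixes H :: "complex \<Rightarrow> complex" and \<mu> :: "real \<Rightarrow> complex"
  assumes hol: "H holomorphic_on ball 0 1" and r: "0 < r" "r < 1"
    and cont: "continuous_on UNIV \<mu>" and per: "\<mu> (2 * pi) = \<mu> 0"
    and log: "\<And>t. H (of_real r * cis t) = exp (\<mu> t)"
    and z: "cmod z \<le> r"
  shows "H z \<noteq> 0"
proof
  assume Hz: "H z = 0"
  define \<gamma> where "\<gamma> = circlepath 0 r"
  define R where "R = (r + 1) / 2"
  have R: "r < R" "R < 1" using r by (auto simp: R_def)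
  have nc: "\<not> H constant_on ball 0 1"
  proof
    assume "H constant_on ball 0 1"
    then have "H (of_real r * cis 0) = H z"
      using r z by (auto simp: constant_on_def)
    then show False using log[of 0] Hz by simp
  qed
  have im: "path_image \<gamma> = sphere 0 r" using r by (simp add: \<gamma>_def)
  have nz: "H w \<noteq> 0" if "cmod w = r" for w
  proof -
    have "w = of_real r * cis (Arg w)" using that by (metis rcis_cmod_Arg rcis_def)
    then show ?thesis using log[of "Arg w"] by (metis exp_not_eq_zero)
  qed
  \<comment> \<open>in the shape in which the argument principle lists zeros and poles, the latter being absent\<close>
  define pz where "pz = {w \<in> ball 0 R. H w = 0 \<or> w \<in> {}}"
  have fin: "finite pz"
  proof (rule finite_subset)
    show "finite {w \<in> cball 0 R. H w = 0}"
      using R by (intro holomorphic_compact_finite_zeros[OF hol _ _ _ _ nc]) auto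
  qed (auto simp: pz_def)
  have vp: "valid_path \<gamma>" by (simp add: \<gamma>_def)
  have holR: "H holomorphic_on ball 0 R" using hol R by (auto intro: holomorphic_on_subset)
  have AP: "contour_integral \<gamma> (\<lambda>x. deriv H x * 1 / H x) =
      2 * pi * \<i> * (\<Sum>p\<in>pz. winding_number \<gamma> p * 1 * zorder H p)"
    unfolding pz_def
  proof (rule argument_principle)
    show "path_image \<gamma> \<subseteq> ball 0 R - {w \<in> ball 0 R. H w = 0 \<or> w \<in> {}}"
      using im nz R by (auto simp: dist_norm)
    show "\<forall>z. z \<notin> ball 0 R \<longrightarrow> winding_number \<gamma> z = 0"
      using R r by (auto simp: \<gamma>_def intro!: winding_number_zero_outside[of _ "cball 0 r"])
  qed (use holR vp fin r R in \<open>auto simp: \<gamma>_def pz_def\<close>)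
  have wn0: "winding_number (H \<circ> \<gamma>) 0 = 0"
  proof -
    define p where "p = (\<lambda>u. \<mu> (2 * pi * u))"
    have "H \<circ> \<gamma> = exp \<circ> p"
    proof
      fix u
      have "\<gamma> u = of_real r * cis (2 * pi * u)"
        by (simp add: \<gamma>_def circlepath cis_conv_exp mult_ac)
      then show "(H \<circ> \<gamma>) u = (exp \<circ> p) u" using log[of "2 * pi * u"] by (simp add: p_def)
    qed
    moreover have "path p" unfolding path_def p_def
      by (rule continuous_on_compose2[OF cont]) (auto intro!: continuous_intros)
    ultimately show ?thesis
      using winding_number_compose_exp[of p] per by (simp add: p_def pathfinish_def pathstart_def)
  qed
  have an: "H analytic_on ball 0 1" using hol by (simp add: analytic_on_open)
  have "valid_path (H \<circ> \<gamma>)"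
    by (rule valid_path_compose_analytic[OF vp an]) (use im r in auto)
  moreover have "0 \<notin> path_image (H \<circ> \<gamma>)" using im nz by (auto simp: path_image_compose)
  ultimately have "winding_number (H \<circ> \<gamma>) 0 = 1/(2*pi*\<i>) * contour_integral (H \<circ> \<gamma>) (\<lambda>w. 1/(w - 0))"
    by (rule winding_number_valid_path)
  moreover have "contour_integral (H \<circ> \<gamma>) (\<lambda>w. 1/(w - 0)) = contour_integral \<gamma> (\<lambda>x. deriv H x * (1 / (H x - 0)))"
    by (rule contour_integral_comp_analyticW[OF an vp]) (use im r in auto)
  ultimately have "contour_integral \<gamma> (\<lambda>x. deriv H x * 1 / H x) = 0"
    using wn0 by simp
  with AP have sum0: "(\<Sum>p\<in>pz. winding_number \<gamma> p * 1 * zorder H p) = 0" by simp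
  have wn: "winding_number \<gamma> p = (if cmod p < r then 1 else 0)" if "p \<in> pz" for p
  proof (cases "cmod p < r")
    case True
    then show ?thesis by (simp add: \<gamma>_def winding_number_circlepath)
  next
    case False
    moreover have "cmod p \<noteq> r" using that nz[of p] by (auto simp: pz_def)
    ultimately have "cmod p > r" by linarith
    then show ?thesis using r
      by (auto simp: \<gamma>_def intro!: winding_number_zero_outside[of _ "cball 0 r"])
  qed
  \<comment> \<open>the contributions of different zeros cannot cancel\<close>
  have zpos: "zorder H p > 0" if "p \<in> pz" for p
  proof -
    have pb: "p \<in> ball 0 1" "H p = 0" using that R by (auto simp: pz_def)
    have "H (of_real r * cis 0) \<noteq> 0" using log[of 0] by simp
    then have "eventually (\<lambda>w. H w \<noteq> 0 \<and> w \<in> ball 0 1) (at p)"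
      using pb r by (intro non_zero_neighbour_alt[OF hol, of p "of_real r * cis 0"]) auto
    then have "frequently (\<lambda>w. H w \<noteq> 0) (at p)"
      by (intro eventually_frequently) (auto elim: eventually_mono)
    then show ?thesis
      using zorder_pos_iff[OF hol open_ball pb(1)] pb(2) by simp
  qed
  have "(\<Sum>p\<in>pz. winding_number \<gamma> p * 1 * zorder H p) = of_int (\<Sum>p\<in>pz. (if cmod p < r then zorder H p else 0))"
    unfolding of_int_sum by (rule sum.cong) (auto simp: wn)
  with sum0 have "complex_of_int (\<Sum>p\<in>pz. (if cmod p < r then zorder H p else 0)) = 0" by metis
  then have "(\<Sum>p\<in>pz. (if cmod p < r then zorder H p else 0)) = 0" by (simp only: of_int_eq_0_iff)
  moreover have "(\<Sum>p\<in>pz. (if cmod p < r then zorder H p else 0)) > 0"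
  proof (rule sum_pos2[OF fin])
    have "cmod z < r" using z nz[of z] Hz by (cases "cmod z = r") auto
    then show "z \<in> pz" using R Hz by (auto simp: pz_def)
    with \<open>cmod z < r\<close> show "0 < (if cmod z < r then zorder H z else 0)" using zpos by auto
  qed (use zpos in \<open>force simp: less_imp_le\<close>)
  ultimately show False by simp
qed

section \<open>Proper local homeomorphisms of plane domains\<close>

lemma locally_injective_open_map:
  fixes w :: "complex \<Rightarrow> complex"
  assumes contw: "continuous_on U w"
    and loc: "\<And>z. z \<in> U \<Longrightarrow> \<exists>e>0. ball z e \<subseteq> U \<and> inj_on w (ball z e)"
    and V: "open V" "V \<subseteq> U"
  shows "open (w ` V)"
proof -
  have "\<exists>T. open T \<and> w z \<in> T \<and> T \<subseteq> w ` V" if "z \<in> V" for z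
  proof -
    obtain e where e: "e > 0" "ball z e \<subseteq> U" "inj_on w (ball z e)" using loc \<open>z \<in> V\<close> V(2) by blast
    have "open (w ` (ball z e \<inter> V))"
    proof (rule invariance_of_domain)
      show "continuous_on (ball z e \<inter> V) w" using contw e(2) by (blast intro: continuous_on_subset)
      show "inj_on w (ball z e \<inter> V)" using e(3) by (blast intro: inj_on_subset)
    qed (use V(1) in auto)
    then show ?thesis using e(1) \<open>z \<in> V\<close>
      by (intro exI[of _ "w ` (ball z e \<inter> V)"]) auto
  qed
  then show ?thesis by (subst open_subopen) auto
qed

text \<open>
The image is open since \<open>w\<close> is a local homeomorphism and relatively closed by properness, so it is all
of \<open>D\<close>. Fibres are compact and discrete, hence finite. Around the points of a fibre take disjoint balls
on which \<open>w\<close> is injective; what remains of the preimage of a closed disk is compact and its image misses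
the base point, so a small neighbourhood of that point is evenly covered.
\<close>

lemma proper_local_homeomorphism_imp_covering_space:
  fixes w :: "complex \<Rightarrow> complex"
  assumes U: "open U" and D: "open D" "connected D" and contw: "continuous_on U w"
    and im: "w ` U \<subseteq> D" and ne: "U \<noteq> {}"
    and loc: "\<And>z. z \<in> U \<Longrightarrow> \<exists>e>0. ball z e \<subseteq> U \<and> inj_on w (ball z e)"
    and proper: "\<And>K. compact K \<Longrightarrow> K \<subseteq> D \<Longrightarrow> compact {z \<in> U. w z \<in> K}"
  shows "covering_space U w D"
proof
  show "continuous_on U w" by fact
  have openw: "open (w ` V)" if "open V" "V \<subseteq> U" for V
    by (rule locally_injective_open_map[OF contw loc that])
  show surj: "w ` U = D"
  proof -
    have op: "open (w ` U)" using openw[OF U] by simp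
    have "closedin (top_of_set D) (w ` U)"
    proof (subst closedin_limpt, intro conjI allI impI)
      fix p assume p: "p islimpt w ` U \<and> p \<in> D"
      obtain e where e: "e > 0" "cball p e \<subseteq> D" using D(1) p open_contains_cball by blast
      define K where "K = {z \<in> U. w z \<in> cball p e}"
      have cK: "compact K" unfolding K_def by (rule proper) (use e in auto)
      have "compact (w ` K)"
        by (rule compact_continuous_image[OF continuous_on_subset[OF contw] cK]) (auto simp: K_def)
      moreover have "p islimpt w ` K"
      proof (rule islimptI)
        fix T assume T: "p \<in> T" "open T"
        have "p \<in> T \<inter> ball p e" "open (T \<inter> ball p e)" using T e by auto
        then obtain y where "y \<in> w ` U" "y \<in> T \<inter> ball p e" "y \<noteq> p"
          using p islimptE by metis
        then show "\<exists>y\<in>w ` K. y \<in> T \<and> y \<noteq> p" by (force simp: K_def)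
      qed
      ultimately have "p \<in> w ` K" using compact_imp_closed closed_limpt by blast
      then show "p \<in> w ` U" by (auto simp: K_def)
    qed (use im in auto)
    moreover have "openin (top_of_set D) (w ` U)" using op im by (simp add: openin_open_eq D(1))
    ultimately show ?thesis using D(2) ne unfolding connected_clopen by blast
  qed
  fix p assume p: "p \<in> D"
  define Fib where "Fib = {z \<in> U. w z = p}"
  have cF: "compact Fib"
  proof -
    have "compact {z \<in> U. w z \<in> {p}}" by (rule proper) (use p in auto)
    then show ?thesis by (simp add: Fib_def)
  qed
  have finF: "finite Fib"
  proof (rule ccontr)
    assume "infinite Fib"
    then obtain z where z: "z \<in> Fib" "z islimpt Fib"
      using cF by (meson compact_eq_Bolzano_Weierstrass order_refl)
    obtain e where e: "e > 0" "ball z e \<subseteq> U" "inj_on w (ball z e)" using loc z by (auto simp: Fib_def)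
    have "z \<in> ball z e" "open (ball z e)" using e by auto
    then obtain y where "y \<in> Fib" "y \<in> ball z e" "y \<noteq> z" using z(2) islimptE by metis
    then show False using e(3) z(1) e(1) by (auto simp: Fib_def inj_on_def)
  qed
  obtain e0 where e0: "\<And>z. z \<in> Fib \<Longrightarrow> e0 z > 0 \<and> ball z (e0 z) \<subseteq> U \<and> inj_on w (ball z (e0 z))"
    using loc unfolding Fib_def by (metis (mono_tags, lifting) mem_Collect_eq)
  obtain d where d: "d > 0" "\<And>z z'. z \<in> Fib \<Longrightarrow> z' \<in> Fib \<Longrightarrow> z \<noteq> z' \<Longrightarrow> dist z z' \<ge> d"
  proof -
    define A where "A = insert 1 ((\<lambda>(z, z'). dist z z') ` {q \<in> Fib \<times> Fib. fst q \<noteq> snd q})"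
    have "finite A" using finF by (simp add: A_def)
    moreover have "\<forall>a\<in>A. a > 0" by (auto simp: A_def)
    ultimately have "Min A > 0" "\<And>a. a \<in> A \<Longrightarrow> Min A \<le> a" by (auto simp: A_def)
    moreover have "dist z z' \<in> A" if "z \<in> Fib" "z' \<in> Fib" "z \<noteq> z'" for z z'
      using that by (force simp: A_def)
    ultimately show ?thesis using that by blast
  qed
  define B where "B z = ball z (min (e0 z) (d / 2))" for z
  have B: "z \<in> B z" "open (B z)" "B z \<subseteq> U" "inj_on w (B z)" if "z \<in> Fib" for z
    using e0[OF that] d(1) by (auto simp: B_def intro: inj_on_subset)
  have Bdisj: "B z \<inter> B z' = {}" if zz: "z \<in> Fib" "z' \<in> Fib" "z \<noteq> z'" for z z'
  proof (rule ccontr)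
    assume "B z \<inter> B z' \<noteq> {}"
    then obtain y where "dist z y < d / 2" "dist z' y < d / 2" by (auto simp: B_def)
    then have "dist z z' < d" using dist_triangle2[of z z' y] by (simp add: dist_commute)
    then show False using d(2)[OF zz] by simp
  qed
  obtain e1 where e1: "e1 > 0" "cball p e1 \<subseteq> D" using D(1) p open_contains_cball by blast
  \<comment> \<open>what the balls leave of the preimage of a disk: its image is compact and misses \<open>p\<close>\<close>
  define K where "K = {z \<in> U. w z \<in> cball p e1} - (\<Union>z\<in>Fib. B z)"
  have cK: "compact K" unfolding K_def
    by (intro compact_diff proper) (use e1 B in auto)
  have cwK: "closed (w ` K)"
    by (intro compact_imp_closed compact_continuous_image cK continuous_on_subset[OF contw])
       (auto simp: K_def)
  define T where "T = (ball p e1 - w ` K) \<inter> (\<Inter>z\<in>Fib. w ` B z)"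
  have pT: "p \<in> T" using e1 B(1) by (auto simp: T_def K_def Fib_def)
  have oT: "open T"
    unfolding T_def using finF B openw cwK
    by (intro open_Int open_Diff open_INT) auto
  have TD: "T \<subseteq> D" using e1(2) by (auto simp: T_def)
  define V where "V z = B z \<inter> w -` T" for z
  have oV: "open (V z)" if "z \<in> Fib" for z
  proof -
    have "continuous_on (B z) w" using B(3)[OF that] contw continuous_on_subset by blast
    then show ?thesis unfolding V_def using B(2)[OF that] oT continuous_open_preimage by blast
  qed
  have Vim: "w ` V z = T" if "z \<in> Fib" for z
  proof (intro equalityI subsetI)
    fix x assume "x \<in> T"
    then have "x \<in> w ` B z" using that by (auto simp: T_def)
    then obtain y where "y \<in> B z" "x = w y" by blast
    then show "x \<in> w ` V z" using \<open>x \<in> T\<close> by (auto simp: V_def)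
  qed (auto simp: V_def)
  show "\<exists>T. p \<in> T \<and> openin (top_of_set D) T \<and>
            (\<exists>v. \<Union>v = U \<inter> w -` T \<and> (\<forall>u\<in>v. openin (top_of_set U) u) \<and>
                 pairwise disjnt v \<and> (\<forall>u\<in>v. \<exists>q. homeomorphism u T w q))"
  proof (intro exI conjI)
    show "p \<in> T" by fact
    show "openin (top_of_set D) T" using oT TD by (simp add: openin_open_eq D(1))
    show "\<Union>(V ` Fib) = U \<inter> w -` T"
    proof (intro equalityI subsetI)
      fix x assume "x \<in> U \<inter> w -` T"
      then have "x \<in> U" "w x \<in> T" by auto
      then have "x \<in> (\<Union>z\<in>Fib. B z)" by (auto simp: T_def K_def)
      then show "x \<in> \<Union>(V ` Fib)" using \<open>w x \<in> T\<close> by (auto simp: V_def)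
    qed (use B(3) in \<open>auto simp: V_def\<close>)
    show "\<forall>u\<in>V ` Fib. openin (top_of_set U) u"
      using oV B(3) U by (auto simp: openin_open_eq V_def)
    show "pairwise disjnt (V ` Fib)"
      using Bdisj by (fastforce simp: pairwise_def disjnt_def V_def)
    show "\<forall>u\<in>V ` Fib. \<exists>q. homeomorphism u T w q"
    proof
      fix u assume "u \<in> V ` Fib"
      then obtain z where z: "z \<in> Fib" "u = V z" by auto
      have "V z \<subseteq> U" using B(3)[OF z(1)] by (auto simp: V_def)
      have "inj_on w (V z)" using B(4)[OF z(1)] by (auto simp: V_def intro: inj_on_subset)
      then obtain q where "homeomorphism (V z) (w ` V z) w q"
        using invariance_of_domain_homeomorphism[OF oV[OF z(1)] continuous_on_subset[OF contw \<open>V z \<subseteq> U\<close>]]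
        by auto
      then show "\<exists>q. homeomorphism u T w q" using Vim[OF z(1)] z(2) by auto
    qed
  qed
qed

text \<open>
The identity of \<open>D\<close> lifts to a section \<open>s\<close>. Its image is open by invariance of domain and closed as the
set where \<open>s \<circ> w\<close> is the identity, so it is everything.
\<close>

lemma covering_space_of_simply_connected_inj:
  fixes w :: "complex \<Rightarrow> complex"
  assumes cov: "covering_space U w D" and U: "open U" "connected U"
    and D: "open D" "simply_connected D"
    and loc: "\<And>z. z \<in> U \<Longrightarrow> \<exists>e>0. ball z e \<subseteq> U \<and> inj_on w (ball z e)"
  shows "inj_on w U"
proof (cases "U = {}")
  case False
  have contw: "continuous_on U w" and im: "w ` U = D"
    using covering_space_imp_continuous[OF cov] covering_space_imp_surjective[OF cov] by auto
  have "locally path_connected D" using D(1) open_imp_locally_path_connected by blast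
  with covering_space_lift[OF cov D(2), of id] obtain s where
    s: "continuous_on D s" "s \<in> D \<rightarrow> U" "\<And>y. y \<in> D \<Longrightarrow> w (s y) = y"
    by (auto simp: Pi_def)
  have "inj_on s D" using s(3) by (metis inj_onI)
  then have "open (s ` D)" using invariance_of_domain[OF s(1) D(1)] by simp
  then have 1: "openin (top_of_set U) (s ` D)" using s(2) U(1) by (auto simp: openin_open_eq)
  have "s ` D = {z \<in> U. s (w z) = z}"
    using s im by (auto simp: image_iff) (metis+)
  moreover have "closedin (top_of_set U) {z \<in> U. s (w z) = z}"
  proof -
    have "continuous_on U (\<lambda>z. s (w z) - z)"
      by (intro continuous_intros continuous_on_compose2[OF s(1) contw]) (use im in auto)
    from continuous_closedin_preimage_constant[OF this, of 0] show ?thesis by simp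
  qed
  ultimately have "s ` D = U"
    using 1 U(2) False im connected_clopen[of U] by (metis image_is_empty)
  then have "s (w z) = z" if "z \<in> U" for z using that s(3) by (metis imageE)
  then show ?thesis by (metis inj_onI)
qed auto

section \<open>Smoothness of planar harmonic maps and their inverses\<close>

text \<open>
The holomorphic functions and all rational expressions, with zero-free denominators, in them and their
conjugates. This class is large enough to express the derivative of a harmonic map and of its inverse, and
closed under differentiation, so smoothness can be proved without handling iterated derivatives.
\<close>

inductive smooth_symbol :: "complex set \<Rightarrow> (complex \<Rightarrow> complex) \<Rightarrow> bool" for U where
  hol: "H holomorphic_on U \<Longrightarrow> smooth_symbol U H"
| add: "smooth_symbol U p \<Longrightarrow> smooth_symbol U q \<Longrightarrow> smooth_symbol U (\<lambda>z. p z + q z)"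
| mult: "smooth_symbol U p \<Longrightarrow> smooth_symbol U q \<Longrightarrow> smooth_symbol U (\<lambda>z. p z * q z)"
| cnj: "smooth_symbol U p \<Longrightarrow> smooth_symbol U (\<lambda>z. cnj (p z))"
| inverse: "smooth_symbol U p \<Longrightarrow> (\<And>z. z \<in> U \<Longrightarrow> p z \<noteq> 0) \<Longrightarrow> smooth_symbol U (\<lambda>z. inverse (p z))"

lemma Ck_on_cong:
  assumes "open S" "\<And>x. x \<in> S \<Longrightarrow> h x = h' x"
  shows "Ck_on k h S \<longleftrightarrow> Ck_on k h' S"
  using assms(2)
proof (induction k arbitrary: h h')
  case 0
  then show ?case using continuous_on_cong[of S S h h'] by simp
next
  case (Suc k)
  have der: "(h has_derivative D) (at x) \<longleftrightarrow> (h' has_derivative D) (at x)" if "x \<in> S" for x D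
    using has_derivative_transform_within_open[OF _ assms(1) that] Suc.prems by metis
  then have fd: "frechet_derivative h (at x) = frechet_derivative h' (at x)" if "x \<in> S" for x
    using that by (simp add: frechet_derivative_def)
  have "Ck_on k (\<lambda>x. frechet_derivative h (at x) v) S \<longleftrightarrow> Ck_on k (\<lambda>x. frechet_derivative h' (at x) v) S" for v
    by (rule Suc.IH) (simp add: fd)
  then show ?case using der by (simp add: differentiable_def)
qed

text \<open>
Coinduction for smoothness: any class of differentiable functions whose directional derivatives stay in
the class consists of smooth functions.
\<close>

lemma smooth_onI_closed_under_derivatives:
  assumes S: "open S" and \<P>: "\<P> h"
    and step: "\<And>h. \<P> h \<Longrightarrow> \<exists>D. (\<forall>x\<in>S. (h has_derivative D x) (at x)) \<and> (\<forall>v. \<P> (\<lambda>x. D x v))"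
  shows "smooth_on h S"
  unfolding smooth_on_def
proof
  fix k show "Ck_on k h S" using \<P>
  proof (induction k arbitrary: h)
    case 0
    obtain D where "\<forall>x\<in>S. (h has_derivative D x) (at x)" using step[OF 0] by blast
    then have "\<forall>x\<in>S. isCont h x" using has_derivative_continuous by blast
    then show ?case by (simp add: continuous_at_imp_continuous_on)
  next
    case (Suc k)
    obtain D where D: "\<forall>x\<in>S. (h has_derivative D x) (at x)" "\<forall>v. \<P> (\<lambda>x. D x v)"
      using step[OF Suc.prems] by blast
    have "Ck_on k (\<lambda>x. frechet_derivative h (at x) v) S" for v
    proof -
      have "frechet_derivative h (at x) = D x" if "x \<in> S" for x
        using D(1) that frechet_derivative_at by fastforce
      then have "Ck_on k (\<lambda>x. frechet_derivative h (at x) v) S \<longleftrightarrow> Ck_on k (\<lambda>x. D x v) S"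
        by (intro Ck_on_cong S) simp
      then show ?thesis using Suc.IH D(2) by blast
    qed
    then show ?case using D(1) by (auto simp: differentiable_def)
  qed
qed

text \<open>
If the derivative of \<open>\<phi>\<close> is itself a symbol evaluated at \<open>\<phi>\<close>, as in an autonomous differential equation,
then the functions \<open>p \<circ> \<phi>\<close> with \<open>p\<close> a symbol are closed under differentiation. For \<open>\<phi>\<close> the identity this
gives smoothness of a harmonic map, for \<open>\<phi>\<close> its inverse smoothness of the inverse.
\<close>

lemma smooth_symbol_comp_derivative:
  assumes "open U" and p: "smooth_symbol U p"
    and \<phi>: "\<And>x. x \<in> S \<Longrightarrow> (\<phi> has_derivative \<Phi> x) (at x)" "\<And>x. x \<in> S \<Longrightarrow> \<phi> x \<in> U"
    and \<Phi>: "\<And>v. smooth_symbol U (N v)" "\<And>x v. x \<in> S \<Longrightarrow> \<Phi> x v = N v (\<phi> x)"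
  shows "\<exists>D. (\<forall>x\<in>S. ((\<lambda>x. p (\<phi> x)) has_derivative D x) (at x)) \<and>
             (\<forall>v. \<exists>q. smooth_symbol U q \<and> (\<forall>x\<in>S. D x v = q (\<phi> x)))"
  using p
proof (induction)
  case (hol H)
  have "((\<lambda>x. H (\<phi> x)) has_derivative (\<lambda>v. deriv H (\<phi> x) * \<Phi> x v)) (at x)" if "x \<in> S" for x
  proof -
    have "(H has_derivative (*) (deriv H (\<phi> x))) (at (\<phi> x))"
      using holomorphic_derivI[OF hol \<open>open U\<close> \<phi>(2)[OF that]] by (simp add: has_field_derivative_def)
    from has_derivative_compose[OF \<phi>(1)[OF that] this] show ?thesis by simp
  qed
  moreover have "\<exists>q. smooth_symbol U q \<and> (\<forall>x\<in>S. deriv H (\<phi> x) * \<Phi> x v = q (\<phi> x))" for v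
    using smooth_symbol.mult[OF smooth_symbol.hol[OF holomorphic_deriv[OF hol \<open>open U\<close>]] \<Phi>(1)[of v]]
    by (intro exI[of _ "\<lambda>z. deriv H z * N v z"]) (simp add: \<Phi>(2))
  ultimately show ?case by (intro exI[of _ "\<lambda>x v. deriv H (\<phi> x) * \<Phi> x v"]) blast
next
  case (add p q)
  from add.IH obtain D E where D: "\<forall>x\<in>S. ((\<lambda>x. p (\<phi> x)) has_derivative D x) (at x)"
      "\<And>v. \<exists>q. smooth_symbol U q \<and> (\<forall>x\<in>S. D x v = q (\<phi> x))"
    and E: "\<forall>x\<in>S. ((\<lambda>x. q (\<phi> x)) has_derivative E x) (at x)"
      "\<And>v. \<exists>q. smooth_symbol U q \<and> (\<forall>x\<in>S. E x v = q (\<phi> x))" by blast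
  have "\<exists>r. smooth_symbol U r \<and> (\<forall>x\<in>S. D x v + E x v = r (\<phi> x))" for v
  proof -
    obtain r s where "smooth_symbol U r" "smooth_symbol U s"
      "\<forall>x\<in>S. D x v = r (\<phi> x)" "\<forall>x\<in>S. E x v = s (\<phi> x)" using D(2) E(2) by meson
    then show ?thesis by (intro exI[of _ "\<lambda>z. r z + s z"]) (auto intro: smooth_symbol.add)
  qed
  then show ?case using D(1) E(1)
    by (intro exI[of _ "\<lambda>x v. D x v + E x v"]) (auto intro!: has_derivative_add)
next
  case (mult p q)
  from mult.IH obtain D E where D: "\<forall>x\<in>S. ((\<lambda>x. p (\<phi> x)) has_derivative D x) (at x)"
      "\<And>v. \<exists>q. smooth_symbol U q \<and> (\<forall>x\<in>S. D x v = q (\<phi> x))"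
    and E: "\<forall>x\<in>S. ((\<lambda>x. q (\<phi> x)) has_derivative E x) (at x)"
      "\<And>v. \<exists>q. smooth_symbol U q \<and> (\<forall>x\<in>S. E x v = q (\<phi> x))" by blast
  have "\<exists>r. smooth_symbol U r \<and> (\<forall>x\<in>S. p (\<phi> x) * E x v + D x v * q (\<phi> x) = r (\<phi> x))" for v
  proof -
    obtain r s where "smooth_symbol U r" "smooth_symbol U s"
      "\<forall>x\<in>S. D x v = r (\<phi> x)" "\<forall>x\<in>S. E x v = s (\<phi> x)" using D(2) E(2) by meson
    then show ?thesis using mult.hyps
      by (intro exI[of _ "\<lambda>z. p z * s z + r z * q z"]) (auto intro!: smooth_symbol.add smooth_symbol.mult)
  qed
  then show ?case using D(1) E(1)
    by (intro exI[of _ "\<lambda>x v. p (\<phi> x) * E x v + D x v * q (\<phi> x)"]) (auto intro!: has_derivative_mult)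
next
  case (cnj p)
  from cnj.IH obtain D where D: "\<forall>x\<in>S. ((\<lambda>x. p (\<phi> x)) has_derivative D x) (at x)"
      "\<And>v. \<exists>q. smooth_symbol U q \<and> (\<forall>x\<in>S. D x v = q (\<phi> x))" by blast
  have "\<exists>r. smooth_symbol U r \<and> (\<forall>x\<in>S. cnj (D x v) = r (\<phi> x))" for v
  proof -
    obtain r where "smooth_symbol U r" "\<forall>x\<in>S. D x v = r (\<phi> x)" using D(2) by meson
    then show ?thesis by (intro exI[of _ "\<lambda>z. cnj (r z)"]) (auto intro: smooth_symbol.cnj)
  qed
  then show ?case using D(1)
    by (intro exI[of _ "\<lambda>x v. cnj (D x v)"]) (auto intro!: has_derivative_cnj)
next
  case (inverse p)
  from inverse.IH obtain D where D: "\<forall>x\<in>S. ((\<lambda>x. p (\<phi> x)) has_derivative D x) (at x)"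
      "\<And>v. \<exists>q. smooth_symbol U q \<and> (\<forall>x\<in>S. D x v = q (\<phi> x))" by blast
  have "\<exists>r. smooth_symbol U r \<and>
      (\<forall>x\<in>S. - (inverse (p (\<phi> x)) * D x v * inverse (p (\<phi> x))) = r (\<phi> x))" for v
  proof -
    obtain r where "smooth_symbol U r" "\<forall>x\<in>S. D x v = r (\<phi> x)" using D(2) by meson
    moreover have "smooth_symbol U (\<lambda>z. inverse (p z))" by (rule smooth_symbol.inverse) fact+
    moreover have "smooth_symbol U (\<lambda>_. -1)" by (rule smooth_symbol.hol) simp
    ultimately have "smooth_symbol U (\<lambda>z. (-1) * ((inverse (p z) * r z) * inverse (p z)))"
      by (intro smooth_symbol.mult)
    then show ?thesis using \<open>\<forall>x\<in>S. D x v = r (\<phi> x)\<close>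
      by (intro exI[of _ "\<lambda>z. (-1) * ((inverse (p z) * r z) * inverse (p z))"]) simp
  qed
  moreover have "((\<lambda>x. inverse (p (\<phi> x))) has_derivative
      (\<lambda>v. - (inverse (p (\<phi> x)) * D x v * inverse (p (\<phi> x))))) (at x)" if "x \<in> S" for x
    using that D(1) inverse.hyps \<phi>(2) by (intro Deriv.has_derivative_inverse) auto
  ultimately show ?case
    by (intro exI[of _ "\<lambda>x v. - (inverse (p (\<phi> x)) * D x v * inverse (p (\<phi> x)))"]) blast
qed

lemma smooth_symbol_comp_smooth_on:
  assumes "open U" "open S" and p: "smooth_symbol U p"
    and \<phi>: "\<And>x. x \<in> S \<Longrightarrow> (\<phi> has_derivative \<Phi> x) (at x)" "\<And>x. x \<in> S \<Longrightarrow> \<phi> x \<in> U"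
    and \<Phi>: "\<And>v. smooth_symbol U (N v)" "\<And>x v. x \<in> S \<Longrightarrow> \<Phi> x v = N v (\<phi> x)"
  shows "smooth_on (\<lambda>x. p (\<phi> x)) S"
proof (rule smooth_onI_closed_under_derivatives[where
      \<P> = "\<lambda>h. \<exists>q. smooth_symbol U q \<and> (\<forall>x\<in>S. h x = q (\<phi> x))", OF \<open>open S\<close>])
  show "\<exists>q. smooth_symbol U q \<and> (\<forall>x\<in>S. p (\<phi> x) = q (\<phi> x))" using p by blast
  fix h assume "\<exists>q. smooth_symbol U q \<and> (\<forall>x\<in>S. h x = q (\<phi> x))"
  then obtain q where q: "smooth_symbol U q" "\<forall>x\<in>S. h x = q (\<phi> x)" by blast
  obtain D where D: "\<forall>x\<in>S. ((\<lambda>x. q (\<phi> x)) has_derivative D x) (at x)"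
    "\<forall>v. \<exists>q. smooth_symbol U q \<and> (\<forall>x\<in>S. D x v = q (\<phi> x))"
  proof -
    have "\<exists>D. (\<forall>x\<in>S. ((\<lambda>x. q (\<phi> x)) has_derivative D x) (at x)) \<and>
             (\<forall>v. \<exists>q. smooth_symbol U q \<and> (\<forall>x\<in>S. D x v = q (\<phi> x)))"
      by (rule smooth_symbol_comp_derivative[OF assms(1) q(1), where \<Phi> = \<Phi> and N = N]) (fact \<phi> \<Phi>)+
    then show ?thesis using that by blast
  qed
  have "(h has_derivative D x) (at x)" if "x \<in> S" for x
    using has_derivative_transform_within_open[OF bspec[OF D(1) that] \<open>open S\<close> that] q(2) by simp
  then show "\<exists>D. (\<forall>x\<in>S. (h has_derivative D x) (at x)) \<and>
      (\<forall>v. \<exists>q. smooth_symbol U q \<and> (\<forall>x\<in>S. D x v = q (\<phi> x)))"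
    using D(2) by blast
qed

lemma harmonic_has_derivative:
  assumes "(h has_field_derivative a) (at z)" "(k has_field_derivative b) (at z)"
  shows "((\<lambda>z. h z + cnj (k z)) has_derivative (\<lambda>v. a * v + cnj (b * v))) (at z)"
  using assms unfolding has_field_derivative_def
  by (intro has_derivative_add has_derivative_cnj)

lemma jacobian_det_harmonic:
  assumes "(h has_field_derivative a) (at z)" "(k has_field_derivative b) (at z)"
  shows "jacobian_det (\<lambda>z. h z + cnj (k z)) z = (cmod a)\<^sup>2 - (cmod b)\<^sup>2"
proof -
  have "frechet_derivative (\<lambda>z. h z + cnj (k z)) (at z) = (\<lambda>v. a * v + cnj (b * v))"
    using harmonic_has_derivative[OF assms] frechet_derivative_at by metis
  then show ?thesis
    by (simp add: jacobian_det_def cmod_def algebra_simps power2_eq_square)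
qed

lemma harmonic_smooth_on:
  assumes "open U" and h: "h holomorphic_on U" and k: "k holomorphic_on U"
  shows "smooth_on (\<lambda>z. h z + cnj (k z)) U"
proof -
  have "smooth_symbol U (\<lambda>z. h z + cnj (k z))"
    by (intro smooth_symbol.add smooth_symbol.cnj smooth_symbol.hol h k)
  from smooth_symbol_comp_smooth_on[OF assms(1) assms(1) this, of "\<lambda>x. x" "\<lambda>_ v. v" "\<lambda>v _. v"]
  show ?thesis by (simp add: smooth_symbol.hol)
qed

text \<open>
The derivative \<open>v \<mapsto> a v + cnj (b v)\<close> is inverted by Cramer's rule, its determinant being
\<open>|a|\<^sup>2 - |b|\<^sup>2\<close>.
\<close>

lemma harmonic_locally_injective:
  assumes "open U" and h: "h holomorphic_on U" and k: "k holomorphic_on U"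
    and J: "\<And>z. z \<in> U \<Longrightarrow> cmod (deriv k z) < cmod (deriv h z)" and z: "z \<in> U"
  shows "\<exists>e>0. ball z e \<subseteq> U \<and> inj_on (\<lambda>z. h z + cnj (k z)) (ball z e)"
proof -
  define w where "w = (\<lambda>z. h z + cnj (k z))"
  define w' where "w' z v = deriv h z * v + cnj (deriv k z * v)" for z v
  have der: "(w has_derivative w' z) (at z)" if "z \<in> U" for z
    unfolding w_def w'_def
    by (intro harmonic_has_derivative holomorphic_derivI[OF h] holomorphic_derivI[OF k]) (use assms that in auto)
  define a b where "a = deriv h z" and "b = deriv k z"
  define j where "j = a * cnj a - b * cnj b"
  have "j = of_real ((cmod a)\<^sup>2 - (cmod b)\<^sup>2)"
    by (simp add: j_def complex_norm_square[symmetric])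
  moreover have "(cmod b)\<^sup>2 < (cmod a)\<^sup>2" using J[OF z] by (simp add: a_def b_def power_strict_mono)
  ultimately have j: "j \<noteq> 0" by (metis diff_gt_0_iff_gt less_irrefl of_real_eq_0_iff)
  define g' where "g' u = (cnj a * u - cnj b * cnj u) / j" for u
  obtain e where "e > 0" "ball z e \<subseteq> U" "inj_on w (ball z e)"
  proof (rule has_derivative_locally_injective[OF z \<open>open U\<close>, of g' w' w])
    show "bounded_linear g'" unfolding g'_def
      by (rule bounded_linear_compose[OF bounded_linear_divide])
         (intro bounded_linear_sub bounded_linear_const_mult bounded_linear_cnj bounded_linear_ident)
    show "g' \<circ> w' z = id"
    proof
      fix v
      have "cnj a * (a * v + cnj (b * v)) - cnj b * cnj (a * v + cnj (b * v)) = j * v"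
        by (simp add: j_def algebra_simps)
      then show "(g' \<circ> w' z) v = id v" using j by (simp add: g'_def w'_def a_def b_def)
    qed
    fix e :: real assume "e > 0"
    have "isCont (deriv h) z" "isCont (deriv k) z"
      using holomorphic_deriv[OF h] holomorphic_deriv[OF k] assms
      by (metis continuous_on_eq_continuous_at holomorphic_on_imp_continuous_on)+
    then obtain d1 d2 where d: "d1 > 0" "d2 > 0"
      "\<And>x. dist x z < d1 \<Longrightarrow> dist (deriv h x) (deriv h z) < e / 3"
      "\<And>x. dist x z < d2 \<Longrightarrow> dist (deriv k x) (deriv k z) < e / 3"
      using \<open>e > 0\<close> unfolding continuous_at_eps_delta by (metis zero_less_divide_iff zero_less_numeral)
    have "onorm (\<lambda>v. w' x v - w' z v) < e" if "dist z x < min d1 d2" for x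
    proof -
      have "cmod (w' x v - w' z v) \<le> (2 * e / 3) * cmod v" for v
      proof -
        have "w' x v - w' z v = (deriv h x - deriv h z) * v + cnj ((deriv k x - deriv k z) * v)"
          by (simp add: w'_def algebra_simps)
        then have "cmod (w' x v - w' z v) \<le> cmod (deriv h x - deriv h z) * cmod v + cmod (deriv k x - deriv k z) * cmod v"
          by (metis complex_mod_cnj norm_mult norm_triangle_ineq)
        also have "\<dots> \<le> e / 3 * cmod v + e / 3 * cmod v"
          using d(3)[of x] d(4)[of x] that
          by (intro add_mono mult_right_mono) (auto simp: dist_norm norm_minus_commute dist_commute)
        finally show ?thesis by simp
      qed
      then have "onorm (\<lambda>v. w' x v - w' z v) \<le> 2 * e / 3" by (rule onorm_bound[rotated]) (use \<open>e > 0\<close> in auto)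
      then show ?thesis using \<open>e > 0\<close> by simp
    qed
    then show "\<exists>d>0. \<forall>x. dist z x < d \<longrightarrow> onorm (\<lambda>v. w' x v - w' z v) < e"
      using d by (intro exI[of _ "min d1 d2"]) auto
  qed (use der in auto)
  then show ?thesis unfolding w_def by blast
qed

text \<open>
By Cramer's rule the derivative of the inverse \<open>\<phi>\<close> at \<open>y\<close> is a rational expression in \<open>h'\<close>, \<open>k'\<close> and
their conjugates, evaluated at \<open>\<phi> y\<close>; that is the situation of \<open>smooth_symbol_comp_smooth_on\<close>.
\<close>

lemma harmonic_inverse_smooth_on:
  assumes "open U" and h: "h holomorphic_on U" and k: "k holomorphic_on U"
    and J: "\<And>z. z \<in> U \<Longrightarrow> cmod (deriv k z) < cmod (deriv h z)"
    and inj: "inj_on (\<lambda>z. h z + cnj (k z)) U"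
  shows "smooth_on (the_inv_into U (\<lambda>z. h z + cnj (k z))) ((\<lambda>z. h z + cnj (k z)) ` U)"
proof -
  define w where "w = (\<lambda>z. h z + cnj (k z))"
  define \<phi> where "\<phi> = the_inv_into U w"
  define a b where "a = deriv h" and "b = deriv k"
  define j where "j z = a z * cnj (a z) + (-1) * (b z * cnj (b z))" for z
  have j: "j z \<noteq> 0" if "z \<in> U" for z
  proof -
    have "j z = of_real ((cmod (a z))\<^sup>2 - (cmod (b z))\<^sup>2)"
      by (simp add: j_def complex_norm_square[symmetric])
    moreover have "(cmod (b z))\<^sup>2 < (cmod (a z))\<^sup>2" using J[OF that] by (simp add: a_def b_def power_strict_mono)
    ultimately show ?thesis by (metis diff_gt_0_iff_gt less_irrefl of_real_eq_0_iff)
  qed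
  have ha: "a holomorphic_on U" "b holomorphic_on U" unfolding a_def b_def
    using h k \<open>open U\<close> by (auto intro: holomorphic_deriv)
  have contw: "continuous_on U w" unfolding w_def
    using h k by (intro continuous_intros holomorphic_on_imp_continuous_on)
  have injw: "inj_on w U" using inj by (simp add: w_def)
  have opw: "open (w ` U)" by (rule invariance_of_domain[OF contw \<open>open U\<close> injw])
  obtain q where q: "homeomorphism U (w ` U) w q"
    using invariance_of_domain_homeomorphism[OF \<open>open U\<close> contw _ injw] by auto
  have \<phi>w: "\<phi> (w z) = z" if "z \<in> U" for z unfolding \<phi>_def by (rule the_inv_into_f_f[OF injw that])
  have "\<phi> y = q y" if "y \<in> w ` U" for y using that \<phi>w q by (auto simp: homeomorphism_def)
  then have cont\<phi>: "continuous_on (w ` U) \<phi>" using q continuous_on_cong[of "w ` U" "w ` U" \<phi> q]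
    by (auto simp: homeomorphism_def)
  define N where "N v z = (cnj (a z) * v + (-1) * (cnj (b z) * cnj v)) * inverse (j z)" for v z
  have "smooth_on (\<lambda>x. id (\<phi> x)) (w ` U)"
  proof (rule smooth_symbol_comp_smooth_on[OF \<open>open U\<close> opw, where N = N and p = id and \<phi> = \<phi> and \<Phi> = "\<lambda>x v. N v (\<phi> x)"])
    show "smooth_symbol U id" by (rule smooth_symbol.hol) (simp add: id_def)
    show "smooth_symbol U (N v)" for v
      unfolding N_def j_def
      by (intro smooth_symbol.add smooth_symbol.mult smooth_symbol.cnj smooth_symbol.inverse
          smooth_symbol.hol ha holomorphic_on_const) (use j in \<open>simp add: j_def\<close>)
    fix x assume "x \<in> w ` U"
    then obtain z where z: "z \<in> U" "x = w z" by blast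
    show "\<phi> x \<in> U" using z \<phi>w by simp
    have "(w has_derivative (\<lambda>v. a z * v + cnj (b z * v))) (at z)"
      unfolding w_def a_def b_def
      by (intro harmonic_has_derivative holomorphic_derivI[OF h] holomorphic_derivI[OF k]) (use assms z in auto)
    moreover have "bounded_linear (\<lambda>v. N v z)" unfolding N_def
      by (intro bounded_linear_mult_const bounded_linear_add bounded_linear_const_mult bounded_linear_cnj bounded_linear_ident bounded_linear_compose[OF _ bounded_linear_cnj])
    moreover have "(\<lambda>v. N v z) \<circ> (\<lambda>v. a z * v + cnj (b z * v)) = id"
    proof
      fix v
      have "cnj (a z) * (a z * v + cnj (b z * v)) + (-1) * (cnj (b z) * cnj (a z * v + cnj (b z * v))) = j z * v"
        by (simp add: j_def algebra_simps)
      then show "((\<lambda>v. N v z) \<circ> (\<lambda>v. a z * v + cnj (b z * v))) v = id v"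
        using j[OF z(1)] by (simp add: N_def field_simps)
    qed
    ultimately have "(\<phi> has_derivative (\<lambda>v. N v z)) (at (w z))"
      using has_derivative_inverse_dieudonne[OF \<open>open U\<close> opw contw cont\<phi> \<phi>w z(1)] by blast
    then show "(\<phi> has_derivative (\<lambda>v. N v (\<phi> x))) (at x)" using z \<phi>w by simp
  qed auto
  then show ?thesis by (simp add: \<phi>_def w_def)
qed

lemma diffeomorphism_onto_cong:
  assumes U: "open U" and eq: "\<And>z. z \<in> U \<Longrightarrow> w z = v z" and v: "diffeomorphism_onto v U D"
  shows "diffeomorphism_onto w U D"
proof -
  have "the_inv_into U w = the_inv_into U v"
    unfolding the_inv_into_def using eq by (intro ext arg_cong[of _ _ The]) auto
  moreover have "bij_betw w U D" using v eq bij_betw_cong[of U w v D] by (simp add: diffeomorphism_onto_def)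
  moreover have "smooth_on w U"
    using v Ck_on_cong[OF U, of w v] eq by (simp add: diffeomorphism_onto_def smooth_on_def)
  ultimately show ?thesis using v by (simp add: diffeomorphism_onto_def)
qed

section \<open>The polar derivatives of the Poisson kernel\<close>

definition kernel_denom :: "real \<Rightarrow> real \<Rightarrow> real" where
  "kernel_denom r x = 1 - 2 * r * cos x + r\<^sup>2"

text \<open>
This is \<open>r\<close> times the radial derivative of the Poisson kernel; at \<open>r = 1\<close> it is
\<open>- 1 / (4\<pi> sin\<^sup>2 (x/2))\<close>.
\<close>

definition radial_kernel :: "real \<Rightarrow> real \<Rightarrow> real" where
  "radial_kernel r x = r * ((1 + r\<^sup>2) * cos x - 2 * r) / (pi * (kernel_denom r x)\<^sup>2)"

text \<open>
This is minus the derivative of the Poisson kernel in the angle.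
\<close>

definition angular_kernel :: "real \<Rightarrow> real \<Rightarrow> real" where
  "angular_kernel r x = r * (1 - r\<^sup>2) * sin x / (pi * (kernel_denom r x)\<^sup>2)"

lemma kernel_denom_eq: "kernel_denom r x = (1 - r)\<^sup>2 + 4 * r * (sin (x / 2))\<^sup>2"
proof -
  have "cos x = 1 - 2 * (sin (x / 2))\<^sup>2" using cos_double_sin[of "x / 2"] by simp
  then show ?thesis unfolding kernel_denom_def by (simp only: power2_eq_square) (simp add: algebra_simps)
qed

lemma kernel_denom_pos: "\<bar>r\<bar> < 1 \<Longrightarrow> 0 < kernel_denom r x"
proof -
  assume r: "\<bar>r\<bar> < 1"
  have "2 * r * cos x \<le> 2 * \<bar>r\<bar>"
  proof -
    have "r * cos x \<le> \<bar>r\<bar> * \<bar>cos x\<bar>" by (metis abs_ge_self abs_mult)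
    also have "\<dots> \<le> \<bar>r\<bar> * 1" by (intro mult_left_mono) auto
    finally show ?thesis by simp
  qed
  moreover have "(1 - \<bar>r\<bar>)\<^sup>2 > 0" using r by simp
  moreover have "(1 - \<bar>r\<bar>)\<^sup>2 = 1 - 2 * \<bar>r\<bar> + r\<^sup>2" by (simp add: power2_diff)
  ultimately show ?thesis unfolding kernel_denom_def by linarith
qed

text \<open>
Jordan's inequality with a worse constant, which the Taylor bound of order three supplies.
\<close>

lemma sin_ge_third:
  fixes y :: real
  assumes "0 \<le> y" "y \<le> pi / 2"
  shows "y / 3 \<le> sin y"
proof -
  have "\<bar>sin y - (\<Sum>m<3. sin_coeff m * y ^ m)\<bar> \<le> inverse (fact 3) * \<bar>y\<bar> ^ 3"
    by (rule Maclaurin_sin_bound)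
  moreover have "(\<Sum>m<3. sin_coeff m * y ^ m) = y"
    by (simp add: sin_coeff_def eval_nat_numeral)
  moreover have "inverse (fact 3) * \<bar>y\<bar> ^ 3 \<le> y * (2 / 3)"
  proof -
    have "y \<le> 2" using assms pi_less_4 by simp
    then have "y * y \<le> 2 * 2" by (intro mult_mono) (use assms in auto)
    then have "y * (y * y) \<le> y * 4" by (intro mult_left_mono) (use assms in auto)
    then show ?thesis using assms by (simp add: eval_nat_numeral fact_numeral)
  qed
  ultimately show ?thesis by linarith
qed

text \<open>
The denominator is the squared distance of the points \<open>r\<close> and \<open>e\<^sup>i\<^sup>x\<close>; bounding it below by elementary
terms is what all the kernel estimates rest on.
\<close>

lemma kernel_denom_lower:
  assumes r: "1/2 \<le> r" "r \<le> 1" and x: "\<bar>x\<bar> \<le> pi"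
  shows "((1 - r)\<^sup>2 + x\<^sup>2) / 18 \<le> kernel_denom r x"
proof -
  have "\<bar>x\<bar> / 6 \<le> sin (\<bar>x\<bar> / 2)" using sin_ge_third[of "\<bar>x\<bar> / 2"] x by simp
  then have "(\<bar>x\<bar> / 6)\<^sup>2 \<le> (sin (\<bar>x\<bar> / 2))\<^sup>2" by (intro power_mono) auto
  moreover have "(sin (\<bar>x\<bar> / 2))\<^sup>2 = (sin (x / 2))\<^sup>2" by (cases "x \<ge> 0") auto
  ultimately have "x\<^sup>2 / 36 \<le> (sin (x / 2))\<^sup>2" by (simp add: power_divide)
  then have "2 * (x\<^sup>2 / 36) \<le> 4 * r * (sin (x / 2))\<^sup>2"
    using r by (intro mult_mono) auto
  moreover have "(1 - r)\<^sup>2 / 18 \<le> (1 - r)\<^sup>2" by simp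
  ultimately show ?thesis unfolding kernel_denom_eq add_divide_distrib by linarith
qed

lemma kernel_denom_recip:
  assumes r: "1/2 \<le> r" "r \<le> 1" and x: "\<bar>x\<bar> \<le> pi" and c: "0 \<le> c"
  shows "c / kernel_denom r x \<le> 18 * (c / ((1 - r)\<^sup>2 + x\<^sup>2))"
proof (cases "r = 1 \<and> x = 0")
  case True
  then show ?thesis by (simp add: kernel_denom_def)
next
  case False
  then have pos: "0 < (1 - r)\<^sup>2 + x\<^sup>2" by (auto simp: sum_power2_gt_zero_iff)
  have "c / kernel_denom r x \<le> c / (((1 - r)\<^sup>2 + x\<^sup>2) / 18)"
    using kernel_denom_lower[OF r x] pos c by (intro divide_left_mono mult_pos_pos) (auto intro: less_le_trans)
  then show ?thesis by (simp add: mult.commute)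
qed

text \<open>
The numerator cancels one of the two factors \<open>D\<close> in the denominator:
\<open>(1 + r\<^sup>2) cos x - 2 r = D cos x - 2 r sin\<^sup>2 x\<close> and \<open>r sin\<^sup>2 x \<le> D\<close>.
\<close>

lemma radial_kernel_bound:
  assumes r: "1/2 \<le> r" "r \<le> 1" and x: "\<bar>x\<bar> \<le> pi"
  shows "\<bar>radial_kernel r x\<bar> \<le> 18 / ((1 - r)\<^sup>2 + x\<^sup>2)"
proof -
  define D where "D = kernel_denom r x"
  have D0: "0 \<le> D" using kernel_denom_lower[OF assms] unfolding D_def
    by (rule order_trans[rotated]) simp
  have "(1 + r\<^sup>2) * cos x - 2 * r = cos x * D - 2 * r * (sin x)\<^sup>2"
    unfolding D_def kernel_denom_def sin_squared_eq by (simp add: algebra_simps power2_eq_square)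
  moreover have "r * (sin x)\<^sup>2 \<le> D"
  proof -
    have "(sin x)\<^sup>2 = 4 * (sin (x / 2))\<^sup>2 * (cos (x / 2))\<^sup>2"
      using sin_double[of "x / 2"] by (simp add: power_mult_distrib)
    also have "\<dots> \<le> 4 * (sin (x / 2))\<^sup>2 * 1"
      by (intro mult_left_mono) (auto simp: abs_square_le_1)
    finally have "r * (sin x)\<^sup>2 \<le> r * (4 * (sin (x / 2))\<^sup>2)"
      using r by (intro mult_left_mono) auto
    also have "\<dots> \<le> (1 - r)\<^sup>2 + r * (4 * (sin (x / 2))\<^sup>2)" by simp
    also have "\<dots> = D" by (simp add: D_def kernel_denom_eq mult_ac)
    finally show ?thesis .
  qed
  moreover have "\<bar>cos x * D\<bar> \<le> D"
    using D0 mult_right_mono[OF abs_cos_le_one[of x] D0] by (simp add: abs_mult)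
  moreover have "0 \<le> r * (sin x)\<^sup>2" using r by simp
  ultimately have "\<bar>(1 + r\<^sup>2) * cos x - 2 * r\<bar> \<le> 3 * D" by linarith
  then have num: "\<bar>r * ((1 + r\<^sup>2) * cos x - 2 * r)\<bar> \<le> 1 * (3 * D)"
    unfolding abs_mult using r by (intro mult_mono) auto
  have "\<bar>radial_kernel r x\<bar> = \<bar>r * ((1 + r\<^sup>2) * cos x - 2 * r)\<bar> / (pi * D\<^sup>2)"
    by (simp add: radial_kernel_def D_def abs_mult)
  also have "\<dots> \<le> (3 * D) / (pi * D\<^sup>2)" using num by (intro divide_right_mono) auto
  also have "\<dots> = (3 / pi) / D" by (simp add: power2_eq_square)
  also have "\<dots> \<le> 1 / D" using pi_gt3 D0 by (intro divide_right_mono) auto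
  also have "\<dots> \<le> 18 * (1 / ((1 - r)\<^sup>2 + x\<^sup>2))" unfolding D_def by (rule kernel_denom_recip) (use assms in auto)
  finally show ?thesis by simp
qed

lemma angular_kernel_times_nonneg:
  assumes r: "0 \<le> r" "r \<le> 1" and x: "\<bar>x\<bar> \<le> pi"
  shows "0 \<le> x * angular_kernel r x"
proof -
  have "0 \<le> x * sin x"
    using sin_ge_zero[of "\<bar>x\<bar>"] x by (cases "x \<ge> 0") (auto intro: mult_nonneg_nonneg mult_nonpos_nonpos)
  moreover have "r\<^sup>2 \<le> 1" using r by (simp add: power_le_one)
  ultimately have "0 \<le> (r * (1 - r\<^sup>2)) * (x * sin x)"
    using r by (intro mult_nonneg_nonneg[of "r * (1 - r\<^sup>2)"]) auto
  then have "0 \<le> r * (1 - r\<^sup>2) * (x * sin x) / (pi * (kernel_denom r x)\<^sup>2)" by simp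
  then show ?thesis by (simp add: angular_kernel_def mult_ac)
qed

text \<open>
With the factor \<open>x\<close> this kernel is as good as the Poisson kernel itself: an approximate identity with
Cauchy tails. It will always be applied to functions of size \<open>O(|x|)\<close>.
\<close>

lemma angular_kernel_bound:
  assumes r: "1/2 \<le> r" "r < 1" and x: "\<bar>x\<bar> \<le> pi"
  shows "\<bar>x * angular_kernel r x\<bar> \<le> 216 * ((1 - r) / ((1 - r)\<^sup>2 + x\<^sup>2))"
proof -
  define D where "D = kernel_denom r x"
  have D0: "0 < D" unfolding D_def using r by (intro kernel_denom_pos) auto
  have "((1 - r)\<^sup>2 + x\<^sup>2) / 18 \<le> D" unfolding D_def by (rule kernel_denom_lower) (use r x in auto)
  then have "(1 - r)\<^sup>2 + x\<^sup>2 \<le> 18 * D" by simp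
  then have xD: "x\<^sup>2 \<le> 18 * D" by (smt (verit) zero_le_power2)
  define c where "c = r * (1 - r\<^sup>2)"
  have c: "0 \<le> c" "c \<le> 2 * (1 - r)"
  proof -
    show "0 \<le> c" using r by (simp add: c_def power_le_one)
    have "c = (r * (1 + r)) * (1 - r)" by (simp add: c_def power2_eq_square algebra_simps)
    also have "\<dots> \<le> (1 * 2) * (1 - r)" using r by (intro mult_right_mono mult_mono) auto
    finally show "c \<le> 2 * (1 - r)" by simp
  qed
  have "\<bar>x * (c * sin x)\<bar> = c * (\<bar>x\<bar> * \<bar>sin x\<bar>)"
    using c(1) by (simp add: abs_mult)
  also have "\<dots> \<le> (2 * (1 - r)) * (\<bar>x\<bar> * \<bar>x\<bar>)"
    using c r by (intro mult_mono mult_left_mono abs_sin_x_le_abs_x) auto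
  also have "\<dots> \<le> (2 * (1 - r)) * (18 * D)"
    using xD r by (intro mult_left_mono) (auto simp: power2_eq_square)
  finally have num: "\<bar>x * (c * sin x)\<bar> \<le> (2 * (1 - r)) * (18 * D)" .
  have "\<bar>x * angular_kernel r x\<bar> = \<bar>x * (c * sin x)\<bar> / (pi * D\<^sup>2)"
    by (simp add: angular_kernel_def D_def c_def abs_mult)
  also have "\<dots> \<le> (2 * (1 - r)) * (18 * D) / (pi * D\<^sup>2)" using num by (intro divide_right_mono) auto
  also have "\<dots> = (36 / pi) * ((1 - r) / D)" using D0 by (simp add: power2_eq_square)
  also have "\<dots> \<le> 12 * ((1 - r) / D)"
    using pi_gt3 D0 r by (intro mult_right_mono) (auto simp: divide_le_eq)
  also have "\<dots> \<le> 12 * (18 * ((1 - r) / ((1 - r)\<^sup>2 + x\<^sup>2)))"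
    unfolding D_def by (intro mult_left_mono kernel_denom_recip) (use assms in auto)
  finally show ?thesis by simp
qed

lemma poisson_kernel_bound:
  assumes r: "1/2 \<le> r" "r < 1" and x: "\<bar>x\<bar> \<le> pi"
  shows "0 \<le> poisson_kernel r x" "poisson_kernel r x \<le> 6 * ((1 - r) / ((1 - r)\<^sup>2 + x\<^sup>2))"
proof -
  define D where "D = kernel_denom r x"
  have D0: "0 < D" unfolding D_def using r by (intro kernel_denom_pos) auto
  have eq: "poisson_kernel r x = (1 - r\<^sup>2) / (2 * pi * D)"
    by (simp add: poisson_kernel_def D_def kernel_denom_def)
  show "0 \<le> poisson_kernel r x" unfolding eq using D0 r by (simp add: power_le_one)
  have "1 - r\<^sup>2 = (1 + r) * (1 - r)" by (simp add: power2_eq_square algebra_simps)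
  also have "\<dots> \<le> 2 * (1 - r)" using r by (intro mult_right_mono) auto
  finally have "poisson_kernel r x \<le> 2 * (1 - r) / (2 * pi * D)"
    unfolding eq using D0 by (intro divide_right_mono) auto
  also have "\<dots> = (1 / pi) * ((1 - r) / D)" using D0 by (simp add: divide_simps)
  also have "\<dots> \<le> (1 / 3) * ((1 - r) / D)"
    using pi_gt3 D0 r by (intro mult_right_mono) (auto simp: divide_le_eq)
  also have "\<dots> \<le> (1 / 3) * (18 * ((1 - r) / ((1 - r)\<^sup>2 + x\<^sup>2)))"
    unfolding D_def by (intro mult_left_mono kernel_denom_recip) (use assms in auto)
  also have "\<dots> = 6 * ((1 - r) / ((1 - r)\<^sup>2 + x\<^sup>2))" unfolding mult.assoc[symmetric] by simp
  finally show "poisson_kernel r x \<le> 6 * ((1 - r) / ((1 - r)\<^sup>2 + x\<^sup>2))" .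
qed

lemma kernels_continuous_on:
  assumes "\<bar>r\<bar> < 1"
  shows "continuous_on S (radial_kernel r)" "continuous_on S (angular_kernel r)"
    "continuous_on S (poisson_kernel r)"
proof -
  have nz: "kernel_denom r x \<noteq> 0" "1 - 2 * r * cos x + r\<^sup>2 \<noteq> 0" for x
    using kernel_denom_pos[OF assms, of x] by (auto simp: kernel_denom_def)
  have cD: "continuous_on S (kernel_denom r)" unfolding kernel_denom_def by (intro continuous_intros)
  show "continuous_on S (radial_kernel r)" "continuous_on S (angular_kernel r)"
    unfolding radial_kernel_def[abs_def] angular_kernel_def[abs_def]
    by (intro continuous_intros cD; use nz in simp)+
  show "continuous_on S (poisson_kernel r)"
    unfolding poisson_kernel_def[abs_def] by (intro continuous_intros; use nz in simp)
qed

lemma poisson_kernel_has_derivative: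
  assumes "\<bar>r\<bar> < 1"
  shows "(poisson_kernel r has_real_derivative - angular_kernel r x) (at x within S)"
proof -
  have nz: "1 - 2 * r * cos x + r\<^sup>2 \<noteq> 0"
    using kernel_denom_pos[OF assms, of x] by (auto simp: kernel_denom_def)
  have "((\<lambda>x. (1 - r\<^sup>2) / (2 * pi * (1 - 2 * r * cos x + r\<^sup>2))) has_real_derivative
      - ((1 - r\<^sup>2) * (2 * pi * (2 * r * sin x)) / (2 * pi * (1 - 2 * r * cos x + r\<^sup>2))\<^sup>2)) (at x within S)"
    using nz by (auto intro!: derivative_eq_intros simp: power2_eq_square)
  moreover have "(1 - r\<^sup>2) * (2 * pi * (2 * r * sin x)) / (2 * pi * (1 - 2 * r * cos x + r\<^sup>2))\<^sup>2 = angular_kernel r x"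
  proof -
    have "A * (2 * pi * (2 * r * s)) / (2 * pi * D)\<^sup>2 = r * A * s / (pi * D\<^sup>2)" for A s D :: real
      by (cases "D = 0") (simp_all add: field_simps power2_eq_square)
    then show ?thesis unfolding angular_kernel_def kernel_denom_def .
  qed
  ultimately show ?thesis unfolding poisson_kernel_def[abs_def] by simp
qed

text \<open>
An antiderivative is the conjugate Poisson kernel.
\<close>

lemma radial_kernel_integral:
  assumes "\<bar>r\<bar> < 1"
  shows "(radial_kernel r has_integral 0) {-pi..pi}"
proof -
  have "((\<lambda>x. r * sin x / (pi * kernel_denom r x)) has_real_derivative radial_kernel r x) (at x within {-pi..pi})" for x
  proof -
    define D where "D = 1 - 2 * r * cos x + r\<^sup>2"
    have nz: "D \<noteq> 0"
      using kernel_denom_pos[OF assms, of x] by (auto simp: kernel_denom_def D_def)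
    have "((\<lambda>x. r * sin x / (pi * (1 - 2 * r * cos x + r\<^sup>2))) has_real_derivative
      (r * cos x * (pi * D) - r * sin x * (pi * (2 * r * sin x))) / (pi * D)\<^sup>2) (at x within {-pi..pi})"
      using nz unfolding D_def by (auto intro!: derivative_eq_intros simp: power2_eq_square)
    moreover have "(r * cos x * (pi * D) - r * sin x * (pi * (2 * r * sin x))) / (pi * D)\<^sup>2 = radial_kernel r x"
    proof -
      have "r * cos x * (pi * D) - r * sin x * (pi * (2 * r * sin x)) = pi * r * (cos x * D - 2 * r * (sin x)\<^sup>2)"
        by (simp add: algebra_simps power2_eq_square)
      also have "cos x * D - 2 * r * (sin x)\<^sup>2 = (1 + r\<^sup>2) * cos x - 2 * r"
        unfolding D_def sin_squared_eq by (simp add: algebra_simps power2_eq_square)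
      finally have num: "r * cos x * (pi * D) - r * sin x * (pi * (2 * r * sin x)) = pi * r * ((1 + r\<^sup>2) * cos x - 2 * r)" .
      have kd: "kernel_denom r x = D" by (simp add: kernel_denom_def D_def)
      show ?thesis unfolding num radial_kernel_def kd using nz by (simp add: power2_eq_square)
    qed
    ultimately show ?thesis unfolding kernel_denom_def by simp
  qed
  then have "(radial_kernel r has_integral (r * sin pi / (pi * kernel_denom r pi) - r * sin (-pi) / (pi * kernel_denom r (-pi)))) {-pi..pi}"
    by (intro fundamental_theorem_of_calculus) (auto simp: has_real_derivative_iff_has_vector_derivative)
  then show ?thesis by simp
qed

lemma angular_kernel_integral:
  assumes "\<bar>r\<bar> < 1"
  shows "(angular_kernel r has_integral 0) {-pi..pi}"
proof -
  have "((\<lambda>x. - angular_kernel r x) has_integral (poisson_kernel r pi - poisson_kernel r (-pi))) {-pi..pi}"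
    using poisson_kernel_has_derivative[OF assms]
    by (intro fundamental_theorem_of_calculus) (auto simp: has_real_derivative_iff_has_vector_derivative)
  from has_integral_neg[OF this] show ?thesis by (simp add: poisson_kernel_def)
qed

lemma has_integral_even:
  fixes p :: "real \<Rightarrow> real"
  assumes "(p has_integral I) {0..a}" "0 \<le> a"
  shows "((\<lambda>x. p \<bar>x\<bar>) has_integral (2 * I)) {-a..a}"
proof -
  have 1: "((\<lambda>x. p \<bar>x\<bar>) has_integral I) {0..a}"
    by (rule has_integral_eq[OF _ assms(1)]) auto
  have "((\<lambda>x. p (- x)) has_integral I) {-a..0}"
    using Henstock_Kurzweil_Integration.has_integral_reflect_real[of p I a 0] assms(1) by simp
  then have 2: "((\<lambda>x. p \<bar>x\<bar>) has_integral I) {-a..0}"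
    by (rule has_integral_eq[rotated]) auto
  from has_integral_combine[OF _ _ 2 1] assms(2) show ?thesis by simp
qed

lemma cauchy_density_integral:
  assumes "0 < \<delta>"
  shows "((\<lambda>x. \<delta> / (\<delta>\<^sup>2 + x\<^sup>2)) has_integral (2 * arctan (pi / \<delta>))) {-pi..pi}"
proof -
  have "((\<lambda>x. \<delta> / (\<delta>\<^sup>2 + x\<^sup>2)) has_integral (arctan (pi / \<delta>) - arctan (0 / \<delta>))) {0..pi}"
  proof (rule fundamental_theorem_of_calculus)
    fix x :: real
    have "1 + (x / \<delta>)\<^sup>2 \<noteq> 0" by (smt (verit) zero_le_power2)
    moreover have "\<delta>\<^sup>2 + x\<^sup>2 > 0" using assms by (simp add: add_pos_nonneg)
    moreover have "inverse (1 + (x / \<delta>)\<^sup>2) / \<delta> = \<delta> / (\<delta>\<^sup>2 + x\<^sup>2)"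
    proof -
      have "1 + (x / \<delta>)\<^sup>2 = (\<delta>\<^sup>2 + x\<^sup>2) / \<delta>\<^sup>2"
        using assms by (simp add: add_divide_distrib power_divide)
      then show ?thesis using assms by (simp add: power2_eq_square)
    qed
    ultimately have "((\<lambda>x. arctan (x / \<delta>)) has_real_derivative \<delta> / (\<delta>\<^sup>2 + x\<^sup>2)) (at x within {0..pi})"
      using assms by (auto intro!: derivative_eq_intros)
    then show "((\<lambda>x. arctan (x / \<delta>)) has_vector_derivative \<delta> / (\<delta>\<^sup>2 + x\<^sup>2)) (at x within {0..pi})"
      by (simp add: has_real_derivative_iff_has_vector_derivative)
  qed simp
  from has_integral_even[OF this] show ?thesis by simp
qed

text \<open>
The source of the logarithm: a kernel of order \<open>-2\<close> applied to a Lipschitz function.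
\<close>

lemma log_kernel_integral:
  assumes "0 < \<delta>"
  shows "((\<lambda>x. \<bar>x\<bar> / (\<delta>\<^sup>2 + x\<^sup>2)) has_integral ln ((\<delta>\<^sup>2 + pi\<^sup>2) / \<delta>\<^sup>2)) {-pi..pi}"
proof -
  have "((\<lambda>x. x / (\<delta>\<^sup>2 + x\<^sup>2)) has_integral (ln (\<delta>\<^sup>2 + pi\<^sup>2) / 2 - ln (\<delta>\<^sup>2 + 0\<^sup>2) / 2)) {0..pi}"
  proof (rule fundamental_theorem_of_calculus)
    fix x :: real
    have "\<delta>\<^sup>2 + x\<^sup>2 > 0" using assms by (simp add: add_pos_nonneg)
    then have "((\<lambda>x. ln (\<delta>\<^sup>2 + x\<^sup>2)) has_real_derivative 2 * x / (\<delta>\<^sup>2 + x\<^sup>2)) (at x within {0..pi})"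
      by (auto intro!: derivative_eq_intros)
    from DERIV_cdivide[OF this, of 2]
    moreover have "2 * x / N / 2 = x / N" for N :: real by simp
    ultimately have "((\<lambda>x. ln (\<delta>\<^sup>2 + x\<^sup>2) / 2) has_real_derivative x / (\<delta>\<^sup>2 + x\<^sup>2)) (at x within {0..pi})"
      by metis
    then show "((\<lambda>x. ln (\<delta>\<^sup>2 + x\<^sup>2) / 2) has_vector_derivative x / (\<delta>\<^sup>2 + x\<^sup>2)) (at x within {0..pi})"
      by (simp add: has_real_derivative_iff_has_vector_derivative)
  qed simp
  from has_integral_even[OF this] have "((\<lambda>x. \<bar>x\<bar> / (\<delta>\<^sup>2 + x\<^sup>2)) has_integral (ln (\<delta>\<^sup>2 + pi\<^sup>2) - ln (\<delta>\<^sup>2))) {-pi..pi}"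
    by (simp add: right_diff_distrib)
  moreover have "ln ((\<delta>\<^sup>2 + pi\<^sup>2) / \<delta>\<^sup>2) = ln (\<delta>\<^sup>2 + pi\<^sup>2) - ln (\<delta>\<^sup>2)"
  proof (rule ln_divide_pos)
    show "0 < \<delta>\<^sup>2 + pi\<^sup>2" using assms by (intro add_pos_pos) auto
  qed (use assms in auto)
  ultimately show ?thesis by simp
qed

section \<open>Logarithms and the Dini condition\<close>

text \<open>
By monotonicity \<open>\<rho>(y) log (\<eta>/y) \<le> \<integral> \<rho>(x)/x dx\<close> over \<open>[y, \<eta>]\<close>, which is small once \<open>\<eta>\<close> is, and
\<open>log (1/y) \<le> 2 log (\<eta>/y)\<close> as soon as \<open>y \<le> \<eta>\<^sup>2\<close>.
\<close>

lemma dini_log_tendsto_0: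
  fixes \<rho> :: "real \<Rightarrow> real"
  assumes mono: "\<And>x y. 0 \<le> x \<Longrightarrow> x \<le> y \<Longrightarrow> \<rho> x \<le> \<rho> y" and nn: "\<And>x. 0 \<le> x \<Longrightarrow> 0 \<le> \<rho> x"
    and int: "(\<lambda>x. \<rho> x / x) integrable_on {0..pi}"
  shows "((\<lambda>y. \<rho> y * ln (1 / y)) \<longlongrightarrow> 0) (at_right 0)"
proof (rule tendstoI)
  fix e :: real assume e: "0 < e"
  define \<Psi> where "\<Psi> y = integral {0..y} (\<lambda>x. \<rho> x / x)" for y
  have "continuous_on {0..pi} \<Psi>" unfolding \<Psi>_def by (rule indefinite_integral_continuous_1[OF int])
  then have "((\<Psi>) \<longlongrightarrow> \<Psi> 0) (at 0 within {0..pi})" by (simp add: continuous_on)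
  moreover have "\<Psi> 0 = 0" by (simp add: \<Psi>_def)
  ultimately have "eventually (\<lambda>y. dist (\<Psi> y) 0 < e / 2) (at 0 within {0..pi})"
    using e tendstoD by (metis half_gt_zero)
  then obtain d where d: "d > 0" "\<And>y. y \<in> {0..pi} \<Longrightarrow> y \<noteq> 0 \<Longrightarrow> dist y 0 < d \<Longrightarrow> dist (\<Psi> y) 0 < e / 2"
    unfolding eventually_at by auto
  define \<eta> where "\<eta> = min (d / 2) (1 / 2)"
  have \<eta>: "0 < \<eta>" "\<eta> < 1" "\<eta> < d" "\<eta> < pi" using d(1) pi_gt3 by (auto simp: \<eta>_def min_def)
  have \<Psi>\<eta>: "\<Psi> \<eta> < e / 2" using d(2)[of \<eta>] \<eta> by (auto simp: dist_norm)
  have bound: "\<rho> y * ln (\<eta> / y) < e / 2" if y: "0 < y" "y < \<eta>" for y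
  proof -
    have i1: "((\<lambda>x. \<rho> y * inverse x) has_integral (\<rho> y * ln \<eta> - \<rho> y * ln y)) {y..\<eta>}"
    proof (rule fundamental_theorem_of_calculus)
      fix x assume "x \<in> {y..\<eta>}"
      then have "((\<lambda>x. \<rho> y * ln x) has_real_derivative \<rho> y * inverse x) (at x within {y..\<eta>})"
        using y by (auto intro!: derivative_eq_intros simp: divide_simps)
      then show "((\<lambda>x. \<rho> y * ln x) has_vector_derivative \<rho> y * inverse x) (at x within {y..\<eta>})"
        by (simp add: has_real_derivative_iff_has_vector_derivative)
    qed (use y in auto)
    have int': "(\<lambda>x. \<rho> x / x) integrable_on {a..b}" if "0 \<le> a" "b \<le> pi" for a b
      using integrable_on_subinterval[OF int, of a b] that by auto
    have "\<rho> y * ln (\<eta> / y) = integral {y..\<eta>} (\<lambda>x. \<rho> y * inverse x)"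
      unfolding integral_unique[OF i1] using y \<eta> by (simp add: ln_div right_diff_distrib)
    also have "\<dots> \<le> integral {y..\<eta>} (\<lambda>x. \<rho> x / x)"
    proof (rule integral_le)
      show "(\<lambda>x. \<rho> y * inverse x) integrable_on {y..\<eta>}" using i1 by blast
      show "\<rho> y * inverse x \<le> \<rho> x / x" if "x \<in> {y..\<eta>}" for x
        using that y mono[of y x] by (auto simp: divide_inverse intro!: mult_right_mono)
    qed (use int' y \<eta> in auto)
    also have "\<dots> \<le> integral {0..y} (\<lambda>x. \<rho> x / x) + integral {y..\<eta>} (\<lambda>x. \<rho> x / x)"
    proof -
      have "0 \<le> integral {0..y} (\<lambda>x. \<rho> x / x)"
        by (rule Henstock_Kurzweil_Integration.integral_nonneg) (use int' y \<eta> nn in auto)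
      then show ?thesis by simp
    qed
    also have "\<dots> = \<Psi> \<eta>" unfolding \<Psi>_def
      by (rule Henstock_Kurzweil_Integration.integral_combine) (use y \<eta> int' in auto)
    finally show ?thesis using \<Psi>\<eta> by simp
  qed
  have "dist (\<rho> y * ln (1 / y)) 0 < e" if y: "0 < y" "y < \<eta>\<^sup>2 / 2" for y
  proof -
    have "\<eta>\<^sup>2 / 2 < \<eta>" using \<eta> by (simp add: power2_eq_square)
    then have y\<eta>: "y < \<eta>" "y < 1" using y \<eta> by auto
    have "ln (1 / y) = 2 * ln (\<eta> / y) - ln (\<eta>\<^sup>2 / y)"
      using y \<eta> by (simp add: ln_div ln_realpow)
    moreover have "0 \<le> ln (\<eta>\<^sup>2 / y)" using y by (intro ln_ge_zero) (simp add: divide_simps)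
    ultimately have "ln (1 / y) \<le> 2 * ln (\<eta> / y)" by linarith
    then have "\<rho> y * ln (1 / y) \<le> \<rho> y * (2 * ln (\<eta> / y))" using nn[of y] y by (intro mult_left_mono) auto
    also have "\<dots> < e" using bound[OF y(1) y\<eta>(1)] by simp
    finally have "\<rho> y * ln (1 / y) < e" .
    moreover have "0 \<le> \<rho> y * ln (1 / y)" using nn[of y] y y\<eta> by (intro mult_nonneg_nonneg ln_ge_zero) auto
    ultimately show ?thesis by simp
  qed
  then show "\<forall>\<^sub>F y in at_right 0. dist (\<rho> y * ln (1 / y)) 0 < e"
    unfolding eventually_at_right_field using \<eta> by (intro exI[of _ "\<eta>\<^sup>2 / 2"]) auto
qed

lemma mult_log_tendsto_0: "((\<lambda>y::real. y * ln (1 / y)) \<longlongrightarrow> 0) (at_right 0)"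
proof (rule dini_log_tendsto_0)
  have "(\<lambda>x::real. if x = 0 then 0 else 1) integrable_on {0..pi}"
    by (rule integrable_spike[of "\<lambda>_. 1" _ "{0}"]) auto
  then show "(\<lambda>x::real. x / x) integrable_on {0..pi}"
    by (rule integrable_eq) auto
qed auto

lemma log_ratio_bounds:
  assumes "0 < \<delta>" "\<delta> < 1"
  shows "0 \<le> ln ((\<delta>\<^sup>2 + pi\<^sup>2) / \<delta>\<^sup>2)"
    and "ln ((\<delta>\<^sup>2 + pi\<^sup>2) / \<delta>\<^sup>2) \<le> ln (1 + pi\<^sup>2) + 2 * ln (1 / \<delta>)"
proof -
  show "0 \<le> ln ((\<delta>\<^sup>2 + pi\<^sup>2) / \<delta>\<^sup>2)" using assms by (intro ln_ge_zero) (simp add: divide_simps)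
  have "\<delta>\<^sup>2 + pi\<^sup>2 \<le> 1 + pi\<^sup>2" using assms by (simp add: power_le_one)
  then have "ln ((\<delta>\<^sup>2 + pi\<^sup>2) / \<delta>\<^sup>2) \<le> ln ((1 + pi\<^sup>2) / \<delta>\<^sup>2)"
    using assms by (subst ln_le_cancel_iff) (auto simp: divide_right_mono add_nonneg_pos intro!: divide_pos_pos)
  also have "\<dots> = ln (1 + pi\<^sup>2) + 2 * ln (1 / \<delta>)"
  proof -
    have "1 + pi\<^sup>2 > 0" by (simp add: add_pos_nonneg)
    then show ?thesis using assms by (subst ln_divide_pos) (auto simp: ln_realpow ln_div)
  qed
  finally show "ln ((\<delta>\<^sup>2 + pi\<^sup>2) / \<delta>\<^sup>2) \<le> ln (1 + pi\<^sup>2) + 2 * ln (1 / \<delta>)" .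
qed

section \<open>Extensions of a Dini smooth curve near the circle\<close>

text \<open>
The modulus of continuity enters only through a finite monotone majorant \<open>m\<close> with \<open>m(x)/x\<close> integrable
near \<open>0\<close>.
\<close>

locale dini_curve =
  fixes g g' :: "real \<Rightarrow> complex" and m :: "real \<Rightarrow> real"
  assumes der: "\<And>s. (g has_vector_derivative g' s) (at s)"
    and cont: "continuous_on UNIV g'" and unit: "\<And>s. cmod (g' s) = 1"
    and m_bound: "\<And>a b. cmod (g' a - g' b) \<le> m \<bar>a - b\<bar>"
    and m_mono: "\<And>x y. 0 \<le> x \<Longrightarrow> x \<le> y \<Longrightarrow> m x \<le> m y"
    and m_int: "\<And>K. 0 < K \<Longrightarrow> (\<lambda>x. m x / x) integrable_on {0..K}"
begin

lemma m_nonneg: "0 \<le> x \<Longrightarrow> 0 \<le> m x"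
  using m_bound[of 0 0] m_mono[of 0 x] by simp

lemma g_continuous: "continuous_on UNIV g"
  using der by (meson continuous_at_imp_continuous_on has_vector_derivative_continuous)

lemma g_secant_integral:
  shows "(\<lambda>u. g' (a + u * x)) integrable_on {0..1}"
    and "x * integral {0..1} (\<lambda>u. g' (a + u * x)) = g (a + x) - g a"
proof -
  show "(\<lambda>u. g' (a + u * x)) integrable_on {0..1}"
    by (intro integrable_continuous_real continuous_on_compose2[OF cont]) (auto intro!: continuous_intros)
  show "x * integral {0..1} (\<lambda>u. g' (a + u * x)) = g (a + x) - g a"
    by (rule mean_derivative_secant[OF der])
qed

lemma chord_bound: "cmod (g b - g a) \<le> \<bar>b - a\<bar>"
proof -
  have "cmod (integral {0..1} (\<lambda>u. g' (a + u * (b - a)))) \<le> integral {0..1} (\<lambda>u::real. 1)"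
    by (rule integral_norm_bound_integral) (auto simp: g_secant_integral unit)
  then have "cmod (integral {0..1} (\<lambda>u. g' (a + u * (b - a)))) \<le> 1" by simp
  then have "\<bar>b - a\<bar> * cmod (integral {0..1} (\<lambda>u. g' (a + u * (b - a)))) \<le> \<bar>b - a\<bar> * 1"
    by (intro mult_left_mono) auto
  then show ?thesis using arg_cong[OF g_secant_integral(2)[of "b - a" a], of cmod]
    by (simp add: norm_mult del: of_real_diff)
qed

lemma tangent_bound: "cmod (g b - g a - of_real (b - a) * g' a) \<le> \<bar>b - a\<bar> * m \<bar>b - a\<bar>"
proof -
  define I where "I = integral {0..1} (\<lambda>u. g' (a + u * (b - a)))"
  have "I - g' a = integral {0..1} (\<lambda>u. g' (a + u * (b - a)) - g' a)"
    unfolding I_def by (subst Henstock_Kurzweil_Integration.integral_diff) (auto simp: g_secant_integral)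
  also have "cmod \<dots> \<le> integral {0..1} (\<lambda>u::real. m \<bar>b - a\<bar>)"
  proof (rule integral_norm_bound_integral)
    show "(\<lambda>u. g' (a + u * (b - a)) - g' a) integrable_on {0..1}"
      by (intro integrable_diff g_secant_integral) auto
    fix u :: real assume u: "u \<in> {0..1}"
    have "cmod (g' (a + u * (b - a)) - g' a) \<le> m \<bar>u * (b - a)\<bar>"
      using m_bound[of "a + u * (b - a)" a] by simp
    also have "\<dots> \<le> m \<bar>b - a\<bar>"
      using u by (intro m_mono) (auto simp: abs_mult mult_left_le_one_le)
    finally show "cmod (g' (a + u * (b - a)) - g' a) \<le> m \<bar>b - a\<bar>" .
  qed auto
  finally have I: "cmod (I - g' a) \<le> m \<bar>b - a\<bar>" by simp
  have "g b - g a - of_real (b - a) * g' a = of_real (b - a) * (I - g' a)"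
    using g_secant_integral(2)[of "b - a" a] by (simp add: I_def algebra_simps)
  then have "cmod (g b - g a - of_real (b - a) * g' a) = \<bar>b - a\<bar> * cmod (I - g' a)"
    by (simp add: norm_mult del: of_real_diff)
  then show ?thesis using I by (simp add: mult_left_mono)
qed

text \<open>
The modulus of continuity as seen through an \<open>L\<close>-Lipschitz reparametrization.
\<close>

definition rho :: "real \<Rightarrow> real \<Rightarrow> real" where "rho L x = L * m (L * x)"

lemma rho_mono: "0 \<le> L \<Longrightarrow> 0 \<le> x \<Longrightarrow> x \<le> y \<Longrightarrow> rho L x \<le> rho L y"
  unfolding rho_def by (intro mult_left_mono m_mono) auto

lemma rho_nonneg: "0 \<le> L \<Longrightarrow> 0 \<le> x \<Longrightarrow> 0 \<le> rho L x"
  unfolding rho_def by (intro mult_nonneg_nonneg m_nonneg) auto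

lemma rho_integrable:
  assumes L: "0 < L"
  shows "(\<lambda>x. rho L x / x) integrable_on {0..pi}"
proof -
  obtain i where "((\<lambda>x. m x / x) has_integral i) {0..L * pi}"
    using m_int[of "L * pi"] L by (auto simp: integrable_on_def)
  from has_integral_stretch_real[OF this, of L]
  have "((\<lambda>x. m (L * x) / (L * x)) has_integral (1 / \<bar>L\<bar>) *\<^sub>R i) ((\<lambda>x. x / L) ` {0..L * pi})"
    using L by simp
  moreover have "(\<lambda>x. x / L) ` {0..L * pi} = {0..pi}"
  proof (intro equalityI subsetI)
    fix x assume "x \<in> {0..pi}"
    then show "x \<in> (\<lambda>x. x / L) ` {0..L * pi}" using L by (intro image_eqI[of _ _ "L * x"]) auto
  qed (use L in \<open>auto simp: divide_le_eq mult.commute\<close>)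
  ultimately have "(\<lambda>x. m (L * x) / (L * x)) integrable_on {0..pi}" by (auto simp: integrable_on_def)
  then have "(\<lambda>x. L\<^sup>2 * (m (L * x) / (L * x))) integrable_on {0..pi}" by (rule integrable_on_mult_right)
  moreover have "L\<^sup>2 * (m (L * x) / (L * x)) = rho L x / x" for x
    using L by (simp add: rho_def power2_eq_square)
  ultimately show ?thesis by simp
qed

lemma rho_abs_integrable:
  assumes L: "0 < L"
  shows "(\<lambda>x. rho L \<bar>x\<bar> / \<bar>x\<bar>) integrable_on {-pi..pi}"
proof -
  obtain i where "((\<lambda>x. rho L x / x) has_integral i) {0..pi}"
    using rho_integrable[OF L] by (auto simp: integrable_on_def)
  from has_integral_even[OF this] show ?thesis by (auto simp: integrable_on_def)
qed

text \<open>
Up to sign the distance of a point of the curve from the tangent line at another one.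
\<close>

definition chord_det :: "(real \<Rightarrow> real) \<Rightarrow> real \<Rightarrow> real \<Rightarrow> real" where
  "chord_det f \<tau> x = Im (cnj (g (f (\<tau> + x)) - g (f \<tau>)) * g' (f \<tau>))"

text \<open>
The determinant of the radial derivative \<open>r w\<^sub>r\<close> of the extension \<open>w\<close> and the unit tangent. The definition makes
sense for \<open>r = 1\<close> too, where it turns out to be the function \<open>T\<close>.
\<close>

definition radial_det :: "(real \<Rightarrow> real) \<Rightarrow> real \<Rightarrow> real \<Rightarrow> real" where
  "radial_det f r \<tau> = integral {-pi..pi} (\<lambda>x. radial_kernel r x * chord_det f \<tau> x)"

lemma chord_tangent_bound:
  assumes "0 < L" and lip: "L-lipschitz_on UNIV f"
  shows "cmod (g (f (\<tau> + x)) - g (f \<tau>) - of_real (f (\<tau> + x) - f \<tau>) * g' (f \<tau>)) \<le> \<bar>x\<bar> * rho L \<bar>x\<bar>"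
proof -
  have d: "\<bar>f (\<tau> + x) - f \<tau>\<bar> \<le> L * \<bar>x\<bar>"
    using lipschitz_onD[OF lip, of "\<tau> + x" \<tau>] by (simp add: dist_real_def)
  have "\<bar>f (\<tau> + x) - f \<tau>\<bar> * m \<bar>f (\<tau> + x) - f \<tau>\<bar> \<le> (L * \<bar>x\<bar>) * m (L * \<bar>x\<bar>)"
    using d assms(1) by (intro mult_mono m_mono) (auto intro: m_nonneg)
  then show ?thesis using tangent_bound[of "f (\<tau> + x)" "f \<tau>"] by (simp add: rho_def mult_ac)
qed

text \<open>
The tangential part of the chord does not contribute to the determinant.
\<close>

lemma chord_det_bound:
  assumes "0 < L" and lip: "L-lipschitz_on UNIV f"
  shows "\<bar>chord_det f \<tau> x\<bar> \<le> \<bar>x\<bar> * rho L \<bar>x\<bar>"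
proof -
  define e where "e = g' (f \<tau>)"
  define d where "d = f (\<tau> + x) - f \<tau>"
  define c where "c = g (f (\<tau> + x)) - g (f \<tau>)"
  have "Im (cnj (of_real d * e) * e) = 0" by (simp add: algebra_simps)
  then have "chord_det f \<tau> x = Im (cnj (c - of_real d * e) * e)"
    by (simp add: chord_det_def c_def e_def d_def algebra_simps)
  also have "\<bar>\<dots>\<bar> \<le> cmod (cnj (c - of_real d * e) * e)" by (rule abs_Im_le_cmod)
  also have "\<dots> = cmod (c - of_real d * e)" by (simp add: norm_mult e_def unit del: complex_cnj_diff)
  also have "\<dots> \<le> \<bar>x\<bar> * rho L \<bar>x\<bar>"
    using chord_tangent_bound[OF assms, of \<tau> x] by (simp add: c_def d_def e_def)
  finally show ?thesis .
qed

text \<open>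
The bound is uniform in \<open>r\<close>, up to and including \<open>r = 1\<close>, and integrable by the Dini condition.
\<close>

lemma radial_det_integrand_bound:
  assumes L: "0 < L" and lip: "L-lipschitz_on UNIV f" and r: "1/2 \<le> r" "r \<le> 1" and x: "\<bar>x\<bar> \<le> pi"
  shows "\<bar>radial_kernel r x * chord_det f \<tau> x\<bar> \<le> 18 * (rho L \<bar>x\<bar> / \<bar>x\<bar>)"
proof (cases "x = 0")
  case True
  then show ?thesis by (simp add: chord_det_def)
next
  case False
  have "\<bar>radial_kernel r x * chord_det f \<tau> x\<bar> \<le> (18 / ((1 - r)\<^sup>2 + x\<^sup>2)) * (\<bar>x\<bar> * rho L \<bar>x\<bar>)"
    unfolding abs_mult by (intro mult_mono radial_kernel_bound chord_det_bound assms) auto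
  also have "\<dots> \<le> (18 / x\<^sup>2) * (\<bar>x\<bar> * rho L \<bar>x\<bar>)"
    using False L by (intro mult_right_mono divide_left_mono mult_nonneg_nonneg rho_nonneg mult_pos_pos add_nonneg_pos) auto
  also have "\<dots> = 18 * (rho L \<bar>x\<bar> / \<bar>x\<bar>)"
    using False by (simp add: power2_eq_square divide_simps abs_mult[symmetric])
  finally show ?thesis .
qed

lemma radial_kernel_tendsto:
  assumes "(rs \<longlongrightarrow> r) F" "kernel_denom r x \<noteq> 0"
  shows "((\<lambda>n. radial_kernel (rs n) x) \<longlongrightarrow> radial_kernel r x) F"
  unfolding radial_kernel_def using assms unfolding kernel_denom_def
  by (intro tendsto_intros) auto

lemma radial_det_integrand_tendsto:
  assumes fs: "\<And>n. L-lipschitz_on UNIV (fs n)" "\<And>t. (\<lambda>n. fs n t) \<longlonglongrightarrow> f t"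
    and \<tau>s: "\<tau>s \<longlonglongrightarrow> \<tau>" and rs: "rs \<longlonglongrightarrow> r" and r: "1/2 \<le> r" "r \<le> 1" and x: "\<bar>x\<bar> \<le> pi"
  shows "(\<lambda>n. radial_kernel (rs n) x * chord_det (fs n) (\<tau>s n) x) \<longlonglongrightarrow> radial_kernel r x * chord_det f \<tau> x"
proof (cases "x = 0")
  case True
  then show ?thesis by (simp add: chord_det_def)
next
  case False
  have fconv: "(\<lambda>n. fs n (\<tau>s n + y)) \<longlonglongrightarrow> f (\<tau> + y)" for y
  proof -
    have "(\<lambda>n. fs n (\<tau>s n + y) - fs n (\<tau> + y)) \<longlonglongrightarrow> 0"
    proof (rule Lim_null_comparison)
      show "\<forall>\<^sub>F n in sequentially. norm (fs n (\<tau>s n + y) - fs n (\<tau> + y)) \<le> L * \<bar>\<tau>s n - \<tau>\<bar>"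
        using lipschitz_onD[OF fs(1)] by (auto simp: dist_real_def intro!: always_eventually)
           (metis UNIV_I add_diff_cancel_right)
      show "(\<lambda>n. L * \<bar>\<tau>s n - \<tau>\<bar>) \<longlonglongrightarrow> 0"
        using tendsto_mult_right_zero[OF tendsto_rabs_zero[OF LIM_zero[OF \<tau>s]]] .
    qed
    from tendsto_add[OF this fs(2)[of "\<tau> + y"]] show ?thesis by simp
  qed
  have gc: "(\<lambda>n. g (fs n (\<tau>s n + y))) \<longlonglongrightarrow> g (f (\<tau> + y))" for y
    using continuous_on_tendsto_compose[OF g_continuous fconv[of y]] by simp
  have g'c: "(\<lambda>n. g' (fs n (\<tau>s n))) \<longlonglongrightarrow> g' (f \<tau>)"
    using continuous_on_tendsto_compose[OF cont fconv[of 0]] by simp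
  have "0 < ((1 - r)\<^sup>2 + x\<^sup>2) / 18" using False by (simp add: add_nonneg_pos)
  then have "kernel_denom r x \<noteq> 0" using kernel_denom_lower[OF r x] by linarith
  then show ?thesis unfolding chord_det_def
    using gc[of x] gc[of 0] g'c by (intro tendsto_intros radial_kernel_tendsto rs) auto
qed

text \<open>
Joint continuity in the reparametrization, the radius and the angle. Integrability along the sequence is
a hypothesis, and integrability of the limit part of the conclusion, so that the case \<open>r = 1\<close> can be
reached from \<open>r < 1\<close>.
\<close>

lemma radial_det_dominated_convergence:
  assumes L: "0 < L" and fs: "\<And>n. L-lipschitz_on UNIV (fs n)" "\<And>t. (\<lambda>n. fs n t) \<longlonglongrightarrow> f t"
    and \<tau>s: "\<tau>s \<longlonglongrightarrow> \<tau>" and rs: "rs \<longlonglongrightarrow> r"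
    and rn: "\<And>n. 1/2 \<le> rs n" "\<And>n. rs n \<le> 1"
    and int: "\<And>n. (\<lambda>x. radial_kernel (rs n) x * chord_det (fs n) (\<tau>s n) x) integrable_on {-pi..pi}"
  shows "(\<lambda>x. radial_kernel r x * chord_det f \<tau> x) integrable_on {-pi..pi}"
    and "(\<lambda>n. radial_det (fs n) (rs n) (\<tau>s n)) \<longlonglongrightarrow> radial_det f r \<tau>"
proof -
  have r: "1/2 \<le> r" "r \<le> 1"
    by (rule LIMSEQ_le_const[OF rs], use rn in blast)
       (rule LIMSEQ_le_const2[OF rs], use rn in blast)
  have 1: "(\<lambda>x. 18 * (rho L \<bar>x\<bar> / \<bar>x\<bar>)) integrable_on {-pi..pi}"
    by (rule integrable_on_mult_right[OF rho_abs_integrable[OF L]])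
  have 2: "norm (radial_kernel (rs n) x * chord_det (fs n) (\<tau>s n) x) \<le> 18 * (rho L \<bar>x\<bar> / \<bar>x\<bar>)"
    if "x \<in> {-pi..pi}" for n x
    using radial_det_integrand_bound[OF L fs(1) rn, of x] that by (auto simp: abs_le_iff)
  have 3: "(\<lambda>n. radial_kernel (rs n) x * chord_det (fs n) (\<tau>s n) x) \<longlonglongrightarrow> radial_kernel r x * chord_det f \<tau> x"
    if "x \<in> {-pi..pi}" for x
    using that by (intro radial_det_integrand_tendsto[OF fs \<tau>s rs r]) auto
  show "(\<lambda>x. radial_kernel r x * chord_det f \<tau> x) integrable_on {-pi..pi}"
    by (rule dominated_convergence(1)[OF int 1 2 3])
  show "(\<lambda>n. radial_det (fs n) (rs n) (\<tau>s n)) \<longlonglongrightarrow> radial_det f r \<tau>"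
    unfolding radial_det_def by (rule dominated_convergence(2)[OF int 1 2 3])
qed

lemma chord_continuous_on:
  fixes f :: "real \<Rightarrow> real"
  assumes "continuous_on UNIV f"
  shows "continuous_on S (\<lambda>x. g (f (\<tau> + x)))"
proof -
  have "continuous_on S (\<lambda>x. \<tau> + x)"
    using continuous_on_add[OF continuous_on_const continuous_on_id, of S \<tau>] by simp
  from continuous_on_compose2[OF assms this] have "continuous_on S (\<lambda>x. f (\<tau> + x))" by simp
  from continuous_on_compose2[OF g_continuous this] show ?thesis by simp
qed

lemma radial_det_integrable:
  assumes L: "0 < L" and lip: "L-lipschitz_on UNIV f" and r: "1/2 \<le> r" "r \<le> 1"
  shows "(\<lambda>x. radial_kernel r x * chord_det f \<tau> x) integrable_on {-pi..pi}"
proof -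
  have *: "(\<lambda>x. radial_kernel r x * chord_det f \<tau> x) integrable_on {-pi..pi}"
    if "1/2 \<le> r" "r < 1" for r
    unfolding chord_det_def
    using kernels_continuous_on(1)[of r] that chord_continuous_on[OF lipschitz_on_continuous_on[OF lip]]
    by (intro integrable_continuous_real continuous_intros) auto
  show ?thesis
  proof (cases "r = 1")
    case True
    \<comment> \<open>the kernel is not continuous at \<open>x = 0\<close> for \<open>r = 1\<close>; approach it through radii in
      \<open>[1/2, 1)\<close>\<close>
    define rs where "rs n = 1 - inverse (real (Suc (Suc n)))" for n
    have "rs \<longlonglongrightarrow> 1 - 0"
      unfolding rs_def using LIMSEQ_Suc[OF LIMSEQ_inverse_real_of_nat]
      by (intro tendsto_intros) (simp add: LIMSEQ_Suc)
    moreover have "1/2 \<le> rs n" "rs n < 1" for n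
      unfolding rs_def using le_imp_inverse_le[of 2 "real (Suc (Suc n))"] by auto
    ultimately show ?thesis
      using radial_det_dominated_convergence(1)[where fs = "\<lambda>_. f" and f = f and \<tau>s = "\<lambda>_. \<tau>" and \<tau> = \<tau>
          and rs = rs and r = r and L = L] * L lip True
      by (simp add: less_imp_le)
  qed (use * r in auto)
qed

lemma radial_det_tendsto:
  assumes L: "0 < L" and fs: "\<And>n. L-lipschitz_on UNIV (fs n)" "\<And>t. (\<lambda>n. fs n t) \<longlonglongrightarrow> f t"
    and \<tau>s: "\<tau>s \<longlonglongrightarrow> \<tau>" and rs: "rs \<longlonglongrightarrow> r"
    and rn: "\<And>n. 1/2 \<le> rs n" "\<And>n. rs n \<le> 1"
  shows "(\<lambda>n. radial_det (fs n) (rs n) (\<tau>s n)) \<longlonglongrightarrow> radial_det f r \<tau>"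
  using radial_det_dominated_convergence(2)[OF assms] radial_det_integrable[OF L fs(1) rn] by blast

text \<open>
The derivative \<open>r w\<^sub>r\<close> of the extension \<open>w\<close>.
\<close>

definition radial_int :: "(real \<Rightarrow> real) \<Rightarrow> real \<Rightarrow> real \<Rightarrow> complex" where
  "radial_int f r \<tau> = integral {-pi..pi} (\<lambda>x. of_real (radial_kernel r x) * g (f (\<tau> + x)))"

text \<open>
The derivative \<open>w\<^sub>\<tau>\<close> of the extension \<open>w\<close>.
\<close>

definition angular_int :: "(real \<Rightarrow> real) \<Rightarrow> real \<Rightarrow> real \<Rightarrow> complex" where
  "angular_int f r \<tau> = integral {-pi..pi} (\<lambda>x. of_real (angular_kernel r x) * g (f (\<tau> + x)))"

text \<open>
The angular derivative of the extension of \<open>f\<close> itself, written with differences because \<open>f\<close> is not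
periodic; this is the main part of the speed of \<open>w\<^sub>\<tau>\<close>.
\<close>

definition tangential_speed :: "(real \<Rightarrow> real) \<Rightarrow> real \<Rightarrow> real \<Rightarrow> real" where
  "tangential_speed f r \<tau> = integral {-pi..pi} (\<lambda>x. angular_kernel r x * (f (\<tau> + x) - f \<tau>))"

text \<open>
An upper bound for the deviation of \<open>w\<^sub>\<tau>\<close> from the tangent at distance \<open>\<delta> = 1 - r\<close> from the circle, obtained by
splitting the integral at \<open>|x| = \<surd>\<delta>\<close>.
\<close>

definition tangential_error :: "real \<Rightarrow> real \<Rightarrow> real" where
  "tangential_error L \<delta> =
     216 * (pi * rho L (sqrt \<delta>) + sqrt \<delta> * integral {-pi..pi} (\<lambda>x. rho L \<bar>x\<bar> / \<bar>x\<bar>))"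

lemma mean_zero_kernel_int:
  fixes G :: "real \<Rightarrow> complex"
  assumes k: "continuous_on {-pi..pi} k" "(k has_integral 0) {-pi..pi}" and G: "continuous_on {-pi..pi} G"
  shows "integral {-pi..pi} (\<lambda>x. of_real (k x) * G x) = integral {-pi..pi} (\<lambda>x. of_real (k x) * (G x - c))"
proof -
  have "((\<lambda>x. of_real (k x) * c) has_integral (of_real 0 * c)) {-pi..pi}"
    by (intro has_integral_mult_left has_integral_of_real k)
  moreover have "(\<lambda>x. of_real (k x) * G x) integrable_on {-pi..pi}"
    by (intro integrable_continuous_real continuous_intros k G)
  ultimately have "((\<lambda>x. of_real (k x) * G x - of_real (k x) * c) has_integral
      (integral {-pi..pi} (\<lambda>x. of_real (k x) * G x) - of_real 0 * c)) {-pi..pi}"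
    by (intro has_integral_diff integrable_integral)
  then show ?thesis by (simp add: integral_unique right_diff_distrib)
qed

text \<open>
Since \<open>g\<close> is merely Lipschitz along \<open>f\<close>, the radial derivative can grow like \<open>log (1/(1 - r))\<close>; its normal
component is nevertheless \<open>radial_det\<close>, which stays bounded.
\<close>

lemma radial_int_bound_and_det:
  assumes L: "0 < L" and lip: "L-lipschitz_on UNIV f" and r: "1/2 \<le> r" "r < 1"
  shows "cmod (radial_int f r \<tau>) \<le> 18 * L * ln (((1 - r)\<^sup>2 + pi\<^sup>2) / (1 - r)\<^sup>2)"
    and "Im (cnj (radial_int f r \<tau>) * g' (f \<tau>)) = radial_det f r \<tau>"
proof -
  have fc: "continuous_on UNIV f" using lip lipschitz_on_continuous_on by blast
  have kc: "continuous_on S (radial_kernel r)" for S using kernels_continuous_on r by auto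
  have eq: "radial_int f r \<tau> = integral {-pi..pi} (\<lambda>x. of_real (radial_kernel r x) * (g (f (\<tau> + x)) - g (f \<tau>)))"
    unfolding radial_int_def
    using r by (intro mean_zero_kernel_int kc radial_kernel_integral chord_continuous_on fc) auto
  have int: "(\<lambda>x. of_real (radial_kernel r x) * (g (f (\<tau> + x)) - g (f \<tau>))) integrable_on {-pi..pi}"
    by (intro integrable_continuous_real continuous_intros kc chord_continuous_on fc)
  have "((\<lambda>x. 18 * L * (\<bar>x\<bar> / ((1 - r)\<^sup>2 + x\<^sup>2))) has_integral (18 * L * ln (((1 - r)\<^sup>2 + pi\<^sup>2) / (1 - r)\<^sup>2))) {-pi..pi}"
    by (intro has_integral_mult_right log_kernel_integral) (use r in auto)
  note bd = this
  have "cmod (radial_int f r \<tau>) \<le> integral {-pi..pi} (\<lambda>x. 18 * L * (\<bar>x\<bar> / ((1 - r)\<^sup>2 + x\<^sup>2)))"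
    unfolding eq
  proof (rule integral_norm_bound_integral[OF int])
    show "(\<lambda>x. 18 * L * (\<bar>x\<bar> / ((1 - r)\<^sup>2 + x\<^sup>2))) integrable_on {-pi..pi}" using bd by blast
    fix x assume x: "x \<in> {-pi..pi}"
    have "cmod (g (f (\<tau> + x)) - g (f \<tau>)) \<le> L * \<bar>x\<bar>"
      using chord_bound[of "f (\<tau> + x)" "f \<tau>"] lipschitz_onD[OF lip, of "\<tau> + x" \<tau>] by (simp add: dist_real_def)
    then have "\<bar>radial_kernel r x\<bar> * cmod (g (f (\<tau> + x)) - g (f \<tau>)) \<le> (18 / ((1 - r)\<^sup>2 + x\<^sup>2)) * (L * \<bar>x\<bar>)"
      using r x by (intro mult_mono radial_kernel_bound) auto
    then show "cmod (of_real (radial_kernel r x) * (g (f (\<tau> + x)) - g (f \<tau>))) \<le> 18 * L * (\<bar>x\<bar> / ((1 - r)\<^sup>2 + x\<^sup>2))"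
      by (simp add: norm_mult mult_ac)
  qed
  then show "cmod (radial_int f r \<tau>) \<le> 18 * L * ln (((1 - r)\<^sup>2 + pi\<^sup>2) / (1 - r)\<^sup>2)"
    using integral_unique[OF bd] by simp
  have bl: "bounded_linear (\<lambda>z. Im (cnj z * g' (f \<tau>)))"
    by (intro bounded_linear_compose[OF bounded_linear_Im] bounded_linear_mult_const bounded_linear_cnj bounded_linear_ident)
  have "Im (cnj (radial_int f r \<tau>) * g' (f \<tau>)) = integral {-pi..pi}
      ((\<lambda>z. Im (cnj z * g' (f \<tau>))) \<circ> (\<lambda>x. of_real (radial_kernel r x) * (g (f (\<tau> + x)) - g (f \<tau>))))"
    unfolding eq by (rule integral_linear[OF int bl, symmetric])
  then show "Im (cnj (radial_int f r \<tau>) * g' (f \<tau>)) = radial_det f r \<tau>"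
    by (simp add: radial_det_def chord_det_def o_def algebra_simps)
qed

text \<open>
For \<open>|x| \<le> \<surd>\<delta>\<close> the error \<open>|x| \<rho>(|x|)\<close> of the tangent approximation is at most \<open>|x| \<rho>(\<surd>\<delta>)\<close>, and the
kernel has bounded mass; for larger \<open>|x|\<close> the kernel itself is at most \<open>\<surd>\<delta> / x\<^sup>2\<close>, up to constants, and the Dini
integral is what remains.
\<close>

lemma tangential_bound:
  assumes L: "0 < L" and lip: "L-lipschitz_on UNIV f" and r: "1/2 \<le> r" "r < 1"
  shows "cmod (angular_int f r \<tau> - of_real (tangential_speed f r \<tau>) * g' (f \<tau>)) \<le> tangential_error L (1 - r)"
proof -
  define \<delta> where "\<delta> = 1 - r"
  have \<delta>: "0 < \<delta>" using r by (simp add: \<delta>_def)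
  have fc: "continuous_on UNIV f" using lip lipschitz_on_continuous_on by blast
  have fc': "continuous_on S (\<lambda>x. f (\<tau> + x))" for S
    by (rule continuous_on_compose2[OF fc]) (auto intro!: continuous_intros)
  have kc: "continuous_on S (angular_kernel r)" for S using kernels_continuous_on r by auto
  define E where "E x = g (f (\<tau> + x)) - g (f \<tau>) - of_real (f (\<tau> + x) - f \<tau>) * g' (f \<tau>)" for x
  have i1: "(\<lambda>x. of_real (angular_kernel r x) * (g (f (\<tau> + x)) - g (f \<tau>))) integrable_on {-pi..pi}"
    by (intro integrable_continuous_real continuous_intros kc chord_continuous_on fc)
  have i2: "((\<lambda>x. of_real (angular_kernel r x * (f (\<tau> + x) - f \<tau>)) * g' (f \<tau>)) has_integral
      (of_real (tangential_speed f r \<tau>) * g' (f \<tau>))) {-pi..pi}"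
    unfolding tangential_speed_def
    by (intro has_integral_mult_left has_integral_of_real integrable_integral integrable_continuous_real
        continuous_intros kc fc')
  have "angular_int f r \<tau> = integral {-pi..pi} (\<lambda>x. of_real (angular_kernel r x) * (g (f (\<tau> + x)) - g (f \<tau>)))"
    unfolding angular_int_def
    using r by (intro mean_zero_kernel_int kc angular_kernel_integral chord_continuous_on fc) auto
  then have "((\<lambda>x. of_real (angular_kernel r x) * (g (f (\<tau> + x)) - g (f \<tau>))
        - of_real (angular_kernel r x * (f (\<tau> + x) - f \<tau>)) * g' (f \<tau>)) has_integral
      (angular_int f r \<tau> - of_real (tangential_speed f r \<tau>) * g' (f \<tau>))) {-pi..pi}"
    using has_integral_diff[OF integrable_integral[OF i1] i2] by simp
  moreover have "of_real (angular_kernel r x) * (g (f (\<tau> + x)) - g (f \<tau>))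
        - of_real (angular_kernel r x * (f (\<tau> + x) - f \<tau>)) * g' (f \<tau>) = of_real (angular_kernel r x) * E x" for x
    by (simp add: E_def algebra_simps)
  ultimately have hi: "((\<lambda>x. of_real (angular_kernel r x) * E x) has_integral
      (angular_int f r \<tau> - of_real (tangential_speed f r \<tau>) * g' (f \<tau>))) {-pi..pi}" by simp
  define B where "B x = 216 * (\<delta> / (\<delta>\<^sup>2 + x\<^sup>2) * rho L (sqrt \<delta>) + sqrt \<delta> * (rho L \<bar>x\<bar> / \<bar>x\<bar>))" for x
  have hB: "(B has_integral 216 * (2 * arctan (pi / \<delta>) * rho L (sqrt \<delta>) + sqrt \<delta> * integral {-pi..pi} (\<lambda>x. rho L \<bar>x\<bar> / \<bar>x\<bar>))) {-pi..pi}"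
    unfolding B_def
    by (intro has_integral_mult_right has_integral_add has_integral_mult_left cauchy_density_integral \<delta>
        integrable_integral rho_abs_integrable L)
  have "cmod (of_real (angular_kernel r x) * E x) \<le> B x" if x: "x \<in> {-pi..pi}" for x
  proof -
    have "cmod (of_real (angular_kernel r x) * E x) \<le> \<bar>angular_kernel r x\<bar> * (\<bar>x\<bar> * rho L \<bar>x\<bar>)"
      using chord_tangent_bound[OF L lip, of \<tau> x] unfolding E_def norm_mult
      by (intro mult_mono) auto
    also have "\<dots> = \<bar>x * angular_kernel r x\<bar> * rho L \<bar>x\<bar>" by (simp add: abs_mult)
    also have "\<dots> \<le> 216 * (\<delta> / (\<delta>\<^sup>2 + x\<^sup>2)) * rho L \<bar>x\<bar>"
      using angular_kernel_bound[OF r, of x] x L rho_nonneg[of L "\<bar>x\<bar>"]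
      by (intro mult_right_mono) (auto simp: \<delta>_def abs_le_iff)
    also have "\<dots> = 216 * (\<delta> / (\<delta>\<^sup>2 + x\<^sup>2) * rho L \<bar>x\<bar>)" by simp
    also have "\<delta> / (\<delta>\<^sup>2 + x\<^sup>2) * rho L \<bar>x\<bar> \<le> \<delta> / (\<delta>\<^sup>2 + x\<^sup>2) * rho L (sqrt \<delta>) + sqrt \<delta> * (rho L \<bar>x\<bar> / \<bar>x\<bar>)"
    proof (cases "\<bar>x\<bar> \<le> sqrt \<delta>")
      case True
      have "\<delta> / (\<delta>\<^sup>2 + x\<^sup>2) * rho L \<bar>x\<bar> \<le> \<delta> / (\<delta>\<^sup>2 + x\<^sup>2) * rho L (sqrt \<delta>)"
        using True L \<delta> by (intro mult_left_mono rho_mono) auto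
      moreover have "0 \<le> sqrt \<delta> * (rho L \<bar>x\<bar> / \<bar>x\<bar>)"
        using L \<delta> rho_nonneg[of L "\<bar>x\<bar>"] by simp
      ultimately show ?thesis by linarith
    next
      case False
      then have x0: "0 < \<bar>x\<bar>" and sx: "sqrt \<delta> < \<bar>x\<bar>" using \<delta> by (auto simp: not_le)
      have "\<delta> / (\<delta>\<^sup>2 + x\<^sup>2) \<le> \<delta> / x\<^sup>2"
        using x0 \<delta> by (intro divide_left_mono mult_pos_pos add_nonneg_pos) auto
      also have "\<dots> = (\<delta> / \<bar>x\<bar>) / \<bar>x\<bar>" by (simp add: power2_eq_square)
      also have "\<dots> \<le> sqrt \<delta> / \<bar>x\<bar>"
      proof (rule divide_right_mono)
        have "\<delta> = sqrt \<delta> * sqrt \<delta>" using \<delta> by simp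
        also have "\<dots> \<le> sqrt \<delta> * \<bar>x\<bar>" using sx \<delta> by (intro mult_left_mono) auto
        finally show "\<delta> / \<bar>x\<bar> \<le> sqrt \<delta>" using x0 by (simp add: divide_le_eq)
      qed auto
      finally have "\<delta> / (\<delta>\<^sup>2 + x\<^sup>2) * rho L \<bar>x\<bar> \<le> sqrt \<delta> / \<bar>x\<bar> * rho L \<bar>x\<bar>"
        using L rho_nonneg[of L "\<bar>x\<bar>"] by (intro mult_right_mono) auto
      moreover have "0 \<le> \<delta> / (\<delta>\<^sup>2 + x\<^sup>2) * rho L (sqrt \<delta>)"
        using L \<delta> rho_nonneg[of L "sqrt \<delta>"] by simp
      ultimately show ?thesis by simp
    qed
    finally show ?thesis unfolding B_def by simp
  qed
  then have "cmod (integral {-pi..pi} (\<lambda>x. of_real (angular_kernel r x) * E x)) \<le> integral {-pi..pi} B"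
    using hi hB by (intro integral_norm_bound_integral) auto
  then have "cmod (angular_int f r \<tau> - of_real (tangential_speed f r \<tau>) * g' (f \<tau>))
      \<le> 216 * (2 * arctan (pi / \<delta>) * rho L (sqrt \<delta>) + sqrt \<delta> * integral {-pi..pi} (\<lambda>x. rho L \<bar>x\<bar> / \<bar>x\<bar>))"
    unfolding integral_unique[OF hi] integral_unique[OF hB] .
  also have "\<dots> \<le> tangential_error L \<delta>"
    unfolding tangential_error_def
    using L \<delta> rho_nonneg[of L "sqrt \<delta>"] arctan_ubound[of "pi / \<delta>"]
    by (intro mult_left_mono add_right_mono mult_right_mono) auto
  finally show ?thesis by (simp add: \<delta>_def)
qed

lemma rho_log_tendsto_0:
  assumes L: "0 < L"
  shows "((\<lambda>y. rho L y * ln (1 / y)) \<longlongrightarrow> 0) (at_right 0)"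
  using L by (intro dini_log_tendsto_0 rho_mono rho_nonneg rho_integrable) auto

lemma rho_tendsto_0:
  assumes L: "0 < L"
  shows "((\<lambda>y. rho L y) \<longlongrightarrow> 0) (at_right 0)"
proof (rule tendsto_sandwich[OF _ _ tendsto_const rho_log_tendsto_0[OF L]])
  show "\<forall>\<^sub>F y in at_right 0. 0 \<le> rho L y"
    unfolding eventually_at_right_field using L by (intro exI[of _ 1]) (auto intro: rho_nonneg)
  show "\<forall>\<^sub>F y in at_right 0. rho L y \<le> rho L y * ln (1 / y)"
    unfolding eventually_at_right_field
  proof (intro exI[of _ "exp (-1)"] conjI allI impI)
    fix y :: real assume y: "0 < y" "y < exp (-1)"
    have "ln y < -1" using y by (metis ln_exp ln_less_cancel_iff exp_gt_zero)
    then have "1 \<le> ln (1 / y)" using y by (simp add: ln_div)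
    then show "rho L y \<le> rho L y * ln (1 / y)"
      using mult_left_mono[of 1 "ln (1 / y)" "rho L y"] rho_nonneg[of L y] L y by simp
  qed auto
qed

text \<open>
The second limit is the heart of the matter: the error beats the logarithmic growth of the radial
derivative. Passing from \<open>\<delta>\<close> to \<open>\<surd>\<delta>\<close> only doubles the logarithm.
\<close>

lemma tangential_error_tendsto_0:
  assumes L: "0 < L"
  shows "(tangential_error L \<longlongrightarrow> 0) (at_right 0)"
    and "((\<lambda>\<delta>. ln ((\<delta>\<^sup>2 + pi\<^sup>2) / \<delta>\<^sup>2) * tangential_error L \<delta>) \<longlongrightarrow> 0) (at_right 0)"
proof -
  define I where "I = integral {-pi..pi} (\<lambda>x. rho L \<bar>x\<bar> / \<bar>x\<bar>)"
  define h where "h y = 216 * (pi * rho L y + y * I)" for y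
  have sq: "filterlim sqrt (at_right 0) (at_right (0::real))"
  proof -
    have "(sqrt \<longlongrightarrow> sqrt 0) (at_right 0)" by (intro tendsto_intros)
    then show ?thesis unfolding filterlim_at
      by (auto simp: eventually_at_right_field intro: exI[of _ 1])
  qed
  have te: "tangential_error L \<delta> = h (sqrt \<delta>)" for \<delta>
    by (simp add: tangential_error_def h_def I_def)
  have id0: "((\<lambda>y::real. y) \<longlongrightarrow> 0) (at_right 0)" by (rule tendsto_ident_at)
  have h0: "(h \<longlongrightarrow> 216 * (pi * 0 + 0 * I)) (at_right 0)"
    unfolding h_def by (intro tendsto_intros rho_tendsto_0[OF L] id0)
  have te': "tangential_error L = (\<lambda>\<delta>. h (sqrt \<delta>))" by (rule ext) (rule te)
  from filterlim_compose[OF h0 sq] show "(tangential_error L \<longlongrightarrow> 0) (at_right 0)"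
    unfolding te' by simp
  have hl: "((\<lambda>y. h y * ln (1 / y)) \<longlongrightarrow> 0) (at_right 0)"
  proof -
    have "((\<lambda>y. 216 * (pi * (rho L y * ln (1 / y)) + I * (y * ln (1 / y)))) \<longlongrightarrow> 216 * (pi * 0 + I * 0)) (at_right 0)"
      by (intro tendsto_intros rho_log_tendsto_0[OF L] mult_log_tendsto_0)
    then show ?thesis by (simp add: h_def algebra_simps)
  qed
  have bnd: "((\<lambda>y. ln (1 + pi\<^sup>2) * h y + 4 * (h y * ln (1 / y))) \<longlongrightarrow> ln (1 + pi\<^sup>2) * (216 * (pi * 0 + 0 * I)) + 4 * 0) (at_right 0)"
    by (intro tendsto_intros h0 hl)
  show "((\<lambda>\<delta>. ln ((\<delta>\<^sup>2 + pi\<^sup>2) / \<delta>\<^sup>2) * tangential_error L \<delta>) \<longlongrightarrow> 0) (at_right 0)"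
  proof (rule tendsto_sandwich[OF _ _ tendsto_const])
    show "((\<lambda>\<delta>. ln (1 + pi\<^sup>2) * h (sqrt \<delta>) + 4 * (h (sqrt \<delta>) * ln (1 / sqrt \<delta>))) \<longlongrightarrow> 0) (at_right 0)"
      using filterlim_compose[OF bnd sq] by simp
    have Inn: "0 \<le> I" unfolding I_def
      using L by (intro Henstock_Kurzweil_Integration.integral_nonneg rho_abs_integrable) (auto intro!: divide_nonneg_nonneg rho_nonneg)
    have "0 \<le> ln ((\<delta>\<^sup>2 + pi\<^sup>2) / \<delta>\<^sup>2) * tangential_error L \<delta> \<and>
        ln ((\<delta>\<^sup>2 + pi\<^sup>2) / \<delta>\<^sup>2) * tangential_error L \<delta> \<le> ln (1 + pi\<^sup>2) * h (sqrt \<delta>) + 4 * (h (sqrt \<delta>) * ln (1 / sqrt \<delta>))"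
      if \<delta>: "0 < \<delta>" "\<delta> < 1" for \<delta>
    proof -
      have hnn: "0 \<le> h (sqrt \<delta>)" using \<delta> L Inn by (simp add: h_def rho_nonneg)
      have "2 * ln (1 / \<delta>) = 4 * ln (1 / sqrt \<delta>)" using \<delta> by (simp add: ln_div ln_sqrt)
      with log_ratio_bounds[OF \<delta>]
      have up: "ln ((\<delta>\<^sup>2 + pi\<^sup>2) / \<delta>\<^sup>2) \<le> ln (1 + pi\<^sup>2) + 4 * ln (1 / sqrt \<delta>)"
        and "0 \<le> ln ((\<delta>\<^sup>2 + pi\<^sup>2) / \<delta>\<^sup>2)" by simp_all
      then show ?thesis using mult_right_mono[OF up hnn] hnn by (simp add: te algebra_simps)
    qed
    then show "\<forall>\<^sub>F \<delta> in at_right 0. 0 \<le> ln ((\<delta>\<^sup>2 + pi\<^sup>2) / \<delta>\<^sup>2) * tangential_error L \<delta>"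
      and "\<forall>\<^sub>F \<delta> in at_right 0. ln ((\<delta>\<^sup>2 + pi\<^sup>2) / \<delta>\<^sup>2) * tangential_error L \<delta> \<le> ln (1 + pi\<^sup>2) * h (sqrt \<delta>) + 4 * (h (sqrt \<delta>) * ln (1 / sqrt \<delta>))"
      unfolding eventually_at_right_field by (auto intro!: exI[of _ 1])
  qed
qed

text \<open>
Write \<open>w\<^sub>\<tau> = a e + E\<close> with \<open>e\<close> the unit tangent. The determinant of \<open>r w\<^sub>r\<close> with \<open>a e\<close> is the main term, and
the determinant with \<open>E\<close> is at most a logarithm times \<open>|E|\<close>.
\<close>

lemma polar_det_estimate:
  assumes L: "0 < L" and lip: "L-lipschitz_on UNIV f" and r: "1/2 \<le> r" "r < 1"
  shows "\<bar>Im (cnj (radial_int f r \<tau>) * angular_int f r \<tau>) - tangential_speed f r \<tau> * radial_det f r \<tau>\<bar>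
    \<le> 18 * L * (ln (((1 - r)\<^sup>2 + pi\<^sup>2) / (1 - r)\<^sup>2) * tangential_error L (1 - r))"
proof -
  define E where "E = angular_int f r \<tau> - of_real (tangential_speed f r \<tau>) * g' (f \<tau>)"
  have "Im (cnj (radial_int f r \<tau>) * angular_int f r \<tau>) - tangential_speed f r \<tau> * radial_det f r \<tau>
      = Im (cnj (radial_int f r \<tau>) * E)"
    unfolding radial_int_bound_and_det(2)[OF assms, symmetric] E_def by (simp add: algebra_simps)
  also have "\<bar>\<dots>\<bar> \<le> cmod (radial_int f r \<tau>) * cmod E"
    using abs_Im_le_cmod[of "cnj (radial_int f r \<tau>) * E"] by (simp only: norm_mult complex_mod_cnj)
  also have "\<dots> \<le> (18 * L * ln (((1 - r)\<^sup>2 + pi\<^sup>2) / (1 - r)\<^sup>2)) * tangential_error L (1 - r)"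
    using radial_int_bound_and_det(1)[OF assms, of \<tau>] tangential_bound[OF assms, of \<tau>] unfolding E_def[symmetric]
    by (rule mult_mono[OF _ _ order_trans[OF norm_ge_zero radial_int_bound_and_det(1)[OF assms]] norm_ge_zero])
  finally show ?thesis by simp
qed

end

section \<open>Poisson integrals as sums of Cauchy integrals\<close>

lemma cis_minus_nonzero: "cmod z < 1 \<Longrightarrow> cis t - z \<noteq> 0"
  by (metis norm_cis eq_iff_diff_eq_0 less_irrefl)

lemma cauchy_kernel_deriv_integral:
  fixes z :: complex
  assumes z: "cmod z < 1"
  shows "integral {0..2*pi} (\<lambda>t. cis t / (cis t - z)\<^sup>2) = 0"
proof -
  note nz = cis_minus_nonzero[OF z]
  have "((\<lambda>t. \<i> / (cis t - z)) has_vector_derivative (cis t / (cis t - z)\<^sup>2)) (at t within {0..2*pi})" for t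
  proof -
    have 1: "((\<lambda>w. \<i> / (exp (\<i> * w) - z)) has_field_derivative (exp (\<i> * of_real t) / (exp (\<i> * of_real t) - z)\<^sup>2)) (at (of_real t))"
    proof -
      have "- (\<i> * (E * \<i>) / N) = E / N" for E N :: complex
        unfolding mult.commute[of E \<i>] by simp
      then show ?thesis
        using nz[of t] by (auto intro!: derivative_eq_intros simp: cis_conv_exp power2_eq_square)
    qed
    show ?thesis
      using has_vector_derivative_real_field[OF 1] by (simp add: cis_conv_exp)
  qed
  then have "((\<lambda>t. cis t / (cis t - z)\<^sup>2) has_integral (\<i> / (cis (2*pi) - z) - \<i> / (cis 0 - z))) {0..2*pi}"
    by (intro fundamental_theorem_of_calculus) auto
  then show ?thesis by (simp add: integral_unique)
qed

text \<open>
The Cauchy integral over the unit circle, written in the angle. Both \<open>h\<close> and the holomorphic function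
\<open>k\<close> in \<open>h + cnj k\<close> are of this form, up to a constant.
\<close>

definition cauchy_transform :: "(real \<Rightarrow> complex) \<Rightarrow> complex \<Rightarrow> complex" where
  "cauchy_transform G z = integral {0..2*pi} (\<lambda>t. cis t / (cis t - z) * G t) / (2 * pi)"

definition cauchy_transform_deriv :: "(real \<Rightarrow> complex) \<Rightarrow> complex \<Rightarrow> complex" where
  "cauchy_transform_deriv G z = integral {0..2*pi} (\<lambda>t. cis t / (cis t - z)\<^sup>2 * G t) / (2 * pi)"

lemma cauchy_transform_has_derivative:
  assumes G: "continuous_on {0..2*pi} G" and z: "cmod z < 1"
  shows "(cauchy_transform G has_field_derivative cauchy_transform_deriv G z) (at z)"
proof -
  have "((\<lambda>z. integral (cbox 0 (2*pi)) (\<lambda>t. cis t / (cis t - z) * G t)) has_field_derivative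
      integral (cbox 0 (2*pi)) (\<lambda>t. cis t / (cis t - z)\<^sup>2 * G t)) (at z within ball 0 1)"
  proof (rule leibniz_rule_field_derivative)
    show "z \<in> ball 0 1" using z by simp
  next
    fix x :: complex and t :: real assume "x \<in> ball 0 1" "t \<in> cbox 0 (2*pi)"
    then have "cis t - x \<noteq> 0" by (intro cis_minus_nonzero) auto
    then show "((\<lambda>x. cis t / (cis t - x) * G t) has_field_derivative cis t / (cis t - x)\<^sup>2 * G t) (at x within ball 0 1)"
      by (auto intro!: derivative_eq_intros simp: power2_eq_square)
  next
    fix x :: complex assume "x \<in> ball 0 1"
    then have "cis t - x \<noteq> 0" for t by (intro cis_minus_nonzero) auto
    then show "(\<lambda>t. cis t / (cis t - x) * G t) integrable_on cbox 0 (2*pi)"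
      using G by (intro integrable_continuous continuous_intros) auto
  next
    have G2: "continuous_on (ball 0 1 \<times> cbox 0 (2*pi)) (\<lambda>p::complex \<times> real. G (snd p))"
      by (rule continuous_on_compose2[OF G]) (auto intro!: continuous_intros)
    have "cis (snd p) - fst p \<noteq> 0" if "p \<in> ball 0 1 \<times> cbox 0 (2*pi)" for p :: "complex \<times> real"
      using that by (intro cis_minus_nonzero) auto
    then show "continuous_on (ball 0 1 \<times> cbox 0 (2*pi)) (\<lambda>(x, t). cis t / (cis t - x)\<^sup>2 * G t)"
      unfolding split_def by (intro continuous_intros G2) auto
  qed (use z in auto)
  moreover have "at z within ball 0 1 = at z" using z by (intro at_within_open) auto
  ultimately have "((\<lambda>z. integral {0..2*pi} (\<lambda>t. cis t / (cis t - z) * G t)) has_field_derivative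
      integral {0..2*pi} (\<lambda>t. cis t / (cis t - z)\<^sup>2 * G t)) (at z)" by simp
  from DERIV_cdivide[OF this, of "2 * pi"] show ?thesis
    unfolding cauchy_transform_def[abs_def] cauchy_transform_deriv_def by simp
qed

lemma cauchy_transform_holomorphic:
  assumes G: "continuous_on {0..2*pi} G"
  shows "cauchy_transform G holomorphic_on ball 0 1" "cauchy_transform_deriv G holomorphic_on ball 0 1"
proof -
  have d: "(cauchy_transform G has_field_derivative cauchy_transform_deriv G z) (at z)" if "z \<in> ball 0 1" for z
    using cauchy_transform_has_derivative[OF G] that by auto
  show 1: "cauchy_transform G holomorphic_on ball 0 1"
    unfolding holomorphic_on_open[OF open_ball] using d by blast
  have "deriv (cauchy_transform G) z = cauchy_transform_deriv G z" if "z \<in> ball 0 1" for z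
    using DERIV_imp_deriv[OF d[OF that]] .
  then show "cauchy_transform_deriv G holomorphic_on ball 0 1"
    using holomorphic_transform[OF holomorphic_deriv[OF 1 open_ball]] by auto
qed

lemma cauchy_transform_const:
  assumes "cmod z < 1"
  shows "cauchy_transform (\<lambda>_. 1) z = 1"
proof -
  have "(cauchy_transform (\<lambda>_. 1) has_field_derivative 0) (at w within ball 0 1)" if "w \<in> ball 0 1" for w
  proof -
    have "cauchy_transform_deriv (\<lambda>_. 1) w = 0"
      using cauchy_kernel_deriv_integral[of w] that by (simp add: cauchy_transform_deriv_def)
    then show ?thesis
      using cauchy_transform_has_derivative[of "\<lambda>_. 1" w] that has_field_derivative_at_within by force
  qed
  then have "cauchy_transform (\<lambda>_. 1) z = cauchy_transform (\<lambda>_. 1) 0"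
    using has_field_derivative_zero_constant[of "ball 0 1" "cauchy_transform (\<lambda>_. 1)"] assms by (metis centre_in_ball convex_ball dist_0_norm mem_ball zero_less_one)
  also have "\<dots> = 1" by (simp add: cauchy_transform_def scaleR_conv_of_real)
  finally show ?thesis .
qed

lemma cauchy_transform_deriv_diff_bound:
  assumes G: "continuous_on {0..2*pi} G1" "continuous_on {0..2*pi} G2"
    and d: "\<And>t. t \<in> {0..2*pi} \<Longrightarrow> cmod (G1 t - G2 t) \<le> d" and z: "cmod z \<le> R" "R < 1"
  shows "cmod (cauchy_transform_deriv G1 z - cauchy_transform_deriv G2 z) \<le> d / (1 - R)\<^sup>2"
proof -
  have nz: "cis t - z \<noteq> 0" for t using z by (intro cis_minus_nonzero) auto
  define q where "q t = cis t / (cis t - z)\<^sup>2" for t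
  have qc: "continuous_on {0..2*pi} q" unfolding q_def using nz by (intro continuous_intros) auto
  have i: "(\<lambda>t. q t * G1 t) integrable_on {0..2*pi}" "(\<lambda>t. q t * G2 t) integrable_on {0..2*pi}"
    by (intro integrable_continuous_real continuous_intros qc G)+
  have "cmod (integral {0..2*pi} (\<lambda>t. q t * G1 t - q t * G2 t)) \<le> integral {0..2*pi} (\<lambda>t. d / (1 - R)\<^sup>2)"
  proof (rule integral_norm_bound_integral)
    show "(\<lambda>t. q t * G1 t - q t * G2 t) integrable_on {0..2*pi}" by (intro integrable_diff i)
    fix t assume t: "t \<in> {0..2*pi}"
    have "1 - R \<le> cmod (cis t - z)" using norm_triangle_ineq2[of "cis t" z] z by simp
    then have "(1 - R)\<^sup>2 \<le> (cmod (cis t - z))\<^sup>2" using z by (intro power_mono) auto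
    then have "cmod (q t) \<le> 1 / (1 - R)\<^sup>2"
      using z unfolding q_def norm_divide norm_power norm_cis by (intro divide_left_mono mult_pos_pos) auto
    then have "cmod (q t) * cmod (G1 t - G2 t) \<le> (1 / (1 - R)\<^sup>2) * d"
      using d[OF t] by (intro mult_mono) auto
    then show "cmod (q t * G1 t - q t * G2 t) \<le> d / (1 - R)\<^sup>2"
      by (simp add: norm_mult flip: right_diff_distrib)
  qed auto
  also have "integral {0..2*pi} (\<lambda>t. q t * G1 t - q t * G2 t) = integral {0..2*pi} (\<lambda>t. q t * G1 t) - integral {0..2*pi} (\<lambda>t. q t * G2 t)"
    by (rule Henstock_Kurzweil_Integration.integral_diff[OF i])
  finally have b: "cmod (integral {0..2*pi} (\<lambda>t. q t * G1 t) - integral {0..2*pi} (\<lambda>t. q t * G2 t)) \<le> 2 * pi * (d / (1 - R)\<^sup>2)"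
    by simp
  have "cauchy_transform_deriv G1 z - cauchy_transform_deriv G2 z
      = (integral {0..2*pi} (\<lambda>t. q t * G1 t) - integral {0..2*pi} (\<lambda>t. q t * G2 t)) / of_real (2 * pi)"
    by (simp add: cauchy_transform_deriv_def q_def diff_divide_distrib)
  then have "cmod (cauchy_transform_deriv G1 z - cauchy_transform_deriv G2 z)
      = cmod (integral {0..2*pi} (\<lambda>t. q t * G1 t) - integral {0..2*pi} (\<lambda>t. q t * G2 t)) / (2 * pi)"
    by (simp only: norm_divide norm_of_real) simp
  also have "\<dots> \<le> 2 * pi * (d / (1 - R)\<^sup>2) / (2 * pi)" using b by (intro divide_right_mono) auto
  also have "\<dots> = d / (1 - R)\<^sup>2" by simp
  finally show ?thesis .
qed

text \<open>
The first two say that the polar derivatives of the Poisson kernel are the real and imaginary parts of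
the kernel of \<open>z h'(z)\<close>, the third that the Poisson kernel is the real part of the Cauchy kernel.
\<close>

lemma cis_kernel_identities:
  assumes "0 \<le> r" "r < 1"
  shows "Re (of_real r * cis x / (cis x - of_real r)\<^sup>2) = pi * radial_kernel r x"
    and "Im (of_real r * cis x / (cis x - of_real r)\<^sup>2) = - (pi * angular_kernel r x)"
    and "2 * Re (cis x / (cis x - of_real r)) - 1 = 2 * pi * poisson_kernel r x"
proof -
  define D where "D = kernel_denom r x"
  have pos: "0 < D" unfolding D_def using assms by (intro kernel_denom_pos) auto
  define c where "c = cis x - of_real r"
  have cc: "cnj c = cis (- x) - of_real r" by (simp add: c_def cis_cnj)
  have "Re (c * cnj c) = (cos x)\<^sup>2 + (sin x)\<^sup>2 - 2 * r * cos x + r\<^sup>2"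
    by (simp add: c_def power2_eq_square algebra_simps)
  then have "Re (c * cnj c) = D" by (simp add: D_def kernel_denom_def)
  then have n: "c * cnj c = of_real D" by (simp add: complex_eq_iff)
  have nz: "c \<noteq> 0" "cnj c \<noteq> 0" using n pos by auto
  have "of_real r * cis x / c\<^sup>2 = of_real r * cis x * (cnj c)\<^sup>2 / (c * cnj c)\<^sup>2"
    using nz by (simp add: power_mult_distrib)
  also have "\<dots> = of_real r * (cis x * (cnj c)\<^sup>2) / of_real (D\<^sup>2)"
    unfolding n by simp
  also have "cis x * (cnj c)\<^sup>2 = cis (- x) - 2 * of_real r + of_real r ^ 2 * cis x"
  proof -
    have "cis x * (cnj c)\<^sup>2 = (cis x * cis (-x)) * cis (-x) - 2 * of_real r * (cis x * cis (-x)) + of_real r ^ 2 * cis x"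
      unfolding cc by (simp add: power2_eq_square algebra_simps)
    then show ?thesis by (simp add: cis_mult)
  qed
  finally have q: "of_real r * cis x / (cis x - of_real r)\<^sup>2
      = of_real r * (cis (- x) - 2 * of_real r + of_real (r\<^sup>2) * cis x) / of_real (D\<^sup>2)"
    by (simp add: c_def)
  have "pi * radial_kernel r x = r * ((1 + r\<^sup>2) * cos x - 2 * r) / D\<^sup>2"
    by (simp add: radial_kernel_def D_def)
  then show "Re (of_real r * cis x / (cis x - of_real r)\<^sup>2) = pi * radial_kernel r x"
    unfolding q Re_divide_of_real by (simp add: algebra_simps del: of_real_power)
  have "pi * angular_kernel r x = r * (1 - r\<^sup>2) * sin x / D\<^sup>2"
    by (simp add: angular_kernel_def D_def)
  then show "Im (of_real r * cis x / (cis x - of_real r)\<^sup>2) = - (pi * angular_kernel r x)"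
    unfolding q Im_divide_of_real
    by (simp add: algebra_simps diff_divide_distrib add_divide_distrib del: of_real_power)
  have "cis x / c = cis x * cnj c / (c * cnj c)"
    using nz by simp
  also have "\<dots> = (1 - of_real r * cis x) / of_real D"
    unfolding n by (simp add: cc algebra_simps cis_mult)
  finally have "Re (cis x / (cis x - of_real r)) = (1 - r * cos x) / D" by (simp add: Re_divide_of_real c_def)
  moreover have "2 * ((1 - r * cos x) / D) - 1 = (2 * (1 - r * cos x) - D) / D"
    using pos by (simp add: diff_divide_distrib)
  moreover have "2 * (1 - r * cos x) - D = 1 - r\<^sup>2" by (simp add: D_def kernel_denom_def algebra_simps)
  ultimately show "2 * Re (cis x / (cis x - of_real r)) - 1 = 2 * pi * poisson_kernel r x"
    by (simp add: poisson_kernel_def D_def kernel_denom_def)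
qed

lemma has_integral_periodic_shift:
  fixes p :: "real \<Rightarrow> 'a::banach"
  assumes per: "\<And>x. p (x + T) = p x" and T: "0 < T" and int: "(p has_integral I) {a..a+T}"
  shows "(p has_integral I) {b..b+T}"
proof -
  interpret periodic_fun_simple p T by unfold_locales (rule per)
  have shift: "(p has_integral J) {c + of_int n * T..d + of_int n * T}" if "(p has_integral J) {c..d}" for c d J n
  proof -
    have "p \<circ> ((+) (of_int n * T)) = p" by (auto simp: fun_eq_iff add.commute plus_of_int)
    then show ?thesis using has_integral_shift_Icc_real[of p "of_int n * T" J c d] that by simp
  qed
  define n where "n = \<lfloor>(b - a) / T\<rfloor>"
  define c where "c = b - of_int n * T"
  have c: "a \<le> c" "c \<le> a + T"
    using floor_divide_lower[OF T, of "b - a"] floor_divide_upper[OF T, of "b - a"]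
    by (auto simp: c_def n_def algebra_simps)
  have pint: "p integrable_on {a..a+T}" using int by blast
  have i1: "(p has_integral integral {a..c} p) {a..c}" and i2: "(p has_integral integral {c..a+T} p) {c..a+T}"
    using integrable_on_subinterval[OF pint] c by (auto intro!: integrable_integral)
  have "integral {a..c} p + integral {c..a+T} p = I"
    using has_integral_combine[OF c i1 i2] int has_integral_unique by blast
  moreover have "(p has_integral (integral {c..a+T} p + integral {a..c} p)) {c..c+T}"
    using has_integral_combine[OF _ _ i2, of "c + T"] shift[OF i1, of 1] c by simp
  ultimately have "(p has_integral I) {c..c+T}" by (simp add: add.commute)
  from shift[OF this, of n] show ?thesis by (simp add: c_def algebra_simps)
qed

lemma integral_periodic_shift:
  fixes p :: "real \<Rightarrow> 'a::banach"
  assumes per: "\<And>x. p (x + 2 * pi) = p x" and int: "p integrable_on {0..2*pi}"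
  shows "integral {0..2*pi} p = integral {-pi..pi} (\<lambda>x. p (\<tau> + x))"
proof -
  have "(p has_integral integral {0..2*pi} p) {0..0 + 2*pi}" using int by (simp add: integrable_integral)
  from has_integral_periodic_shift[OF per _ this, of "\<tau> - pi"]
  have "(p has_integral integral {0..2*pi} p) {-pi + \<tau>..pi + \<tau>}" by (simp add: algebra_simps)
  then have "((\<lambda>x. p (\<tau> + x)) has_integral integral {0..2*pi} p) {-pi..pi}"
    using has_integral_shift_Icc_real[of p \<tau> _ "-pi" pi] by (simp add: o_def)
  then show ?thesis by (simp add: integral_unique)
qed

lemma has_integral_cnj_fun: "(p has_integral I) A \<Longrightarrow> ((\<lambda>x. cnj (p x)) has_integral cnj I) A"
  using has_integral_cnj[of p I A] by (simp add: o_def)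

text \<open>
Substituting \<open>t = \<tau> + x\<close> rotates the point \<open>z\<close> to the positive real axis.
\<close>

lemma rotated_cauchy_transform_deriv:
  fixes G :: "real \<Rightarrow> complex"
  assumes G: "continuous_on UNIV G" and per: "\<And>t. G (t + 2*pi) = G t" and r: "0 \<le> r" "r < 1"
  shows "of_real r * cis \<tau> * cauchy_transform_deriv G (of_real r * cis \<tau>) =
    integral {-pi..pi} (\<lambda>x. of_real r * cis x / (cis x - of_real r)\<^sup>2 * G (\<tau> + x)) / (2*pi)"
proof -
  define z where "z = of_real r * cis \<tau>"
  have z: "cmod z < 1" using r by (simp add: z_def norm_mult)
  define p where "p t = cis t / (cis t - z)\<^sup>2 * G t" for t
  have "continuous_on {0..2*pi} p" unfolding p_def
    using cis_minus_nonzero[OF z] by (intro continuous_intros continuous_on_subset[OF G]) auto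
  then have "p integrable_on {0..2*pi}" by (rule integrable_continuous_real)
  moreover have "cis (x + 2 * pi) = cis x" for x by (simp add: cis_mult[symmetric])
  then have "p (x + 2 * pi) = p x" for x by (simp add: p_def per)
  ultimately have eq: "integral {0..2*pi} p = integral {-pi..pi} (\<lambda>x. p (\<tau> + x))"
    by (intro integral_periodic_shift)
  have "cauchy_transform_deriv G z = integral {0..2*pi} p / (2*pi)"
    by (simp add: cauchy_transform_deriv_def p_def[abs_def])
  then have "cauchy_transform_deriv G z = integral {-pi..pi} (\<lambda>x. p (\<tau> + x)) / (2*pi)"
    by (simp only: eq)
  then have "z * cauchy_transform_deriv G z = integral {-pi..pi} (\<lambda>x. z * p (\<tau> + x)) / (2*pi)"
    by simp
  also have "(\<lambda>x. z * p (\<tau> + x)) = (\<lambda>x. of_real r * cis x / (cis x - of_real r)\<^sup>2 * G (\<tau> + x))"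
  proof
    fix x
    have "cis (\<tau> + x) - z = cis \<tau> * (cis x - of_real r)"
      by (simp add: z_def cis_mult[symmetric] algebra_simps)
    then have key: "z * (cis (\<tau> + x) / (cis (\<tau> + x) - z)\<^sup>2) = of_real r * cis x / (cis x - of_real r)\<^sup>2"
      by (simp add: z_def cis_mult[symmetric] power_mult_distrib power2_eq_square)
    have "z * p (\<tau> + x) = z * (cis (\<tau> + x) / (cis (\<tau> + x) - z)\<^sup>2) * G (\<tau> + x)"
      by (simp add: p_def)
    then show "z * p (\<tau> + x) = of_real r * cis x / (cis x - of_real r)\<^sup>2 * G (\<tau> + x)"
      unfolding key .
  qed
  finally show ?thesis by (simp add: z_def)
qed

text \<open>
The function \<open>k\<close> in the decomposition \<open>h + cnj k\<close>, normalised to vanish at the origin so that the mean value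
is not counted twice.
\<close>

definition conj_cauchy_transform :: "(real \<Rightarrow> complex) \<Rightarrow> complex \<Rightarrow> complex" where
  "conj_cauchy_transform G z = cauchy_transform (\<lambda>t. cnj (G t)) z - integral {0..2*pi} (\<lambda>t. cnj (G t)) / (2*pi)"

lemma conj_cauchy_transform_has_derivative:
  assumes "continuous_on {0..2*pi} G" "cmod z < 1"
  shows "(conj_cauchy_transform G has_field_derivative cauchy_transform_deriv (\<lambda>t. cnj (G t)) z) (at z)"
  unfolding conj_cauchy_transform_def[abs_def]
  using cauchy_transform_has_derivative[of "\<lambda>t. cnj (G t)" z] assms
  by (auto intro!: derivative_eq_intros continuous_intros)

lemma poisson_integral_eq:
  fixes G :: "real \<Rightarrow> complex"
  assumes G: "continuous_on {0..2*pi} G" and r: "0 \<le> r" "r < 1" and z: "z = of_real r * cis \<tau>"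
  shows "integral {0..2*pi} (\<lambda>t. of_real (poisson_kernel r (t - \<tau>)) * G t) =
    cauchy_transform G z + cnj (conj_cauchy_transform G z)"
proof -
  have zn: "cmod z < 1" using r z by (simp add: norm_mult)
  define q where "q t = cis t / (cis t - z)" for t
  have qc: "continuous_on {0..2*pi} q" unfolding q_def
    using cis_minus_nonzero[OF zn] by (intro continuous_intros) auto
  have i1: "(\<lambda>t. q t * G t) integrable_on {0..2*pi}" and i2: "(\<lambda>t. q t * cnj (G t)) integrable_on {0..2*pi}"
    and i3: "(\<lambda>t. cnj (G t)) integrable_on {0..2*pi}"
    by (intro integrable_continuous_real continuous_intros qc G)+
  have "((\<lambda>t. (q t * G t + cnj (q t * cnj (G t)) - cnj (cnj (G t))) / of_real (2*pi)) has_integral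
     ((integral {0..2*pi} (\<lambda>t. q t * G t) + cnj (integral {0..2*pi} (\<lambda>t. q t * cnj (G t)))
       - cnj (integral {0..2*pi} (\<lambda>t. cnj (G t)))) / of_real (2*pi))) {0..2*pi}"
    by (intro has_integral_divide has_integral_diff has_integral_add has_integral_cnj_fun integrable_integral i1 i2 i3)
  moreover have "(q t * G t + cnj (q t * cnj (G t)) - cnj (cnj (G t))) / of_real (2*pi)
      = of_real (poisson_kernel r (t - \<tau>)) * G t" for t
  proof -
    have "q t = cis (t - \<tau>) / (cis (t - \<tau>) - of_real r)"
    proof -
      have "cis t = cis \<tau> * cis (t - \<tau>)" by (simp add: cis_mult)
      then have "q t = (cis \<tau> * cis (t - \<tau>)) / (cis \<tau> * (cis (t - \<tau>) - of_real r))"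
        by (simp add: q_def z algebra_simps)
      then show ?thesis by simp
    qed
    then have "2 * Re (q t) - 1 = 2 * pi * poisson_kernel r (t - \<tau>)"
      using cis_kernel_identities(3)[OF r, of "t - \<tau>"] by simp
    then have "poisson_kernel r (t - \<tau>) = (2 * Re (q t) - 1) / (2 * pi)" by simp
    moreover have "q t + cnj (q t) - 1 = of_real (2 * Re (q t) - 1)"
      by (simp add: complex_add_cnj)
    ultimately have "of_real (poisson_kernel r (t - \<tau>)) = (q t + cnj (q t) - 1) / of_real (2 * pi)" by simp
    moreover have "q t * G t + cnj (q t * cnj (G t)) - cnj (cnj (G t)) = (q t + cnj (q t) - 1) * G t"
      by (simp add: algebra_simps)
    ultimately show ?thesis by simp
  qed
  ultimately have "((\<lambda>t. of_real (poisson_kernel r (t - \<tau>)) * G t) has_integral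
     ((integral {0..2*pi} (\<lambda>t. q t * G t) + cnj (integral {0..2*pi} (\<lambda>t. q t * cnj (G t)))
       - cnj (integral {0..2*pi} (\<lambda>t. cnj (G t)))) / of_real (2*pi))) {0..2*pi}" by simp
  then show ?thesis
    by (simp add: integral_unique cauchy_transform_def conj_cauchy_transform_def q_def add_divide_distrib diff_divide_distrib)
qed

lemma poisson_extension_eq:
  assumes G: "continuous_on {0..2*pi} G" and z: "cmod z < 1" and F: "\<And>t. F (cis t) = G t"
  shows "poisson_extension F z = cauchy_transform G z + cnj (conj_cauchy_transform G z)"
proof -
  have "z = of_real (cmod z) * cis (Arg z)" by (metis rcis_cmod_Arg rcis_def)
  from poisson_integral_eq[OF G _ z this] show ?thesis
    by (simp add: poisson_extension_def F)
qed

text \<open>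
The harmonic extension of the constant \<open>1\<close> is \<open>1\<close>.
\<close>

lemma poisson_kernel_integral:
  assumes r: "0 \<le> r" "r < 1"
  shows "(poisson_kernel r has_integral 1) {-pi..pi}"
proof -
  have c: "continuous_on S (poisson_kernel r)" for S using kernels_continuous_on(3) r by auto
  have "integral {0..2*pi} (\<lambda>t. of_real (poisson_kernel r (t - pi)) * 1) =
     cauchy_transform (\<lambda>_. 1) (of_real r * cis pi) + cnj (conj_cauchy_transform (\<lambda>_. 1) (of_real r * cis pi))"
    by (rule poisson_integral_eq) (use r in auto)
  also have "\<dots> = 1"
    using cauchy_transform_const[of "of_real r * cis pi"] r
    by (simp add: conj_cauchy_transform_def norm_mult scaleR_conv_of_real)
  finally have 1: "integral {0..2*pi} (\<lambda>t. complex_of_real (poisson_kernel r (t - pi))) = 1" by simp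
  have "continuous_on {0..2*pi} (\<lambda>t. poisson_kernel r (t - pi))"
    by (rule continuous_on_compose2[OF c[of UNIV]]) (auto intro!: continuous_intros)
  then have i: "(\<lambda>t. poisson_kernel r (t - pi)) integrable_on {0..2*pi}" by (rule integrable_continuous_real)
  have "((\<lambda>t. complex_of_real (poisson_kernel r (t - pi))) has_integral
      complex_of_real (integral {0..2*pi} (\<lambda>t. poisson_kernel r (t - pi)))) {0..2*pi}"
    by (rule has_integral_of_real[OF integrable_integral[OF i]])
  from integral_unique[OF this] 1
  have "complex_of_real (integral {0..2*pi} (\<lambda>t. poisson_kernel r (t - pi))) = 1" by metis
  then have "integral {0..2*pi} (\<lambda>t. poisson_kernel r (t - pi)) = 1" by (simp only: of_real_eq_1_iff)
  with i have "((\<lambda>t. poisson_kernel r (t - pi)) has_integral 1) {0..2*pi}" by (metis integrable_integral)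
  then have "((poisson_kernel r \<circ> (+) (- pi)) has_integral 1) {0..2*pi}" by (simp add: o_def)
  then show ?thesis unfolding has_integral_shift_Icc_real by simp
qed

text \<open>
Integration by parts against the Poisson kernel, whose total mass is \<open>1\<close>; the boundary terms account for the
deviation of the value from \<open>1\<close>.
\<close>

lemma angular_kernel_moment:
  assumes r: "0 \<le> r" "r < 1"
  shows "((\<lambda>x. x * angular_kernel r x) has_integral (2 * r / (1 + r))) {-pi..pi}"
proof -
  have "((\<lambda>x. x * poisson_kernel r x) has_real_derivative (poisson_kernel r x - x * angular_kernel r x)) (at x within {-pi..pi})" for x
    using poisson_kernel_has_derivative[of r x] r by (auto intro!: derivative_eq_intros)
  then have "((\<lambda>x. poisson_kernel r x - x * angular_kernel r x) has_integral
      (pi * poisson_kernel r pi - (-pi) * poisson_kernel r (-pi))) {-pi..pi}"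
    by (intro fundamental_theorem_of_calculus) (auto simp: has_real_derivative_iff_has_vector_derivative)
  from has_integral_diff[OF poisson_kernel_integral[OF r] this]
  have "((\<lambda>x. x * angular_kernel r x) has_integral (1 - (pi * poisson_kernel r pi + pi * poisson_kernel r pi))) {-pi..pi}"
    by (simp add: poisson_kernel_def)
  moreover have "pi * poisson_kernel r pi + pi * poisson_kernel r pi = (1 - r) / (1 + r)"
  proof -
    have "1 + 2 * r + r\<^sup>2 = (1 + r) * (1 + r)" "1 - r\<^sup>2 = (1 - r) * (1 + r)"
      by (simp_all add: power2_eq_square algebra_simps)
    then have P: "poisson_kernel r pi = (1 - r) / (2 * pi * (1 + r))"
      using r by (simp add: poisson_kernel_def)
    have "pi * poisson_kernel r pi + pi * poisson_kernel r pi = (2 * pi) * poisson_kernel r pi" by simp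
    also have "\<dots> = (1 - r) / (1 + r)" unfolding P by simp
    finally show ?thesis .
  qed
  moreover have "1 - (1 - r) / (1 + r) = 2 * r / (1 + r)" using r by (simp add: field_simps)
  ultimately show ?thesis by simp
qed

section \<open>Polar derivatives of the extension of a closed curve\<close>

locale dini_jordan = dini_curve +
  fixes l :: real
  assumes l: "0 < l" and per: "\<And>s. g (s + l) = g s" and inj: "inj_on g {0..<l}"
begin

lemma g'_periodic: "g' (s + l) = g' s"
  by (rule derivative_of_periodic_function[OF per der])

text \<open>
The reparametrizations \<open>f\<close> for which \<open>g \<circ> f\<close> runs through the curve with degree one.
\<close>

definition admissible :: "real \<Rightarrow> (real \<Rightarrow> real) \<Rightarrow> bool" where
  "admissible L f \<longleftrightarrow> 0 < L \<and> L-lipschitz_on UNIV f \<and> (\<forall>t. f (t + 2*pi) = f t + l)"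

abbreviation hol_part :: "(real \<Rightarrow> real) \<Rightarrow> complex \<Rightarrow> complex" where
  "hol_part f \<equiv> cauchy_transform (\<lambda>t. g (f t))"
abbreviation antihol_part :: "(real \<Rightarrow> real) \<Rightarrow> complex \<Rightarrow> complex" where
  "antihol_part f \<equiv> conj_cauchy_transform (\<lambda>t. g (f t))"
abbreviation hol_deriv :: "(real \<Rightarrow> real) \<Rightarrow> complex \<Rightarrow> complex" where
  "hol_deriv f \<equiv> cauchy_transform_deriv (\<lambda>t. g (f t))"
abbreviation antihol_deriv :: "(real \<Rightarrow> real) \<Rightarrow> complex \<Rightarrow> complex" where
  "antihol_deriv f \<equiv> cauchy_transform_deriv (\<lambda>t. cnj (g (f t)))"

context
  fixes L :: real and f :: "real \<Rightarrow> real"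
  assumes adm: "admissible L f"
begin

lemma adm_L: "0 < L" and adm_lip: "L-lipschitz_on UNIV f" and adm_per: "f (t + 2*pi) = f t + l"
  using adm by (auto simp: admissible_def)

lemma adm_cont: "continuous_on S (\<lambda>t. g (f t))"
  using chord_continuous_on[OF lipschitz_on_continuous_on[OF adm_lip], of S 0] by simp

lemma adm_g_per: "g (f (t + 2*pi)) = g (f t)"
  by (simp add: adm_per per)

lemma hol_part_deriv: "cmod z < 1 \<Longrightarrow> (hol_part f has_field_derivative hol_deriv f z) (at z)"
  by (intro cauchy_transform_has_derivative adm_cont)

lemma antihol_part_deriv: "cmod z < 1 \<Longrightarrow> (antihol_part f has_field_derivative antihol_deriv f z) (at z)"
  by (intro conj_cauchy_transform_has_derivative adm_cont)

lemma hol_deriv_holomorphic: "hol_deriv f holomorphic_on ball 0 1" "antihol_deriv f holomorphic_on ball 0 1"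
  by (intro cauchy_transform_holomorphic continuous_intros adm_cont)+

lemma polar_derivatives:
  assumes r: "0 \<le> r" "r < 1" and z: "z = of_real r * cis \<tau>"
  shows "z * hol_deriv f z + cnj (z * antihol_deriv f z) = radial_int f r \<tau>"
    and "\<i> * (z * hol_deriv f z - cnj (z * antihol_deriv f z)) = angular_int f r \<tau>"
proof -
  define q where "q x = of_real r * cis x / (cis x - of_real r)\<^sup>2" for x
  have "cis x - of_real r \<noteq> 0" for x using r by (intro cis_minus_nonzero) auto
  then have qc: "continuous_on S q" for S unfolding q_def by (intro continuous_intros) auto
  have Gc: "continuous_on S (\<lambda>x. g (f (\<tau> + x)))" for S
    by (rule chord_continuous_on[OF lipschitz_on_continuous_on[OF adm_lip]])
  define I1 where "I1 = integral {-pi..pi} (\<lambda>x. q x * g (f (\<tau> + x)))"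
  define I2 where "I2 = integral {-pi..pi} (\<lambda>x. q x * cnj (g (f (\<tau> + x))))"
  have A: "z * hol_deriv f z = I1 / (2*pi)" unfolding z I1_def q_def
    by (intro rotated_cauchy_transform_deriv adm_cont adm_g_per r)
  have B: "z * antihol_deriv f z = I2 / (2*pi)" unfolding z I2_def q_def
    by (intro rotated_cauchy_transform_deriv continuous_intros adm_cont r) (simp add: adm_g_per)
  have i1: "((\<lambda>x. q x * g (f (\<tau> + x))) has_integral I1) {-pi..pi}"
    unfolding I1_def by (intro integrable_integral integrable_continuous_real continuous_intros qc Gc)
  have "((\<lambda>x. q x * cnj (g (f (\<tau> + x)))) has_integral I2) {-pi..pi}"
    unfolding I2_def by (intro integrable_integral integrable_continuous_real continuous_intros qc Gc)
  from has_integral_cnj_fun[OF this] have i2: "((\<lambda>x. cnj (q x) * g (f (\<tau> + x))) has_integral cnj I2) {-pi..pi}" by simp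
  have "((\<lambda>x. (q x * g (f (\<tau> + x)) + cnj (q x) * g (f (\<tau> + x))) / of_real (2*pi)) has_integral ((I1 + cnj I2) / of_real (2*pi))) {-pi..pi}"
    by (intro has_integral_divide has_integral_add i1 i2)
  moreover have "(q x * G + cnj (q x) * G) / of_real (2*pi) = of_real (radial_kernel r x) * G" for x G
  proof -
    have "Re (q x) = pi * radial_kernel r x"
      using cis_kernel_identities(1)[OF r, of x] by (simp add: q_def)
    then have "q x + cnj (q x) = of_real (2 * (pi * radial_kernel r x))"
      by (simp only: complex_add_cnj)
    then have "q x * G + cnj (q x) * G = of_real (2 * (pi * radial_kernel r x)) * G" by (metis distrib_right)
    then show ?thesis by simp
  qed
  ultimately have "radial_int f r \<tau> = (I1 + cnj I2) / of_real (2*pi)"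
    unfolding radial_int_def by (simp add: integral_unique)
  then show "z * hol_deriv f z + cnj (z * antihol_deriv f z) = radial_int f r \<tau>"
    unfolding A B by (simp add: add_divide_distrib)
  have "((\<lambda>x. \<i> * ((q x * g (f (\<tau> + x)) - cnj (q x) * g (f (\<tau> + x))) / of_real (2*pi))) has_integral (\<i> * ((I1 - cnj I2) / of_real (2*pi)))) {-pi..pi}"
    by (intro has_integral_mult_right has_integral_divide has_integral_diff i1 i2)
  moreover have "\<i> * ((q x * G - cnj (q x) * G) / of_real (2*pi)) = of_real (angular_kernel r x) * G" for x G
  proof -
    have "Im (q x) = - (pi * angular_kernel r x)"
      using cis_kernel_identities(2)[OF r, of x] by (simp add: q_def)
    then have "q x - cnj (q x) = - (2 * pi * of_real (angular_kernel r x)) * \<i>"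
      by (simp add: complex_eq_iff)
    then have "q x * G - cnj (q x) * G = - (2 * pi * of_real (angular_kernel r x)) * \<i> * G" by (metis left_diff_distrib)
    moreover have "\<i> * (X * (\<i> * G)) = - (X * G)" for X by (simp add: complex_eq_iff)
    ultimately show ?thesis by simp
  qed
  ultimately have "angular_int f r \<tau> = \<i> * ((I1 - cnj I2) / of_real (2*pi))"
    unfolding angular_int_def by (simp add: integral_unique)
  then show "\<i> * (z * hol_deriv f z - cnj (z * antihol_deriv f z)) = angular_int f r \<tau>"
    unfolding A B by (simp add: diff_divide_distrib)
qed

text \<open>
In polar coordinates \<open>r w\<^sub>r = A + cnj B\<close> and \<open>w\<^sub>\<tau> = i (A - cnj B)\<close> with \<open>A = z h'\<close> and \<open>B = z k'\<close>.
\<close>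

lemma polar_jacobian:
  assumes r: "0 \<le> r" "r < 1" and z: "z = of_real r * cis \<tau>"
  shows "r\<^sup>2 * ((cmod (hol_deriv f z))\<^sup>2 - (cmod (antihol_deriv f z))\<^sup>2)
    = Im (cnj (radial_int f r \<tau>) * angular_int f r \<tau>)"
proof -
  define A B where "A = z * hol_deriv f z" and "B = z * antihol_deriv f z"
  have "Im (cnj (A + cnj B) * (\<i> * (A - cnj B))) = (cmod A)\<^sup>2 - (cmod B)\<^sup>2"
    unfolding cmod_power2 by (simp add: power2_eq_square algebra_simps)
  moreover have "cmod z = r" using r z by (simp add: norm_mult)
  ultimately show ?thesis unfolding polar_derivatives[OF assms, symmetric] A_def[symmetric] B_def[symmetric]
    by (simp add: A_def B_def norm_mult power_mult_distrib right_diff_distrib)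
qed

text \<open>
A quantitative form of the convergence of a Poisson integral, uniform in the angle.
\<close>

lemma boundary_values:
  assumes r: "1/2 \<le> r" "r < 1" and z: "z = of_real r * cis \<tau>"
  shows "cmod (hol_part f z + cnj (antihol_part f z) - g (f \<tau>))
    \<le> 6 * L * ((1 - r) * ln (((1 - r)\<^sup>2 + pi\<^sup>2) / (1 - r)\<^sup>2))"
proof -
  have kc: "continuous_on S (poisson_kernel r)" for S using kernels_continuous_on r by auto
  have Gc: "continuous_on S (\<lambda>x. g (f (\<tau> + x)))" for S
    by (rule chord_continuous_on[OF lipschitz_on_continuous_on[OF adm_lip]])
  define p where "p t = of_real (poisson_kernel r (t - \<tau>)) * g (f t)" for t
  have "hol_part f z + cnj (antihol_part f z) = integral {0..2*pi} p"
    unfolding p_def by (intro poisson_integral_eq[symmetric] adm_cont z) (use r in auto)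
  also have "\<dots> = integral {-pi..pi} (\<lambda>x. p (\<tau> + x))"
  proof (rule integral_periodic_shift)
    have "cos (x + 2 * pi - \<tau>) = cos (x - \<tau>)" for x
      by (metis add_diff_eq diff_add_eq cos_periodic)
    then show "p (x + 2 * pi) = p x" for x by (simp add: p_def poisson_kernel_def adm_g_per)
    have "continuous_on {0..2*pi} (\<lambda>t. poisson_kernel r (t - \<tau>))"
      by (rule continuous_on_compose2[OF kc[of UNIV]]) (auto intro!: continuous_intros)
    then show "p integrable_on {0..2*pi}" unfolding p_def
      by (intro integrable_continuous_real continuous_intros adm_cont)
  qed
  finally have eq: "hol_part f z + cnj (antihol_part f z) = integral {-pi..pi} (\<lambda>x. of_real (poisson_kernel r x) * g (f (\<tau> + x)))"
    by (simp add: p_def)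
  have i: "(\<lambda>x. of_real (poisson_kernel r x) * (g (f (\<tau> + x)) - g (f \<tau>))) integrable_on {-pi..pi}"
    by (intro integrable_continuous_real continuous_intros kc Gc)
  have "((\<lambda>x. of_real (poisson_kernel r x) * g (f (\<tau> + x)) - of_real (poisson_kernel r x) * g (f \<tau>)) has_integral
     (hol_part f z + cnj (antihol_part f z) - of_real 1 * g (f \<tau>))) {-pi..pi}"
    unfolding eq
    by (intro has_integral_diff has_integral_mult_left has_integral_of_real poisson_kernel_integral
        integrable_integral integrable_continuous_real continuous_intros kc Gc) (use r in auto)
  then have hi: "hol_part f z + cnj (antihol_part f z) - g (f \<tau>)
      = integral {-pi..pi} (\<lambda>x. of_real (poisson_kernel r x) * (g (f (\<tau> + x)) - g (f \<tau>)))"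
    by (simp add: integral_unique right_diff_distrib)
  have bd: "((\<lambda>x. 6 * L * ((1 - r) * (\<bar>x\<bar> / ((1 - r)\<^sup>2 + x\<^sup>2)))) has_integral
      (6 * L * ((1 - r) * ln (((1 - r)\<^sup>2 + pi\<^sup>2) / (1 - r)\<^sup>2)))) {-pi..pi}"
    by (intro has_integral_mult_right log_kernel_integral) (use r in auto)
  have "cmod (integral {-pi..pi} (\<lambda>x. of_real (poisson_kernel r x) * (g (f (\<tau> + x)) - g (f \<tau>))))
     \<le> integral {-pi..pi} (\<lambda>x. 6 * L * ((1 - r) * (\<bar>x\<bar> / ((1 - r)\<^sup>2 + x\<^sup>2))))"
  proof (rule integral_norm_bound_integral[OF i])
    show "(\<lambda>x. 6 * L * ((1 - r) * (\<bar>x\<bar> / ((1 - r)\<^sup>2 + x\<^sup>2)))) integrable_on {-pi..pi}" using bd by blast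
    fix x assume x: "x \<in> {-pi..pi}"
    have "cmod (g (f (\<tau> + x)) - g (f \<tau>)) \<le> L * \<bar>x\<bar>"
      using chord_bound[of "f (\<tau> + x)" "f \<tau>"] lipschitz_onD[OF adm_lip, of "\<tau> + x" \<tau>] by (simp add: dist_real_def)
    then have "\<bar>poisson_kernel r x\<bar> * cmod (g (f (\<tau> + x)) - g (f \<tau>)) \<le> (6 * ((1 - r) / ((1 - r)\<^sup>2 + x\<^sup>2))) * (L * \<bar>x\<bar>)"
      using poisson_kernel_bound[OF r, of x] x r by (intro mult_mono) auto
    then show "cmod (of_real (poisson_kernel r x) * (g (f (\<tau> + x)) - g (f \<tau>))) \<le> 6 * L * ((1 - r) * (\<bar>x\<bar> / ((1 - r)\<^sup>2 + x\<^sup>2)))"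
      by (simp add: norm_mult mult_ac)
  qed
  then show ?thesis unfolding hi integral_unique[OF bd] .
qed

text \<open>
The kernel has the sign of \<open>x\<close>, hence \<open>f (\<tau> + x) - f \<tau>\<close> may be compared with \<open>c x\<close> under the integral.
\<close>

lemma tangential_speed_lower:
  assumes r: "0 \<le> r" "r < 1" and c: "\<And>s t. s \<le> t \<Longrightarrow> c * (t - s) \<le> f t - f s"
  shows "c * (2 * r / (1 + r)) \<le> tangential_speed f r \<tau>"
proof -
  have fc: "continuous_on S (\<lambda>x. f (\<tau> + x))" for S
    by (rule continuous_on_compose2[OF lipschitz_on_continuous_on[OF adm_lip]]) (auto intro!: continuous_intros)
  have kc: "continuous_on S (angular_kernel r)" for S using kernels_continuous_on r by auto
  have 1: "((\<lambda>x. c * (x * angular_kernel r x)) has_integral (c * (2 * r / (1 + r)))) {-pi..pi}"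
    by (intro has_integral_mult_right angular_kernel_moment r)
  have "integral {-pi..pi} (\<lambda>x. c * (x * angular_kernel r x)) \<le> tangential_speed f r \<tau>"
    unfolding tangential_speed_def
  proof (rule integral_le)
    show "(\<lambda>x. c * (x * angular_kernel r x)) integrable_on {-pi..pi}" using 1 by blast
    show "(\<lambda>x. angular_kernel r x * (f (\<tau> + x) - f \<tau>)) integrable_on {-pi..pi}"
      by (intro integrable_continuous_real continuous_intros kc fc)
    fix x assume x: "x \<in> {-pi..pi}"
    have Q: "0 \<le> x * angular_kernel r x" by (rule angular_kernel_times_nonneg) (use r x in auto)
    show "c * (x * angular_kernel r x) \<le> angular_kernel r x * (f (\<tau> + x) - f \<tau>)"
    proof (cases x "0::real" rule: linorder_cases)
      case greater
      then have "0 \<le> angular_kernel r x" using Q by (simp add: zero_le_mult_iff)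
      then have "angular_kernel r x * (c * x) \<le> angular_kernel r x * (f (\<tau> + x) - f \<tau>)"
        using c[of \<tau> "\<tau> + x"] greater by (intro mult_left_mono) auto
      then show ?thesis by (simp add: mult_ac)
    next
      case less
      then have "angular_kernel r x \<le> 0" using Q by (simp add: zero_le_mult_iff)
      then have "angular_kernel r x * (c * x) \<le> angular_kernel r x * (f (\<tau> + x) - f \<tau>)"
        using c[of "\<tau> + x" \<tau>] less by (intro mult_left_mono_neg) auto
      then show ?thesis by (simp add: mult_ac)
    qed auto
  qed
  then show ?thesis unfolding integral_unique[OF 1] .
qed

text \<open>
After subtracting \<open>d x\<close>, whose integral is known exactly, the increment of \<open>f\<close> is small relative to \<open>|x|\<close>
near \<open>0\<close>; away from \<open>0\<close> the crude bound by \<open>|x| x\<^sup>2/\<eta>\<^sup>2\<close> suffices since \<open>|x|\<^sup>3\<close> times the kernel is \<open>O(1 - r)\<close>.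
\<close>

lemma tangential_speed_tendsto:
  assumes d: "(f has_real_derivative d) (at \<tau>)"
  shows "((\<lambda>r. tangential_speed f r \<tau>) \<longlongrightarrow> d) (at_left 1)"
proof -
  have fc: "continuous_on S (\<lambda>x. f (\<tau> + x))" for S
    by (rule continuous_on_compose2[OF lipschitz_on_continuous_on[OF adm_lip]]) (auto intro!: continuous_intros)
  have dL: "\<bar>d\<bar> \<le> L"
  proof -
    have "((\<lambda>y. \<bar>(f y - f \<tau>) / (y - \<tau>)\<bar>) \<longlongrightarrow> \<bar>d\<bar>) (at \<tau>)"
      using d by (intro tendsto_rabs) (simp add: has_field_derivative_iff)
    moreover have "\<bar>(f y - f \<tau>) / (y - \<tau>)\<bar> \<le> L" for y
      using lipschitz_onD[OF adm_lip, of y \<tau>] adm_L by (cases "y = \<tau>") (auto simp: dist_real_def abs_divide divide_le_eq)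
    ultimately show ?thesis
      by (intro tendsto_upperbound[of _ _ "at \<tau>"]) (auto intro!: always_eventually)
  qed
  have "((\<lambda>r. tangential_speed f r \<tau> - d * (2 * r / (1 + r))) \<longlongrightarrow> 0) (at_left 1)"
  proof (rule tendstoI)
    fix e :: real assume e: "0 < e"
    \<comment> \<open>\<open>216\<close> is the constant of \<open>angular_kernel_bound\<close>, and the Cauchy density has mass at most
      \<open>\<pi>\<close>\<close>
    define e' where "e' = e / (4 * 216 * pi)"
    have e': "0 < e'" using e by (simp add: e'_def)
    obtain \<eta> where \<eta>: "\<eta> > 0" "\<And>y. y \<noteq> \<tau> \<Longrightarrow> \<bar>y - \<tau>\<bar> < \<eta> \<Longrightarrow> \<bar>(f y - f \<tau>) / (y - \<tau>) - d\<bar> < e'"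
      using d e' unfolding has_field_derivative_iff Lim_at by (auto simp: dist_real_def)
    \<comment> \<open>one bound for all \<open>x\<close>: the first summand is responsible for \<open>|x| < \<eta>\<close>, the second for the
      rest\<close>
    have lin: "\<bar>f (\<tau> + x) - f \<tau> - d * x\<bar> \<le> \<bar>x\<bar> * (e' + 2 * L * (x\<^sup>2 / \<eta>\<^sup>2))" for x
    proof (cases "\<bar>x\<bar> < \<eta>")
      case True
      have "\<bar>f (\<tau> + x) - f \<tau> - d * x\<bar> \<le> \<bar>x\<bar> * e'"
      proof (cases "x = 0")
        case False
        have "f (\<tau> + x) - f \<tau> - d * x = x * ((f (\<tau> + x) - f \<tau>) / (\<tau> + x - \<tau>) - d)"
          using False by (simp add: field_simps)
        moreover have "\<bar>(f (\<tau> + x) - f \<tau>) / (\<tau> + x - \<tau>) - d\<bar> \<le> e'"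
          using \<eta>(2)[of "\<tau> + x"] True False by simp
        ultimately show ?thesis by (simp add: abs_mult mult_left_mono)
      qed simp
      also have "\<dots> \<le> \<bar>x\<bar> * (e' + 2 * L * (x\<^sup>2 / \<eta>\<^sup>2))" using adm_L by (intro mult_left_mono) auto
      finally show ?thesis .
    next
      case False
      have "\<bar>f (\<tau> + x) - f \<tau>\<bar> \<le> L * \<bar>x\<bar>"
        using lipschitz_onD[OF adm_lip, of "\<tau> + x" \<tau>] by (simp add: dist_real_def)
      moreover have "\<bar>d * x\<bar> \<le> L * \<bar>x\<bar>" using dL by (simp add: abs_mult mult_right_mono)
      moreover have "\<bar>x\<bar> * (2 * L * 1) = L * \<bar>x\<bar> + L * \<bar>x\<bar>" by simp
      ultimately have "\<bar>f (\<tau> + x) - f \<tau> - d * x\<bar> \<le> \<bar>x\<bar> * (2 * L * 1)" by linarith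
      also have "\<dots> \<le> \<bar>x\<bar> * (2 * L * (x\<^sup>2 / \<eta>\<^sup>2))"
      proof -
        have "\<eta>\<^sup>2 \<le> x\<^sup>2" using False \<eta>(1) abs_le_square_iff[of \<eta> x] by simp
        then have "1 \<le> x\<^sup>2 / \<eta>\<^sup>2" using \<eta>(1) by simp
        then show ?thesis using adm_L by (intro mult_left_mono) auto
      qed
      also have "\<dots> \<le> \<bar>x\<bar> * (e' + 2 * L * (x\<^sup>2 / \<eta>\<^sup>2))" using e' by (intro mult_left_mono) auto
      finally show ?thesis .
    qed
    define C where "C = 216 * (2 * L / \<eta>\<^sup>2) * (2 * pi)"
    have C: "0 \<le> C" using adm_L by (simp add: C_def)
    have main: "\<bar>tangential_speed f r \<tau> - d * (2 * r / (1 + r))\<bar> \<le> e / 4 + C * (1 - r)"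
      if r: "1/2 \<le> r" "r < 1" for r
    proof -
      define \<delta> where "\<delta> = 1 - r"
      have \<delta>: "0 < \<delta>" using r by (simp add: \<delta>_def)
      have kc: "continuous_on S (angular_kernel r)" for S using kernels_continuous_on r by auto
      have "((\<lambda>x. angular_kernel r x * (f (\<tau> + x) - f \<tau>) - d * (x * angular_kernel r x)) has_integral
          (tangential_speed f r \<tau> - d * (2 * r / (1 + r)))) {-pi..pi}"
        unfolding tangential_speed_def
        by (intro has_integral_diff has_integral_mult_right angular_kernel_moment integrable_integral
            integrable_continuous_real continuous_intros kc fc) (use r in auto)
      then have hi: "((\<lambda>x. angular_kernel r x * (f (\<tau> + x) - f \<tau> - d * x)) has_integral
          (tangential_speed f r \<tau> - d * (2 * r / (1 + r)))) {-pi..pi}" by (simp add: algebra_simps)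
      have hB: "((\<lambda>x. 216 * e' * (\<delta> / (\<delta>\<^sup>2 + x\<^sup>2)) + 216 * (2 * L / \<eta>\<^sup>2) * \<delta>) has_integral
          (216 * e' * (2 * arctan (pi / \<delta>)) + (pi - - pi) *\<^sub>R (216 * (2 * L / \<eta>\<^sup>2) * \<delta>))) {-pi..pi}"
      proof (rule has_integral_add)
        show "((\<lambda>x. 216 * e' * (\<delta> / (\<delta>\<^sup>2 + x\<^sup>2))) has_integral 216 * e' * (2 * arctan (pi / \<delta>))) {-pi..pi}"
          by (intro has_integral_mult_right cauchy_density_integral \<delta>)
        show "((\<lambda>x. 216 * (2 * L / \<eta>\<^sup>2) * \<delta>) has_integral (pi - - pi) *\<^sub>R (216 * (2 * L / \<eta>\<^sup>2) * \<delta>)) {-pi..pi}"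
          using has_integral_const_real[of "216 * (2 * L / \<eta>\<^sup>2) * \<delta>" "-pi" pi] by simp
      qed
      have "norm (integral {-pi..pi} (\<lambda>x. angular_kernel r x * (f (\<tau> + x) - f \<tau> - d * x)))
         \<le> integral {-pi..pi} (\<lambda>x. 216 * e' * (\<delta> / (\<delta>\<^sup>2 + x\<^sup>2)) + 216 * (2 * L / \<eta>\<^sup>2) * \<delta>)"
      proof (rule integral_norm_bound_integral)
        fix x assume x: "x \<in> {-pi..pi}"
        have "\<bar>angular_kernel r x * (f (\<tau> + x) - f \<tau> - d * x)\<bar> \<le> \<bar>angular_kernel r x\<bar> * (\<bar>x\<bar> * (e' + 2 * L * (x\<^sup>2 / \<eta>\<^sup>2)))"
          unfolding abs_mult by (intro mult_left_mono lin) auto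
        also have "\<dots> = \<bar>x * angular_kernel r x\<bar> * (e' + 2 * L * (x\<^sup>2 / \<eta>\<^sup>2))" by (simp add: abs_mult)
        also have "\<dots> \<le> 216 * (\<delta> / (\<delta>\<^sup>2 + x\<^sup>2)) * (e' + 2 * L * (x\<^sup>2 / \<eta>\<^sup>2))"
          using angular_kernel_bound[OF r, of x] x adm_L e' by (intro mult_right_mono) (auto simp: \<delta>_def abs_le_iff)
        also have "\<dots> = 216 * e' * (\<delta> / (\<delta>\<^sup>2 + x\<^sup>2)) + 216 * (2 * L / \<eta>\<^sup>2) * (\<delta> * (x\<^sup>2 / (\<delta>\<^sup>2 + x\<^sup>2)))"
        proof -
          have "216 * (\<delta> / N) * (e' + 2 * L * (x\<^sup>2 / M)) = 216 * e' * (\<delta> / N) + 216 * (2 * L / M) * (\<delta> * (x\<^sup>2 / N))"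
            for N M :: real by (simp add: algebra_simps)
          then show ?thesis .
        qed
        also have "\<dots> \<le> 216 * e' * (\<delta> / (\<delta>\<^sup>2 + x\<^sup>2)) + 216 * (2 * L / \<eta>\<^sup>2) * (\<delta> * 1)"
        proof -
          have "0 < \<delta>\<^sup>2 + x\<^sup>2" using \<delta> by (simp add: add_pos_nonneg)
          then have "x\<^sup>2 / (\<delta>\<^sup>2 + x\<^sup>2) \<le> 1" by simp
          then show ?thesis using adm_L \<delta> by (intro add_left_mono mult_left_mono) auto
        qed
        finally show "norm (angular_kernel r x * (f (\<tau> + x) - f \<tau> - d * x)) \<le> 216 * e' * (\<delta> / (\<delta>\<^sup>2 + x\<^sup>2)) + 216 * (2 * L / \<eta>\<^sup>2) * \<delta>"
          by simp
      qed (use hi hB in blast)+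
      then have "\<bar>tangential_speed f r \<tau> - d * (2 * r / (1 + r))\<bar> \<le> 216 * e' * (2 * arctan (pi / \<delta>)) + C * \<delta>"
        unfolding integral_unique[OF hi] integral_unique[OF hB] by (simp add: C_def mult_ac)
      also have "216 * e' * (2 * arctan (pi / \<delta>)) \<le> 216 * e' * pi"
        using arctan_ubound[of "pi / \<delta>"] e' by (intro mult_left_mono) auto
      also have "\<dots> = e / 4" by (simp add: e'_def)
      finally show ?thesis by (simp add: \<delta>_def)
    qed
    show "\<forall>\<^sub>F r in at_left 1. dist (tangential_speed f r \<tau> - d * (2 * r / (1 + r))) 0 < e"
      unfolding eventually_at_left_field
    proof (intro exI[of _ "max (1/2) (1 - e / (4 * (C + 1)))"] conjI allI impI)
      show "max (1/2) (1 - e / (4 * (C + 1))) < 1" using e C by simp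
      fix r assume r: "max (1/2) (1 - e / (4 * (C + 1))) < r" "r < 1"
      then have "1 - r < e / (4 * (C + 1))" by simp
      then have "(C + 1) * (1 - r) \<le> (C + 1) * (e / (4 * (C + 1)))" using C by (intro mult_left_mono) auto
      also have "\<dots> = e / 4"
      proof -
        have "K * (e / (4 * K)) = e / 4" if "K \<noteq> 0" for K :: real using that by simp
        then show ?thesis using C by (metis add_nonneg_eq_0_iff zero_le_one zero_neq_one)
      qed
      finally have "C * (1 - r) \<le> e / 4" using r by (simp add: algebra_simps)
      then show "dist (tangential_speed f r \<tau> - d * (2 * r / (1 + r))) 0 < e"
        using main[of r] r e by (simp add: dist_real_def)
    qed
  qed
  moreover have "((\<lambda>r. d * (2 * r / (1 + r))) \<longlongrightarrow> d * (2 * 1 / (1 + 1))) (at_left 1)"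
    by (intro tendsto_intros tendsto_ident_at) auto
  ultimately show ?thesis using tendsto_add by fastforce
qed

end

section \<open>The boundary Jacobian\<close>

lemma radial_det_left_limit:
  assumes adm: "admissible L f"
  shows "((\<lambda>r. radial_det f r \<tau>) \<longlongrightarrow> radial_det f 1 \<tau>) (at_left 1)"
proof (rule tendsto_at_left_sequentially[of "1/2"])
  fix S :: "nat \<Rightarrow> real" assume S: "\<And>n. S n < 1" "\<And>n. 1/2 < S n" "S \<longlonglongrightarrow> 1"
  show "(\<lambda>n. radial_det f (S n) \<tau>) \<longlonglongrightarrow> radial_det f 1 \<tau>"
    by (rule radial_det_tendsto[OF adm_L[OF adm] adm_lip[OF adm] tendsto_const tendsto_const S(3)])
       (use S in \<open>auto intro: less_imp_le\<close>)
qed auto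

lemma poisson_extension_jacobian:
  assumes adm: "admissible L f" and F: "\<And>t. F (cis t) = g (f t)" and z: "cmod z < 1"
  shows "jacobian_det (poisson_extension F) z = (cmod (hol_deriv f z))\<^sup>2 - (cmod (antihol_deriv f z))\<^sup>2"
proof -
  define w where "w = (\<lambda>z. hol_part f z + cnj (antihol_part f z))"
  have "poisson_extension F x = w x" if "x \<in> ball 0 1" for x
    unfolding w_def by (rule poisson_extension_eq) (use that F adm_cont[OF adm] in auto)
  then have "(poisson_extension F has_derivative D) (at z) \<longleftrightarrow> (w has_derivative D) (at z)" for D
    using has_derivative_transform_within_open[of _ D z UNIV "ball 0 1"] z by (metis dist_0_norm mem_ball open_ball)
  then have "jacobian_det (poisson_extension F) z = jacobian_det w z"
    by (simp add: jacobian_det_def frechet_derivative_def)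
  also have "\<dots> = (cmod (hol_deriv f z))\<^sup>2 - (cmod (antihol_deriv f z))\<^sup>2"
    unfolding w_def by (intro jacobian_det_harmonic hol_part_deriv[OF adm] antihol_part_deriv[OF adm] z)
  finally show ?thesis .
qed

lemma filterlim_one_minus: "filterlim (\<lambda>r. 1 - r) (at_right 0) (at_left (1::real))"
proof -
  have "((\<lambda>r::real. 1 - r) \<longlongrightarrow> 1 - 1) (at_left 1)" by (intro tendsto_intros tendsto_ident_at)
  then show ?thesis unfolding filterlim_at
    by (auto simp: eventually_at_left_field intro: exI[of _ 0])
qed

lemma polar_jacobian_tendsto:
  assumes adm: "admissible L f" and d: "(f has_real_derivative d) (at \<tau>)"
  shows "((\<lambda>r. Im (cnj (radial_int f r \<tau>) * angular_int f r \<tau>)) \<longlongrightarrow> d * radial_det f 1 \<tau>) (at_left 1)"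
proof -
  have "((\<lambda>r. Im (cnj (radial_int f r \<tau>) * angular_int f r \<tau>) - tangential_speed f r \<tau> * radial_det f r \<tau>) \<longlongrightarrow> 0) (at_left 1)"
  proof (rule Lim_null_comparison)
    show "\<forall>\<^sub>F r in at_left 1. norm (Im (cnj (radial_int f r \<tau>) * angular_int f r \<tau>) - tangential_speed f r \<tau> * radial_det f r \<tau>)
        \<le> 18 * L * (ln (((1 - r)\<^sup>2 + pi\<^sup>2) / (1 - r)\<^sup>2) * tangential_error L (1 - r))"
      unfolding eventually_at_left_field
      using polar_det_estimate[OF adm_L[OF adm] adm_lip[OF adm]] by (intro exI[of _ "1/2"]) auto
    have "((\<lambda>r. 18 * L * (ln (((1 - r)\<^sup>2 + pi\<^sup>2) / (1 - r)\<^sup>2) * tangential_error L (1 - r))) \<longlongrightarrow> 18 * L * 0) (at_left 1)"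
      by (intro tendsto_mult tendsto_const
          filterlim_compose[OF tangential_error_tendsto_0(2)[OF adm_L[OF adm]] filterlim_one_minus])
    then show "((\<lambda>r. 18 * L * (ln (((1 - r)\<^sup>2 + pi\<^sup>2) / (1 - r)\<^sup>2) * tangential_error L (1 - r))) \<longlongrightarrow> 0) (at_left 1)"
      by simp
  qed
  moreover have "((\<lambda>r. tangential_speed f r \<tau> * radial_det f r \<tau>) \<longlongrightarrow> d * radial_det f 1 \<tau>) (at_left 1)"
    by (intro tendsto_mult tangential_speed_tendsto[OF adm d] radial_det_left_limit[OF adm])
  ultimately show ?thesis using tendsto_add by fastforce
qed

text \<open>
The polar determinant is \<open>r\<^sup>2\<close> times the Jacobian.
\<close>

lemma jacobian_tendsto:
  assumes adm: "admissible L f" and F: "\<And>t. F (cis t) = g (f t)"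
    and d: "(f has_real_derivative d) (at \<tau>)"
  shows "((\<lambda>r. jacobian_det (poisson_extension F) (of_real r * cis \<tau>)) \<longlongrightarrow> d * radial_det f 1 \<tau>) (at_left 1)"
proof -
  have "((\<lambda>r. Im (cnj (radial_int f r \<tau>) * angular_int f r \<tau>) / r\<^sup>2) \<longlongrightarrow> d * radial_det f 1 \<tau> / 1\<^sup>2) (at_left 1)"
    by (intro tendsto_divide polar_jacobian_tendsto[OF adm d] tendsto_intros tendsto_ident_at) auto
  moreover have "\<forall>\<^sub>F r in at_left 1. Im (cnj (radial_int f r \<tau>) * angular_int f r \<tau>) / r\<^sup>2
      = jacobian_det (poisson_extension F) (of_real r * cis \<tau>)"
    unfolding eventually_at_left_field
  proof (intro exI[of _ "1/2"] conjI allI impI)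
    fix r :: real assume r: "1/2 < r" "r < 1"
    have "cmod (of_real r * cis \<tau>) < 1" using r by (simp add: norm_mult)
    note J = poisson_extension_jacobian[OF adm F this]
    have P: "r\<^sup>2 * ((cmod (hol_deriv f (of_real r * cis \<tau>)))\<^sup>2 - (cmod (antihol_deriv f (of_real r * cis \<tau>)))\<^sup>2)
        = Im (cnj (radial_int f r \<tau>) * angular_int f r \<tau>)"
      by (rule polar_jacobian[OF adm _ r(2) refl]) (use r in simp)
    show "Im (cnj (radial_int f r \<tau>) * angular_int f r \<tau>) / r\<^sup>2
      = jacobian_det (poisson_extension F) (of_real r * cis \<tau>)"
      unfolding P[symmetric] J using r by simp
  qed auto
  ultimately show ?thesis by (simp add: tendsto_cong)
qed

text \<open>
Both singular kernels are multiples of \<open>1 / sin\<^sup>2 (x/2)\<close>, and multiplication by \<open>i\<close> turns the inner product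
with the normal into the determinant with the tangent.
\<close>

lemma T_integrand_eq:
  "T_integrand g f \<tau> (\<tau> + x) = 2 * pi * (radial_kernel 1 x * chord_det f \<tau> x)"
proof -
  define s where "s = (sin (x / 2))\<^sup>2"
  have "cos x = 1 - 2 * s" using cos_double_sin[of "x / 2"] by (simp add: s_def)
  then have "radial_kernel 1 x = - (4 * s) / (pi * (4 * s)\<^sup>2)"
    by (simp add: radial_kernel_def kernel_denom_def)
  also have "\<dots> = - 1 / (4 * pi * s)" by (cases "s = 0") (simp_all add: power2_eq_square)
  finally have "2 * pi * (radial_kernel 1 x * chord_det f \<tau> x) = - chord_det f \<tau> x / (2 * s)" by simp
  moreover have "Re (cnj c * (\<i> * e)) = - Im (cnj c * e)" for c e by (simp add: algebra_simps)
  ultimately show ?thesis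
    by (simp add: T_integrand_def chord_det_def vector_derivative_at[OF der] s_def)
qed

lemma T_integrand_periodic:
  assumes adm: "admissible L f"
  shows "T_integrand g f \<tau> (t + 2*pi) = T_integrand g f \<tau> t"
    and "T_integrand g f (\<tau> + 2*pi) = T_integrand g f \<tau>"
proof -
  have s: "(sin (y + pi))\<^sup>2 = (sin y)\<^sup>2" "(sin (y - pi))\<^sup>2 = (sin y)\<^sup>2" for y :: real
    by (simp_all add: sin_add sin_diff)
  have "(t + 2*pi - \<tau>) / 2 = (t - \<tau>) / 2 + pi" by (simp add: field_simps)
  then have "(sin ((t + 2*pi - \<tau>) / 2))\<^sup>2 = (sin ((t - \<tau>) / 2))\<^sup>2" by (simp only: s)
  then show "T_integrand g f \<tau> (t + 2*pi) = T_integrand g f \<tau> t"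
    by (simp only: T_integrand_def adm_g_per[OF adm])
  have "(t - (\<tau> + 2*pi)) / 2 = (t - \<tau>) / 2 - pi" for t by (simp add: field_simps)
  then have "(sin ((t - (\<tau> + 2*pi)) / 2))\<^sup>2 = (sin ((t - \<tau>) / 2))\<^sup>2" for t by (simp only: s)
  then show "T_integrand g f (\<tau> + 2*pi) = T_integrand g f \<tau>"
    unfolding fun_eq_iff T_integrand_def vector_derivative_at[OF der] adm_per[OF adm] per g'_periodic
    by simp
qed

lemma T_integrand_integral:
  assumes adm: "admissible L f"
  shows "T_integrand g f \<tau> absolutely_integrable_on {0..2*pi}"
    and "integral {0..2*pi} (T_integrand g f \<tau>) = 2 * pi * radial_det f 1 \<tau>"
proof -
  have unshift: "(p has_integral I) {0..2*pi}"
    if "\<And>t. p (t + 2*pi) = p t" "((\<lambda>x. p (\<tau> + x)) has_integral I) {-pi..pi}" for p :: "real \<Rightarrow> real" and I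
  proof -
    have "(p has_integral I) {-pi + \<tau>..pi + \<tau>}"
      using has_integral_shift_Icc_real[of p \<tau> I "-pi" pi] that(2) by (simp add: o_def)
    then have "(p has_integral I) {\<tau> - pi..\<tau> - pi + 2*pi}" by (simp add: algebra_simps)
    from has_integral_periodic_shift[OF that(1) _ this, of 0] show ?thesis by simp
  qed
  define \<phi> where "\<phi> x = radial_kernel 1 x * chord_det f \<tau> x" for x
  have \<phi>: "\<phi> integrable_on {-pi..pi}"
    unfolding \<phi>_def by (rule radial_det_integrable[OF adm_L[OF adm] adm_lip[OF adm]]) auto
  have a\<phi>: "\<phi> absolutely_integrable_on {-pi..pi}"
  proof (rule absolutely_integrable_integrable_bound[OF _ \<phi>])
    show "(\<lambda>x. 18 * (rho L \<bar>x\<bar> / \<bar>x\<bar>)) integrable_on {-pi..pi}"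
      by (rule integrable_on_mult_right[OF rho_abs_integrable[OF adm_L[OF adm]]])
    show "norm (\<phi> x) \<le> 18 * (rho L \<bar>x\<bar> / \<bar>x\<bar>)" if "x \<in> {-pi..pi}" for x
      unfolding \<phi>_def using radial_det_integrand_bound[OF adm_L[OF adm] adm_lip[OF adm], of 1 x \<tau>] that
      by (auto simp: abs_le_iff)
  qed
  have eq: "T_integrand g f \<tau> (\<tau> + x) = 2 * pi * \<phi> x" for x unfolding \<phi>_def by (rule T_integrand_eq)
  have i: "(T_integrand g f \<tau> has_integral (2 * pi * radial_det f 1 \<tau>)) {0..2*pi}"
  proof (rule unshift[where p = "T_integrand g f \<tau>", OF T_integrand_periodic(1)[OF adm]])
    show "((\<lambda>x. T_integrand g f \<tau> (\<tau> + x)) has_integral 2 * pi * radial_det f 1 \<tau>) {-pi..pi}"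
      unfolding eq radial_det_def \<phi>_def[symmetric] by (intro has_integral_mult_right integrable_integral \<phi>)
  qed
  then show "integral {0..2*pi} (T_integrand g f \<tau>) = 2 * pi * radial_det f 1 \<tau>" by (rule integral_unique)
  have "(\<lambda>x. \<bar>\<phi> x\<bar>) integrable_on {-pi..pi}" using a\<phi> by (simp add: absolutely_integrable_on_def)
  then have "((\<lambda>x. \<bar>T_integrand g f \<tau> (\<tau> + x)\<bar>) has_integral (2 * pi * integral {-pi..pi} (\<lambda>x. \<bar>\<phi> x\<bar>))) {-pi..pi}"
    unfolding eq abs_mult by (simp add: has_integral_mult_right integrable_integral)
  from unshift[of "\<lambda>t. \<bar>T_integrand g f \<tau> t\<bar>", OF _ this]
  have "(\<lambda>t. \<bar>T_integrand g f \<tau> t\<bar>) integrable_on {0..2*pi}"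
    by (auto simp: T_integrand_periodic(1)[OF adm])
  then show "T_integrand g f \<tau> absolutely_integrable_on {0..2*pi}"
    using i by (auto simp: absolutely_integrable_on_def)
qed

lemma cis_eq_imp_shift: "cis a = cis b \<Longrightarrow> \<exists>n::int. a = b + of_int n * (2*pi)"
proof -
  assume "cis a = cis b"
  then have "exp (\<i> * of_real a) = exp (\<i> * of_real b)" by (simp add: cis_conv_exp)
  then obtain n :: int where "\<i> * of_real a = \<i> * of_real b + (of_int (2 * n) * pi) * \<i>"
    by (auto simp: exp_eq)
  then have "a = b + of_int n * (2*pi)" by (simp add: complex_eq_iff)
  then show ?thesis by blast
qed

lemma T_function_eq:
  assumes adm: "admissible L f"
  shows "T_function g f (cis \<tau>) = 1 / (2 * pi) * integral {0..2*pi} (T_integrand g f \<tau>)"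
    and "T_function g f (cis \<tau>) = radial_det f 1 \<tau>"
proof -
  interpret periodic_fun_simple "T_integrand g f" "2*pi"
    by unfold_locales (rule T_integrand_periodic(2)[OF adm])
  have "cis (Arg2pi (cis \<tau>)) = cis \<tau>" by (metis Arg2pi_eq cis_conv_exp mult.right_neutral norm_cis of_real_1 mult_1)
  then obtain n :: int where "Arg2pi (cis \<tau>) = \<tau> + of_int n * (2*pi)" using cis_eq_imp_shift by blast
  then have "T_integrand g f (Arg2pi (cis \<tau>)) = T_integrand g f \<tau>" using plus_of_int by simp
  then show "T_function g f (cis \<tau>) = 1 / (2 * pi) * integral {0..2*pi} (T_integrand g f \<tau>)"
    by (simp add: T_function_def)
  then show "T_function g f (cis \<tau>) = radial_det f 1 \<tau>"
    using T_integrand_integral(2)[OF adm] by simp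
qed

text \<open>
A convergent sequence on the circle is lifted to a convergent sequence of angles by measuring the
argument relative to the limit point, which avoids the branch cut.
\<close>

lemma T_function_continuous:
  assumes adm: "admissible L f"
  shows "continuous_on (sphere 0 1) (T_function g f)"
  unfolding continuous_on_sequentially
proof (intro allI ballI impI, elim conjE)
  fix x :: "nat \<Rightarrow> complex" and a assume a: "a \<in> sphere 0 1" and x: "\<forall>n. x n \<in> sphere 0 1" "x \<longlonglongrightarrow> a"
  define \<tau>s where "\<tau>s n = Arg a + Arg (x n / a)" for n
  have cA: "cis (Arg z) = z" if "cmod z = 1" for z using that by (metis rcis_cmod_Arg rcis_def mult_1 of_real_1)
  have na: "cmod a = 1" "a \<noteq> 0" "cmod (x n) = 1" for n using a x(1) by auto
  have "(\<lambda>n. x n / a) \<longlonglongrightarrow> a / a" by (intro tendsto_intros x(2)) (use na in auto)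
  then have "(\<lambda>n. Arg (x n / a)) \<longlonglongrightarrow> Arg 1"
    using continuous_at_Arg[of 1] na by (intro isCont_tendsto_compose[of 1 Arg]) auto
  then have "\<tau>s \<longlonglongrightarrow> Arg a + 0" unfolding \<tau>s_def by (intro tendsto_intros) simp
  then have "\<tau>s \<longlonglongrightarrow> Arg a" by simp
  then have "(\<lambda>n. radial_det f 1 (\<tau>s n)) \<longlonglongrightarrow> radial_det f 1 (Arg a)"
    by (intro radial_det_tendsto[OF adm_L[OF adm] adm_lip[OF adm]]) auto
  moreover have "cis (\<tau>s n) = x n" for n
    using na cA[of a] cA[of "x n / a"] by (simp add: \<tau>s_def cis_mult[symmetric] norm_divide)
  then have "T_function g f (x n) = radial_det f 1 (\<tau>s n)" for n
    using T_function_eq(2)[OF adm, of "\<tau>s n"] by simp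
  moreover have "T_function g f a = radial_det f 1 (Arg a)"
    using T_function_eq(2)[OF adm, of "Arg a"] cA[OF na(1)] by simp
  ultimately show "(T_function g f \<circ> x) \<longlonglongrightarrow> T_function g f a" by (simp add: o_def)
qed

section \<open>Positivity of the Jacobian inside the disk\<close>

text \<open>
For \<open>\<epsilon> > 0\<close> and nondecreasing \<open>f\<close> the slope is bounded below, while \<open>f\<close> itself may be constant on intervals.
\<close>

definition blend :: "(real \<Rightarrow> real) \<Rightarrow> real \<Rightarrow> real \<Rightarrow> real" where
  "blend f \<epsilon> t = (1 - \<epsilon>) * f t + \<epsilon> * (l / (2*pi) * t)"

lemma boundary_error_tendsto_0: "((\<lambda>r. 6 * L * ((1 - r) * ln (((1 - r)\<^sup>2 + pi\<^sup>2) / (1 - r)\<^sup>2))) \<longlongrightarrow> 0) (at_left (1::real))"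
proof -
  have "((\<lambda>\<delta>::real. \<delta> * ln ((\<delta>\<^sup>2 + pi\<^sup>2) / \<delta>\<^sup>2)) \<longlongrightarrow> 0) (at_right 0)"
  proof (rule tendsto_sandwich[OF _ _ tendsto_const])
    have "((\<lambda>\<delta>::real. \<delta> * ln (1 + pi\<^sup>2) + 2 * (\<delta> * ln (1 / \<delta>))) \<longlongrightarrow> 0 * ln (1 + pi\<^sup>2) + 2 * 0) (at_right 0)"
      by (intro tendsto_intros mult_log_tendsto_0 tendsto_ident_at)
    then show "((\<lambda>\<delta>::real. \<delta> * ln (1 + pi\<^sup>2) + 2 * (\<delta> * ln (1 / \<delta>))) \<longlongrightarrow> 0) (at_right 0)" by simp
    have "0 \<le> \<delta> * ln ((\<delta>\<^sup>2 + pi\<^sup>2) / \<delta>\<^sup>2) \<and>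
        \<delta> * ln ((\<delta>\<^sup>2 + pi\<^sup>2) / \<delta>\<^sup>2) \<le> \<delta> * ln (1 + pi\<^sup>2) + 2 * (\<delta> * ln (1 / \<delta>))"
      if \<delta>: "0 < \<delta>" "\<delta> < 1" for \<delta> :: real
      using log_ratio_bounds[OF that] mult_left_mono[OF log_ratio_bounds(2)[OF that], of \<delta>] that
      by (simp add: algebra_simps)
    then show "\<forall>\<^sub>F \<delta> in at_right 0. 0 \<le> \<delta> * ln ((\<delta>\<^sup>2 + pi\<^sup>2) / \<delta>\<^sup>2)"
      and "\<forall>\<^sub>F \<delta> in at_right 0. \<delta> * ln ((\<delta>\<^sup>2 + pi\<^sup>2) / \<delta>\<^sup>2) \<le> \<delta> * ln (1 + pi\<^sup>2) + 2 * (\<delta> * ln (1 / \<delta>))"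
      unfolding eventually_at_right_field by (auto intro!: exI[of _ 1])
  qed
  from tendsto_mult[OF tendsto_const[of "6 * L"] filterlim_compose[OF this filterlim_one_minus]]
  show ?thesis by simp
qed

lemma boundary_limit:
  assumes adm: "admissible L f"
  shows "((\<lambda>r. hol_part f (of_real r * cis t) + cnj (antihol_part f (of_real r * cis t))) \<longlongrightarrow> g (f t)) (at_left 1)"
proof (rule LIM_zero_cancel, rule Lim_null_comparison[OF _ boundary_error_tendsto_0[of L]])
  show "\<forall>\<^sub>F r in at_left 1. norm (hol_part f (of_real r * cis t) + cnj (antihol_part f (of_real r * cis t)) - g (f t))
      \<le> 6 * L * ((1 - r) * ln (((1 - r)\<^sup>2 + pi\<^sup>2) / (1 - r)\<^sup>2))"
    unfolding eventually_at_left_field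
    using boundary_values[OF adm _ _ refl] by (intro exI[of _ "1/2"]) auto
qed

lemma blend_admissible:
  assumes adm: "admissible L f" and \<epsilon>: "0 \<le> \<epsilon>" "\<epsilon> \<le> 1"
  shows "admissible L (blend f \<epsilon>)"
proof -
  have "l = f (0 + 2*pi) - f 0" unfolding adm_per[OF adm] by simp
  also have "\<dots> \<le> L * (2*pi)"
    using lipschitz_onD[OF adm_lip[OF adm], of "0 + 2*pi" 0] by (simp add: dist_real_def)
  finally have lL: "l / (2*pi) \<le> L" by (simp add: divide_le_eq)
  have "L-lipschitz_on UNIV (blend f \<epsilon>)"
  proof (rule lipschitz_onI)
    fix s t :: real
    have "blend f \<epsilon> s - blend f \<epsilon> t = (1 - \<epsilon>) * (f s - f t) + \<epsilon> * (l / (2*pi) * (s - t))"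
      by (simp add: blend_def algebra_simps diff_divide_distrib)
    also have "\<bar>\<dots>\<bar> \<le> (1 - \<epsilon>) * \<bar>f s - f t\<bar> + \<epsilon> * (l / (2*pi) * \<bar>s - t\<bar>)"
      using \<epsilon> l by (intro order_trans[OF abs_triangle_ineq]) (simp add: abs_mult)
    also have "\<dots> \<le> (1 - \<epsilon>) * (L * \<bar>s - t\<bar>) + \<epsilon> * (L * \<bar>s - t\<bar>)"
      using \<epsilon> lL lipschitz_onD[OF adm_lip[OF adm], of s t]
      by (intro add_mono mult_left_mono mult_right_mono) (auto simp: dist_real_def)
    also have "\<dots> = L * \<bar>s - t\<bar>" by (simp add: algebra_simps)
    finally show "dist (blend f \<epsilon> s) (blend f \<epsilon> t) \<le> L * dist s t" by (simp add: dist_real_def)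
  qed (use adm_L[OF adm] in simp)
  moreover have "blend f \<epsilon> (t + 2*pi) = blend f \<epsilon> t + l" for t
  proof -
    have "l / (2*pi) * (t + 2*pi) = l / (2*pi) * t + l" by (simp add: distrib_left)
    then show ?thesis unfolding blend_def adm_per[OF adm] by (simp only: distrib_left) (simp add: algebra_simps)
  qed
  ultimately show ?thesis using adm_L[OF adm] by (simp add: admissible_def)
qed

lemma blend_increasing:
  assumes "mono f" "0 \<le> \<epsilon>" "\<epsilon> \<le> 1" "s \<le> t"
  shows "\<epsilon> * l / (2*pi) * (t - s) \<le> blend f \<epsilon> t - blend f \<epsilon> s"
proof -
  have "0 \<le> (1 - \<epsilon>) * (f t - f s)" using monoD[OF assms(1,4)] assms by simp
  then show ?thesis by (simp add: blend_def algebra_simps diff_divide_distrib)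
qed

lemma radial_det_periodic:
  assumes adm: "admissible L f"
  shows "radial_det f r (\<tau> + of_int n * (2*pi)) = radial_det f r \<tau>"
proof -
  interpret periodic_fun_simple "radial_det f r" "2*pi"
  proof
    fix \<tau>
    have "f (\<tau> + 2*pi + x) = f (\<tau> + x) + l" for x using adm_per[OF adm, of "\<tau> + x"] by (simp add: algebra_simps)
    then show "radial_det f r (\<tau> + 2*pi) = radial_det f r \<tau>"
      by (simp add: radial_det_def chord_det_def adm_per[OF adm] per g'_periodic)
  qed
  show ?thesis using plus_of_int by simp
qed

text \<open>
Otherwise there would be radii tending to \<open>1\<close>, blends tending to \<open>f\<close> and, by periodicity and
compactness, convergent angles along which the determinant has a limit \<open>\<le> 0\<close>; by joint continuity
this limit is a value of \<open>T\<close>.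
\<close>

lemma radial_det_blend_positive:
  assumes adm: "admissible L f" and pos: "\<And>\<tau>. 0 < radial_det f 1 \<tau>"
  shows "\<exists>c N r0. 0 < c \<and> 1/2 \<le> r0 \<and> r0 < 1 \<and>
    (\<forall>n r \<tau>. N \<le> n \<longrightarrow> r0 \<le> r \<longrightarrow> r < 1 \<longrightarrow> c \<le> radial_det (blend f (inverse (real (Suc n)))) r \<tau>)"
proof (rule ccontr)
  assume neg: "\<not> ?thesis"
  define \<epsilon> where "\<epsilon> n = inverse (real (Suc n))" for n
  have \<epsilon>: "0 \<le> \<epsilon> n" "\<epsilon> n \<le> 1" for n
    using le_imp_inverse_le[of 1 "real (Suc n)"] by (auto simp: \<epsilon>_def)
  have ex: "\<exists>n r \<tau>. j \<le> n \<and> 1 - inverse (real (Suc (Suc j))) \<le> r \<and> r < 1 \<and> \<tau> \<in> {0..2*pi}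
      \<and> radial_det (blend f (\<epsilon> n)) r \<tau> < \<epsilon> j" for j
  proof -
    have "1/2 \<le> 1 - inverse (real (Suc (Suc j)))" using le_imp_inverse_le[of 2 "real (Suc (Suc j))"] by simp
    moreover have "0 < \<epsilon> j" "1 - inverse (real (Suc (Suc j))) < 1" by (auto simp: \<epsilon>_def)
    ultimately have "\<not> (\<forall>n r \<tau>. j \<le> n \<longrightarrow> 1 - inverse (real (Suc (Suc j))) \<le> r \<longrightarrow> r < 1 \<longrightarrow>
        \<epsilon> j \<le> radial_det (blend f (\<epsilon> n)) r \<tau>)"
      using neg unfolding \<epsilon>_def by blast
    then obtain n r \<tau> where nr: "j \<le> n" "1 - inverse (real (Suc (Suc j))) \<le> r" "r < 1"
      "radial_det (blend f (\<epsilon> n)) r \<tau> < \<epsilon> j"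
      by (auto simp: not_le simp del: of_nat_Suc)
    define k where "k = \<lfloor>\<tau> / (2*pi)\<rfloor>"
    have "\<tau> + of_int (- k) * (2*pi) \<in> {0..2*pi}"
      using floor_divide_lower[of "2*pi" \<tau>] floor_divide_upper[of "2*pi" \<tau>]
      by (auto simp: k_def algebra_simps)
    moreover have "radial_det (blend f (\<epsilon> n)) r (\<tau> + of_int (- k) * (2*pi)) = radial_det (blend f (\<epsilon> n)) r \<tau>"
      by (rule radial_det_periodic[OF blend_admissible[OF adm \<epsilon>]])
    ultimately show ?thesis using nr by metis
  qed
  then obtain ns rs \<tau>s where s: "\<And>j. j \<le> ns j" "\<And>j. 1 - inverse (real (Suc (Suc j))) \<le> rs j" "\<And>j. rs j < 1"
    "\<And>j. \<tau>s j \<in> {0..2*pi}" "\<And>j. radial_det (blend f (\<epsilon> (ns j))) (rs j) (\<tau>s j) < \<epsilon> j"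
    by metis
  have rs1: "rs j \<le> 1" for j by (rule less_imp_le[OF s(3)])
  have "compact {0..2*pi}" by simp
  then obtain \<tau> \<phi> where \<phi>: "strict_mono \<phi>" "(\<tau>s \<circ> \<phi>) \<longlonglongrightarrow> \<tau>"
    using s(4) unfolding compact_def by blast
  have \<epsilon>0: "\<epsilon> \<longlonglongrightarrow> 0" unfolding \<epsilon>_def by (rule LIMSEQ_inverse_real_of_nat)
  have nslim: "filterlim ns at_top sequentially"
    by (rule filterlim_at_top_mono[OF filterlim_ident]) (use s(1) in auto)
  have rslim: "rs \<longlonglongrightarrow> 1"
  proof (rule tendsto_sandwich[OF _ _ _ tendsto_const])
    show "(\<lambda>j. 1 - inverse (real (Suc (Suc j)))) \<longlonglongrightarrow> 1"
      using tendsto_diff[OF tendsto_const LIMSEQ_Suc[OF LIMSEQ_inverse_real_of_nat], of 1] by simp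
  qed (use s(2) rs1 in \<open>auto intro!: always_eventually\<close>)
  have rhalf: "1/2 \<le> rs j" for j
    using s(2)[of j] le_imp_inverse_le[of 2 "real (Suc (Suc j))"] by simp
  have "(\<lambda>j. radial_det (blend f (\<epsilon> (ns (\<phi> j)))) (rs (\<phi> j)) (\<tau>s (\<phi> j))) \<longlonglongrightarrow> radial_det f 1 \<tau>"
  proof (rule radial_det_tendsto[OF adm_L[OF adm]])
    show "L-lipschitz_on UNIV (blend f (\<epsilon> (ns (\<phi> n))))" for n
      by (rule adm_lip[OF blend_admissible[OF adm \<epsilon>]])
    have "(\<lambda>n. \<epsilon> (ns (\<phi> n))) \<longlonglongrightarrow> 0"
      using filterlim_compose[OF \<epsilon>0 filterlim_compose[OF nslim filterlim_subseq[OF \<phi>(1)]]] .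
    then have "(\<lambda>n. blend f (\<epsilon> (ns (\<phi> n))) t) \<longlonglongrightarrow> (1 - 0) * f t + 0 * (l / (2*pi) * t)" for t
      unfolding blend_def by (intro tendsto_intros)
    then show "(\<lambda>n. blend f (\<epsilon> (ns (\<phi> n))) t) \<longlonglongrightarrow> f t" for t by simp
    show "(\<lambda>n. \<tau>s (\<phi> n)) \<longlonglongrightarrow> \<tau>" using \<phi>(2) by (simp add: o_def)
    show "(\<lambda>n. rs (\<phi> n)) \<longlonglongrightarrow> 1" using LIMSEQ_subseq_LIMSEQ[OF rslim \<phi>(1)] by (simp add: o_def)
  qed (use rs1 rhalf in auto)
  moreover have "(\<lambda>j. \<epsilon> (\<phi> j)) \<longlonglongrightarrow> 0" using LIMSEQ_subseq_LIMSEQ[OF \<epsilon>0 \<phi>(1)] by (simp add: o_def)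
  ultimately have "radial_det f 1 \<tau> \<le> 0"
    by (rule LIMSEQ_le) (use s(5) less_imp_le in blast)
  then show False using pos[of \<tau>] by simp
qed

text \<open>
On a circle of radius \<open>r\<close> near \<open>1\<close> put \<open>A = z h'\<close> and \<open>B = z k'\<close>. The lower bounds give a positive
determinant, so \<open>|B| < |A|\<close>, and show that \<open>\<Theta> = w\<^sub>\<tau> = i (A - cnj B)\<close> lies within a right angle of the tangent \<open>g'(f)\<close>. Therefore
\<open>A = - i X Y g'(f)\<close> with \<open>X = A / (A - cnj B)\<close> and \<open>Y = \<Theta> / g'(f)\<close> in the right half plane, and the increase
of \<open>log A\<close> around the circle is that of \<open>log g'\<close> along the curve, i.e. \<open>2\<pi>i\<sigma>\<close>. For \<open>\<sigma> = 1\<close> the function \<open>h' = A/z\<close>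
has a closed logarithm and hence no zeros; for \<open>\<sigma> = -1\<close> the same would hold for \<open>z\<^sup>2 h'(z)\<close>, which vanishes at \<open>0\<close>.
Then \<open>k'/h'\<close> is holomorphic and bounded by \<open>1\<close> on the circle, hence inside.
\<close>

lemma hol_deriv_dominates_if_increasing:
  assumes adm: "admissible L f" and c: "0 < c" and r0: "1/2 \<le> r0" "r0 < 1" and \<kappa>: "0 < \<kappa>"
    and det: "\<And>r \<tau>. r0 \<le> r \<Longrightarrow> r < 1 \<Longrightarrow> c \<le> radial_det f r \<tau>"
    and incr: "\<And>s t. s \<le> t \<Longrightarrow> \<kappa> * (t - s) \<le> f t - f s"
    and z0: "cmod z0 < 1"
  shows "hol_deriv f z0 \<noteq> 0 \<and> cmod (antihol_deriv f z0) \<le> cmod (hol_deriv f z0)"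
proof -
  have L: "0 < L" and lip: "L-lipschitz_on UNIV f" using adm_L[OF adm] adm_lip[OF adm] by auto
  \<comment> \<open>the factor is the value of \<open>2 r / (1 + r)\<close> at \<open>r = 1/2\<close>\<close>
  define k where "k = \<kappa> * (2 / 3)"
  have k: "0 < k" using \<kappa> by (simp add: k_def)
  have "((\<lambda>r. 18 * L * (ln (((1 - r)\<^sup>2 + pi\<^sup>2) / (1 - r)\<^sup>2) * tangential_error L (1 - r))) \<longlongrightarrow> 18 * L * 0) (at_left 1)"
    by (intro tendsto_mult tendsto_const
        filterlim_compose[OF tangential_error_tendsto_0(2)[OF L] filterlim_one_minus])
  then have ev1: "\<forall>\<^sub>F r in at_left 1. 18 * L * (ln (((1 - r)\<^sup>2 + pi\<^sup>2) / (1 - r)\<^sup>2) * tangential_error L (1 - r)) < k * c"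
    using k c by (intro order_tendstoD(2)) auto
  have "((\<lambda>r. tangential_error L (1 - r)) \<longlongrightarrow> 0) (at_left 1)"
    by (rule filterlim_compose[OF tangential_error_tendsto_0(1)[OF L] filterlim_one_minus])
  then have ev2: "\<forall>\<^sub>F r in at_left 1. tangential_error L (1 - r) < k"
    using k by (intro order_tendstoD(2)) auto
  have ev3: "\<forall>\<^sub>F r in at_left (1::real). max r0 (cmod z0) < r \<and> r < 1"
    unfolding eventually_at_left_field using r0 z0 by (intro exI[of _ "max r0 (cmod z0)"]) auto
  obtain r where r: "18 * L * (ln (((1 - r)\<^sup>2 + pi\<^sup>2) / (1 - r)\<^sup>2) * tangential_error L (1 - r)) < k * c"
    "tangential_error L (1 - r) < k" "max r0 (cmod z0) < r" "r < 1"
    using eventually_happens[OF eventually_conj[OF ev1 eventually_conj[OF ev2 ev3]]] trivial_limit_at_left_real by blast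
  have r': "1/2 \<le> r" "0 < r" "r0 \<le> r" "cmod z0 \<le> r" using r r0 by auto
  define A where "A t = of_real r * cis t * hol_deriv f (of_real r * cis t)" for t
  define B where "B t = of_real r * cis t * antihol_deriv f (of_real r * cis t)" for t
  define Th where "Th t = angular_int f r t" for t
  have Th: "Th t = \<i> * (A t - cnj (B t))" for t
    unfolding Th_def A_def B_def using polar_derivatives(2)[OF adm _ r(4) refl, of t] r' by simp
  have sp: "k \<le> tangential_speed f r t" for t
  proof -
    have "k \<le> \<kappa> * (2 * r / (1 + r))"
      unfolding k_def using r' \<kappa> by (intro mult_left_mono) (auto simp: field_simps)
    also have "\<dots> \<le> tangential_speed f r t" using r' r by (intro tangential_speed_lower[OF adm _ _ incr]) auto
    finally show ?thesis .
  qed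
  have AB: "cmod (B t) < cmod (A t)" for t
  proof -
    have "k * c \<le> tangential_speed f r t * radial_det f r t"
      using sp[of t] det[OF r'(3) r(4), of t] k c by (intro mult_mono) auto
    then have "0 < Im (cnj (radial_int f r t) * angular_int f r t)"
      using polar_det_estimate[OF L lip r'(1) r(4), of t] r(1) by linarith
    then have "0 < r\<^sup>2 * ((cmod (hol_deriv f (of_real r * cis t)))\<^sup>2 - (cmod (antihol_deriv f (of_real r * cis t)))\<^sup>2)"
      using polar_jacobian[OF adm _ r(4) refl, of t] r' by simp
    then have "(cmod (antihol_deriv f (of_real r * cis t)))\<^sup>2 < (cmod (hol_deriv f (of_real r * cis t)))\<^sup>2"
      using r' by (simp add: zero_less_mult_iff)
    then have "cmod (antihol_deriv f (of_real r * cis t)) < cmod (hol_deriv f (of_real r * cis t))"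
      by (rule power_less_imp_less_base) simp
    then show ?thesis using r' by (simp add: A_def B_def norm_mult)
  qed
  have Anz: "A t \<noteq> 0" for t using AB[of t] by auto
  define X where "X t = A t / (A t - cnj (B t))" for t
  have X: "0 < Re (X t)" for t
  proof -
    have "Re (A t * cnj (A t - cnj (B t))) = (cmod (A t))\<^sup>2 - Re (A t * B t)"
      unfolding cmod_power2 by (simp add: power2_eq_square algebra_simps)
    moreover have "Re (A t * B t) \<le> cmod (A t) * cmod (B t)" by (metis complex_Re_le_cmod norm_mult)
    moreover have "cmod (A t) * cmod (B t) < (cmod (A t))\<^sup>2"
      using AB[of t] Anz[of t] by (simp add: power2_eq_square)
    ultimately show ?thesis unfolding X_def Re_complex_div_gt_0 by linarith
  qed
  define Y where "Y t = Th t / g' (f t)" for t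
  have enz: "g' s \<noteq> 0" for s using unit[of s] by auto
  have Y: "0 < Re (Y t)" for t
  proof -
    define E where "E = Th t - of_real (tangential_speed f r t) * g' (f t)"
    have "cmod E < k" using tangential_bound[OF L lip r'(1) r(4), of t] r(2) by (simp add: E_def Th_def)
    have "g' (f t) * cnj (g' (f t)) = 1" using complex_norm_square[of "g' (f t)"] by (simp add: unit)
    then have "Th t * cnj (g' (f t)) = of_real (tangential_speed f r t) + E * cnj (g' (f t))"
      by (simp add: E_def algebra_simps)
    then have "Re (Th t * cnj (g' (f t))) = tangential_speed f r t + Re (E * cnj (g' (f t)))" by simp
    moreover have "\<bar>Re (E * cnj (g' (f t)))\<bar> \<le> cmod E"
      using abs_Re_le_cmod[of "E * cnj (g' (f t))"] by (simp add: norm_mult unit)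
    ultimately show ?thesis unfolding Y_def Re_complex_div_gt_0 using sp[of t] \<open>cmod E < k\<close> by linarith
  qed
  obtain \<Lambda> \<sigma> where \<Lambda>: "continuous_on UNIV \<Lambda>" "\<And>s. exp (\<Lambda> s) = g' s" "\<sigma> = 1 \<or> \<sigma> = (-1::real)"
    "\<And>s. \<Lambda> (s + l) = \<Lambda> s + 2 * pi * \<i> * \<sigma>"
    using Hopf_Umlaufsatz[OF l per inj der cont unit] by metis
  define c0 where "c0 = Ln (- \<i>)"
  have c0: "exp c0 = - \<i>" unfolding c0_def by (rule exp_Ln) simp
  \<comment> \<open>a continuous logarithm of \<open>A t / (r cis (\<sigma> t))\<close>\<close>
  define \<mu> where "\<mu> t = Ln (X t) + Ln (Y t) + \<Lambda> (f t) + c0 - \<i> * of_real (\<sigma> * t) - of_real (ln r)" for t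
  have zc: "continuous_on UNIV (\<lambda>t. of_real r * cis t)" by (intro continuous_intros)
  have zb: "of_real r * cis t \<in> ball 0 1" for t using r r' by (simp add: norm_mult)
  have hc: "continuous_on UNIV (\<lambda>t. hol_deriv f (of_real r * cis t))" "continuous_on UNIV (\<lambda>t. antihol_deriv f (of_real r * cis t))"
    using zb by (auto intro!: continuous_on_compose2[OF holomorphic_on_imp_continuous_on[OF hol_deriv_holomorphic(1)[OF adm]] zc]
        continuous_on_compose2[OF holomorphic_on_imp_continuous_on[OF hol_deriv_holomorphic(2)[OF adm]] zc])
  have Ac: "continuous_on UNIV A" "continuous_on UNIV B" unfolding A_def B_def by (intro continuous_intros hc)+
  have Thc: "continuous_on UNIV Th" unfolding Th by (intro continuous_intros Ac)
  have dnz: "A t - cnj (B t) \<noteq> 0" for t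
    using AB[of t] by (metis complex_mod_cnj eq_iff_diff_eq_0 less_irrefl)
  have Xc: "continuous_on UNIV X" unfolding X_def by (intro continuous_intros Ac) (use dnz in auto)
  have fc: "continuous_on UNIV f" using lip lipschitz_on_continuous_on by blast
  have Yc: "continuous_on UNIV Y" unfolding Y_def
    by (intro continuous_intros Thc continuous_on_compose2[OF cont fc]) (use enz in auto)
  have \<mu>c: "continuous_on UNIV \<mu>"
    unfolding \<mu>_def
    using X Y by (intro continuous_intros Xc Yc continuous_on_compose2[OF \<Lambda>(1) fc])
      (auto simp: complex_nonpos_Reals_iff not_le)
  have \<mu>per: "\<mu> (2*pi) = \<mu> 0"
  proof -
    have per0: "A (2*pi) = A 0" "B (2*pi) = B 0" by (simp_all add: A_def B_def)
    moreover have f2: "f (2*pi) = f 0 + l" using adm_per[OF adm, of 0] by simp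
    ultimately have "X (2*pi) = X 0" "Y (2*pi) = Y 0" by (simp_all add: X_def Y_def Th g'_periodic)
    then show ?thesis by (simp add: \<mu>_def f2 \<Lambda>(4))
  qed
  have Xnz: "X t \<noteq> 0" "Y t \<noteq> 0" for t using X[of t] Y[of t] by auto
  have exp\<mu>: "exp (\<mu> t) = A t * cis (- (\<sigma> * t)) / of_real r" for t
  proof -
    have "exp (\<mu> t) = X t * Y t * g' (f t) * (- \<i>) / exp (\<i> * of_real (\<sigma> * t)) / exp (of_real (ln r))"
      using Xnz[of t] by (simp add: \<mu>_def exp_add exp_diff \<Lambda>(2) c0)
    also have "exp (of_real (ln r)) = complex_of_real r" using r' by (simp add: exp_of_real)
    also have "X t * Y t * g' (f t) * (- \<i>) = A t"
      using enz[of "f t"] dnz[of t] by (simp add: X_def Y_def Th field_simps)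
    also have "A t / exp (\<i> * of_real (\<sigma> * t)) = A t * cis (- (\<sigma> * t))"
      by (simp add: cis_conv_exp exp_minus divide_inverse)
    finally show ?thesis .
  qed
  have nz: "hol_deriv f z \<noteq> 0" if z: "cmod z \<le> r" for z
  proof -
    from \<Lambda>(3) show ?thesis
    proof
      assume \<sigma>: "\<sigma> = 1"
      have "hol_deriv f (of_real r * cis t) = exp (\<mu> t)" for t
      proof -
        have "cis t * cis (- t) = 1" by (simp add: cis_mult)
        then show ?thesis unfolding exp\<mu> A_def \<sigma> using r' by (simp add: mult_ac)
      qed
      from no_zeros_if_periodic_logarithm[OF hol_deriv_holomorphic(1)[OF adm] r'(2) r(4) \<mu>c \<mu>per this z]
      show ?thesis .
    next
      assume \<sigma>: "\<sigma> = -1"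
      define H where "H z = z\<^sup>2 * hol_deriv f z / (of_real r)\<^sup>2" for z
      have "H holomorphic_on ball 0 1" unfolding H_def
        using r' by (intro holomorphic_intros hol_deriv_holomorphic(1)[OF adm]) auto
      moreover have "H (of_real r * cis t) = exp (\<mu> t)" for t
        unfolding exp\<mu> A_def \<sigma> H_def using r' by (simp add: power2_eq_square mult_ac)
      ultimately have "H 0 \<noteq> 0"
        using no_zeros_if_periodic_logarithm[OF _ r'(2) r(4) \<mu>c \<mu>per, of H 0] r' by auto
      then show ?thesis by (simp add: H_def)
    qed
  qed
  have "cmod (antihol_deriv f z0 / hol_deriv f z0) \<le> 1"
  proof (rule maximum_modulus_frontier[where f = "\<lambda>z. antihol_deriv f z / hol_deriv f z" and S = "cball 0 r"])
    have sub: "cball 0 r \<subseteq> ball (0::complex) 1" using r by auto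
    have hq: "(\<lambda>z. antihol_deriv f z / hol_deriv f z) holomorphic_on cball 0 r"
      using nz hol_deriv_holomorphic[OF adm] sub by (intro holomorphic_intros) (auto intro: holomorphic_on_subset)
    then show "(\<lambda>z. antihol_deriv f z / hol_deriv f z) holomorphic_on interior (cball 0 r)"
      by (rule holomorphic_on_subset) (rule interior_subset)
    show "continuous_on (closure (cball 0 r)) (\<lambda>z. antihol_deriv f z / hol_deriv f z)"
      using holomorphic_on_imp_continuous_on[OF hq] by simp
    fix z assume "z \<in> frontier (cball (0::complex) r)"
    then have zr: "cmod z = r" using r' by simp
    then have "of_real r * cis (Arg z) = z" by (metis rcis_cmod_Arg rcis_def)
    then have "r * cmod (antihol_deriv f z) < r * cmod (hol_deriv f z)"
      using AB[of "Arg z"] zr unfolding A_def B_def by (simp only: norm_mult)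
    then have "cmod (antihol_deriv f z) \<le> cmod (hol_deriv f z)" using r' by simp
    then show "cmod (antihol_deriv f z / hol_deriv f z) \<le> 1" by (simp add: norm_divide divide_le_eq_1)
  qed (use r' in auto)
  then show ?thesis using nz[OF r'(4)] by (simp add: norm_divide divide_le_eq_1)
qed

text \<open>
With \<open>b\<^sup>2 = cnj c\<close> the relation \<open>k' = c h'\<close> says that \<open>cnj b h - b k\<close> is constant; the imaginary part of \<open>cnj b w\<close>
is then constant in the disk, hence also on the boundary.
\<close>

lemma antihol_deriv_unimodular_imp_line:
  assumes adm: "admissible L f" and c: "cmod c = 1"
    and eq: "\<And>z. z \<in> ball 0 1 \<Longrightarrow> antihol_deriv f z = c * hol_deriv f z"
  obtains b where "b \<noteq> 0" "\<And>t s. Im (cnj b * g (f t)) = Im (cnj b * g (f s))"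
proof -
  define b where "b = csqrt (cnj c)"
  have b2: "b\<^sup>2 = cnj c" by (simp add: b_def)
  have "(cmod b)\<^sup>2 = 1" using c by (metis b2 complex_mod_cnj norm_power)
  then have bb: "b * cnj b = 1" by (metis complex_norm_square of_real_1)
  have bnz: "b \<noteq> 0" using bb by auto
  have bc: "b * c = cnj b"
  proof -
    have "c = cnj b ^ 2" using b2 by (metis complex_cnj_cnj complex_cnj_power)
    then have "b * c = (b * cnj b) * cnj b" by (simp add: power2_eq_square)
    then show ?thesis by (simp add: bb)
  qed
  define \<psi> where "\<psi> z = cnj b * hol_part f z - b * antihol_part f z" for z
  have "(\<psi> has_field_derivative 0) (at z within ball 0 1)" if "z \<in> ball 0 1" for z
  proof -
    have z: "cmod z < 1" using that by simp
    have "(\<psi> has_field_derivative (cnj b * hol_deriv f z - b * antihol_deriv f z)) (at z)"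
      unfolding \<psi>_def[abs_def]
      by (intro DERIV_diff DERIV_cmult hol_part_deriv[OF adm z] antihol_part_deriv[OF adm z])
    moreover have "cnj b * hol_deriv f z - b * antihol_deriv f z = 0"
      unfolding eq[OF that] mult.assoc[symmetric] bc by simp
    ultimately show ?thesis using has_field_derivative_at_within by force
  qed
  then obtain C where C: "\<And>z. z \<in> ball 0 1 \<Longrightarrow> \<psi> z = C"
    using has_field_derivative_zero_constant[of "ball 0 1" \<psi>] by auto
  have line: "Im (cnj b * (hol_part f z + cnj (antihol_part f z))) = Im C" if "z \<in> ball 0 1" for z
  proof -
    have "Im (cnj b * (hol_part f z + cnj (antihol_part f z))) = Im (\<psi> z)"
      by (simp add: \<psi>_def algebra_simps)
    then show ?thesis using C[OF that] by simp
  qed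
  have "Im (cnj b * g (f t)) = Im C" for t
  proof -
    have lim: "((\<lambda>r. hol_part f (of_real r * cis t) + cnj (antihol_part f (of_real r * cis t))) \<longlongrightarrow> g (f t)) (at_left 1)"
      by (rule boundary_limit[OF adm])
    have "((\<lambda>r. Im (cnj b * (hol_part f (of_real r * cis t) + cnj (antihol_part f (of_real r * cis t))))) \<longlongrightarrow> Im (cnj b * g (f t))) (at_left 1)"
      by (intro tendsto_intros lim)
    moreover have "\<forall>\<^sub>F r in at_left 1. Im (cnj b * (hol_part f (of_real r * cis t) + cnj (antihol_part f (of_real r * cis t)))) = Im C"
      unfolding eventually_at_left_field
    proof (intro exI[of _ 0] conjI allI impI)
      fix r :: real assume "0 < r" "r < 1"
      then show "Im (cnj b * (hol_part f (of_real r * cis t) + cnj (antihol_part f (of_real r * cis t)))) = Im C"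
        by (intro line) (simp add: norm_mult)
    qed simp
    ultimately have "((\<lambda>r::real. Im C) \<longlongrightarrow> Im (cnj b * g (f t))) (at_left 1)" by (simp add: tendsto_cong)
    then show ?thesis using tendsto_unique[OF _ tendsto_const] trivial_limit_at_left_real by metis
  qed
  then show ?thesis using that bnz by metis
qed

lemma line_imp_det_zero:
  assumes surj: "surj f" and b: "b \<noteq> 0"
    and line: "\<And>t s. Im (cnj b * g (f t)) = Im (cnj b * g (f s))"
  shows "radial_det f r \<tau> = 0"
proof -
  have gl: "Im (cnj b * g s) = Im (cnj b * g 0)" for s
    using line surj by (metis surj_def)
  have g'l: "Im (cnj b * g' s) = 0" for s
  proof -
    have bl: "bounded_linear (\<lambda>z. Im (cnj b * z))"
      by (intro bounded_linear_compose[OF bounded_linear_Im] bounded_linear_mult_right)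
    have "((\<lambda>s. Im (cnj b * g s)) has_vector_derivative Im (cnj b * g' s)) (at s)"
      by (rule bounded_linear.has_vector_derivative[OF bl der])
    moreover have "(\<lambda>s. Im (cnj b * g s)) = (\<lambda>s. Im (cnj b * g 0))" using gl by auto
    ultimately show ?thesis using has_vector_derivative_const vector_derivative_at by metis
  qed
  have "chord_det f \<tau> x = 0" for x
  proof -
    define u v where "u = g (f (\<tau> + x)) - g (f \<tau>)" and "v = g' (f \<tau>)"
    have u: "Im (cnj b * u) = 0" using line[of "\<tau> + x" \<tau>] by (simp add: u_def right_diff_distrib)
    have v: "Im (cnj b * v) = 0" using g'l by (simp add: v_def)
    have "of_real ((cmod b)\<^sup>2) * (cnj u * v) = cnj (cnj b * u) * (cnj b * v)"
      by (simp only: complex_norm_square) (simp add: mult_ac)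
    moreover have "Im (of_real a * z) = a * Im z" for a z by simp
    ultimately have "(cmod b)\<^sup>2 * Im (cnj u * v) = Im (cnj (cnj b * u) * (cnj b * v))"
      by metis
    also have "\<dots> = 0" unfolding times_complex.sel using u v by simp
    finally show ?thesis using b by (simp add: chord_det_def u_def v_def)
  qed
  then show ?thesis by (simp add: radial_det_def)
qed

text \<open>
Pass to the limit in the blends: \<open>|k'| \<le> |h'|\<close> survives, \<open>h'\<close> is free of zeros by Hurwitz' theorem, and the
maximum principle for \<open>k'/h'\<close> upgrades the inequality to a strict one unless \<open>k'/h'\<close> is a unimodular
constant, in which case the curve would be contained in a line and \<open>T\<close> would vanish.
\<close>

lemma jacobian_positive:
  assumes adm: "admissible L f" and "mono f" "surj f"
    and pos: "\<And>\<tau>. 0 < radial_det f 1 \<tau>" and z: "z \<in> ball 0 1"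
  shows "cmod (antihol_deriv f z) < cmod (hol_deriv f z)"
proof -
  obtain c N r0 where c: "0 < c" "1/2 \<le> r0" "r0 < 1"
    "\<And>n r \<tau>. N \<le> n \<Longrightarrow> r0 \<le> r \<Longrightarrow> r < 1 \<Longrightarrow> c \<le> radial_det (blend f (inverse (real (Suc n)))) r \<tau>"
    using radial_det_blend_positive[OF adm pos] by metis
  define \<epsilon> where "\<epsilon> n = inverse (real (Suc (N + n)))" for n
  have \<epsilon>: "0 < \<epsilon> n" "\<epsilon> n \<le> 1" for n
    using le_imp_inverse_le[of 1 "real (Suc (N + n))"] by (auto simp: \<epsilon>_def)
  have \<epsilon>0: "\<epsilon> \<longlonglongrightarrow> 0" unfolding \<epsilon>_def
    using LIMSEQ_ignore_initial_segment[OF LIMSEQ_inverse_real_of_nat, of N] by (simp add: add.commute)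
  define fs where "fs n = blend f (\<epsilon> n)" for n
  have adms: "admissible L (fs n)" for n
    unfolding fs_def using \<epsilon>[of n] by (intro blend_admissible[OF adm]) auto
  have nv: "hol_deriv (fs n) x \<noteq> 0 \<and> cmod (antihol_deriv (fs n) x) \<le> cmod (hol_deriv (fs n) x)"
    if "x \<in> ball 0 1" for n x
  proof (rule hol_deriv_dominates_if_increasing[OF adms c(1-3)])
    show "0 < \<epsilon> n * l / (2*pi)" using \<epsilon>[of n] l by simp
    show "c \<le> radial_det (fs n) r \<tau>" if "r0 \<le> r" "r < 1" for r \<tau>
      using c(4)[of "N + n" r \<tau>] that by (simp add: fs_def \<epsilon>_def)
    show "\<epsilon> n * l / (2*pi) * (t - s) \<le> fs n t - fs n s" if "s \<le> t" for s t
      unfolding fs_def using \<epsilon>[of n] that by (intro blend_increasing[OF \<open>mono f\<close>]) auto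
  qed (use that in auto)
  have fc: "continuous_on S f" for S
    using lipschitz_on_continuous_on[OF adm_lip[OF adm]] continuous_on_subset by blast
  \<comment> \<open>a blend differs from \<open>f\<close> by \<open>\<epsilon>\<close> times this bounded function, so the derivatives converge at
    the rate \<open>\<epsilon>\<close>\<close>
  have "continuous_on {0..2*pi} (\<lambda>t. l / (2*pi) * t - f t)" by (intro continuous_intros fc)
  then have "bounded ((\<lambda>t. l / (2*pi) * t - f t) ` {0..2*pi})"
    by (intro compact_imp_bounded compact_continuous_image) auto
  then obtain M where M0: "\<forall>y\<in>(\<lambda>t. l / (2*pi) * t - f t) ` {0..2*pi}. norm y \<le> M"
    unfolding bounded_iff by blast
  have M: "\<bar>l / (2*pi) * t - f t\<bar> \<le> M" if "t \<in> {0..2*pi}" for t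
    using bspec[OF M0 imageI[OF that]] by simp
  have gd: "cmod (g (fs n t) - g (f t)) \<le> \<epsilon> n * M" if "t \<in> {0..2*pi}" for n t
  proof -
    have "fs n t - f t = \<epsilon> n * (l / (2*pi) * t - f t)" by (simp add: fs_def blend_def algebra_simps)
    then have "\<bar>fs n t - f t\<bar> = \<epsilon> n * \<bar>l / (2*pi) * t - f t\<bar>" using \<epsilon>[of n] by (simp add: abs_mult)
    also have "\<dots> \<le> \<epsilon> n * M" using M[OF that] \<epsilon>[of n] by (intro mult_left_mono) auto
    finally show ?thesis using chord_bound[of "fs n t" "f t"] by linarith
  qed
  have bd: "cmod (hol_deriv (fs n) x - hol_deriv f x) \<le> \<epsilon> n * M / (1 - R)\<^sup>2"
    "cmod (antihol_deriv (fs n) x - antihol_deriv f x) \<le> \<epsilon> n * M / (1 - R)\<^sup>2"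
    if "cmod x \<le> R" "R < 1" for n x R
  proof -
    show "cmod (hol_deriv (fs n) x - hol_deriv f x) \<le> \<epsilon> n * M / (1 - R)\<^sup>2"
      by (rule cauchy_transform_deriv_diff_bound[OF adm_cont[OF adms] adm_cont[OF adm] gd that])
    show "cmod (antihol_deriv (fs n) x - antihol_deriv f x) \<le> \<epsilon> n * M / (1 - R)\<^sup>2"
    proof (rule cauchy_transform_deriv_diff_bound[OF _ _ _ that])
      show "cmod (cnj (g (fs n t)) - cnj (g (f t))) \<le> \<epsilon> n * M" if "t \<in> {0..2*pi}" for t
        using gd[OF that, of n] by (metis complex_cnj_diff complex_mod_cnj)
    qed (rule continuous_on_cnj[OF adm_cont[OF adms]] continuous_on_cnj[OF adm_cont[OF adm]])+
  qed
  have lim0: "(\<lambda>n. \<epsilon> n * M / (1 - R)\<^sup>2) \<longlonglongrightarrow> 0" for R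
    using tendsto_mult[OF \<epsilon>0 tendsto_const[of "M / (1 - R)\<^sup>2"]] by simp
  have conv: "(\<lambda>n. hol_deriv (fs n) x) \<longlonglongrightarrow> hol_deriv f x" "(\<lambda>n. antihol_deriv (fs n) x) \<longlonglongrightarrow> antihol_deriv f x"
    if "x \<in> ball 0 1" for x
  proof -
    have x: "cmod x \<le> cmod x" "cmod x < 1" using that by auto
    show "(\<lambda>n. hol_deriv (fs n) x) \<longlonglongrightarrow> hol_deriv f x"
      by (rule LIM_zero_cancel, rule Lim_null_comparison[OF _ lim0[of "cmod x"]]) (use bd(1)[OF x] in auto)
    show "(\<lambda>n. antihol_deriv (fs n) x) \<longlonglongrightarrow> antihol_deriv f x"
      by (rule LIM_zero_cancel, rule Lim_null_comparison[OF _ lim0[of "cmod x"]]) (use bd(2)[OF x] in auto)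
  qed
  have le: "cmod (antihol_deriv f x) \<le> cmod (hol_deriv f x)" if "x \<in> ball 0 1" for x
    by (rule LIMSEQ_le[OF tendsto_norm[OF conv(2)[OF that]] tendsto_norm[OF conv(1)[OF that]]])
       (use nv[OF that] in blast)
  have no_line: False if "cmod c = 1" "\<And>x. x \<in> ball 0 1 \<Longrightarrow> antihol_deriv f x = c * hol_deriv f x" for c
    using antihol_deriv_unimodular_imp_line[OF adm that] line_imp_det_zero[OF \<open>surj f\<close>] pos[of 0]
    by (metis less_irrefl)
  have nz: "hol_deriv f x \<noteq> 0" if x: "x \<in> ball 0 1" for x
  proof (cases "hol_deriv f constant_on ball 0 1")
    case True
    then obtain k where k: "\<And>y. y \<in> ball 0 1 \<Longrightarrow> hol_deriv f y = k" unfolding constant_on_def by blast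
    have "k \<noteq> 0"
    proof
      assume "k = 0"
      then have "antihol_deriv f y = 1 * hol_deriv f y" if "y \<in> ball 0 1" for y
        using le[OF that] k[OF that] by simp
      then show False using no_line[of 1] by simp
    qed
    then show ?thesis using k[OF x] by simp
  next
    case False
    show ?thesis
    proof (rule Hurwitz_no_zeros[of "ball 0 1" "\<lambda>n. hol_deriv (fs n)" "hol_deriv f"])
      fix K :: "complex set" assume K: "compact K" "K \<subseteq> ball 0 1"
      obtain R where R: "R < 1" "\<And>y. y \<in> K \<Longrightarrow> cmod y \<le> R"
      proof (cases "K = {}")
        case True
        then show ?thesis using that[of 0] by auto
      next
        case False
        then obtain y where "y \<in> K" "\<And>x. x \<in> K \<Longrightarrow> cmod x \<le> cmod y"
          using continuous_attains_sup[OF K(1) False continuous_on_norm_id] by blast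
        then show ?thesis using that[of "cmod y"] K(2) by force
      qed
      show "uniform_limit K (\<lambda>n. hol_deriv (fs n)) (hol_deriv f) sequentially"
      proof (rule uniform_limitI)
        fix e :: real assume "0 < e"
        have "\<forall>\<^sub>F n in sequentially. \<epsilon> n * M / (1 - R)\<^sup>2 < e"
          using order_tendstoD(2)[OF lim0 \<open>0 < e\<close>] .
        then show "\<forall>\<^sub>F n in sequentially. \<forall>x\<in>K. dist (hol_deriv (fs n) x) (hol_deriv f x) < e"
        proof eventually_elim
          case (elim n)
          show ?case
          proof
            fix x assume "x \<in> K"
            from bd(1)[OF R(2)[OF this] R(1), of n] elim
            show "dist (hol_deriv (fs n) x) (hol_deriv f x) < e" by (simp add: dist_norm)
          qed
        qed
      qed
    qed (use nv False x hol_deriv_holomorphic(1)[OF adms] hol_deriv_holomorphic(1)[OF adm] in auto)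
  qed
  show ?thesis
  proof (rule ccontr)
    assume "\<not> ?thesis"
    then have eq: "cmod (antihol_deriv f z) = cmod (hol_deriv f z)" using le[OF z] by simp
    define q where "q x = antihol_deriv f x / hol_deriv f x" for x
    have "q constant_on ball 0 1"
    proof (rule maximum_modulus_principle[where U = "ball 0 1" and \<xi> = z])
      show "q holomorphic_on ball 0 1" unfolding q_def
        using nz by (intro holomorphic_intros hol_deriv_holomorphic[OF adm]) auto
      show "cmod (q x) \<le> cmod (q z)" if "x \<in> ball 0 1" for x
        using le[OF that] nz[OF that] nz[OF z] eq by (simp add: q_def norm_divide divide_le_eq_1)
    qed (use z in auto)
    then obtain c where cq: "\<And>x. x \<in> ball 0 1 \<Longrightarrow> q x = c" unfolding constant_on_def by blast
    have "cmod c = 1" using cq[OF z] eq nz[OF z] by (auto simp: q_def norm_divide)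
    moreover have "antihol_deriv f x = c * hol_deriv f x" if "x \<in> ball 0 1" for x
      using cq[OF that] nz[OF that] by (simp add: q_def field_simps)
    ultimately show False using no_line by blast
  qed
qed

section \<open>The extension as a diffeomorphism\<close>

text \<open>
Near the circle \<open>w\<close> is close to \<open>\<gamma>\<close>, so preimages of compact sets avoiding \<open>\<gamma>\<close> are compact. If a value lay in
the exterior domain, \<open>w\<close> would cover this unbounded set, although \<open>w\<close> is bounded; and no value lies on
\<open>\<gamma>\<close>, because \<open>w\<close> is open and \<open>\<gamma>\<close> is in the closure of the exterior. What is left is a covering of the simply
connected interior domain.
\<close>

lemma harmonic_extension_diffeomorphism:
  assumes adm: "admissible L f"
    and J: "\<And>z. z \<in> ball 0 1 \<Longrightarrow> cmod (antihol_deriv f z) < cmod (hol_deriv f z)"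
  shows "diffeomorphism_onto (\<lambda>z. hol_part f z + cnj (antihol_part f z)) (ball 0 1) (inside (g ` {0..l}))"
proof -
  define w where "w = (\<lambda>z. hol_part f z + cnj (antihol_part f z))"
  define U where "U = ball (0::complex) 1"
  define \<gamma> where "\<gamma> = g ` {0..l}"
  define p where "p u = g (l * u)" for u
  have oU: "open U" "connected U" and U0: "0 \<in> U" by (auto simp: U_def)
  have pim: "path_image p = \<gamma>"
  proof -
    have "(\<lambda>u. l * u) ` {0..1} = {0..l}" using l by (simp add: image_mult_atLeastAtMost)
    then have "g ` ((\<lambda>u. l * u) ` {0..1}) = \<gamma>" by (simp add: \<gamma>_def)
    then show ?thesis by (simp add: path_image_def p_def image_image)
  qed
  have gl: "g l = g 0" using per[of 0] by simp
  have sp: "simple_path p"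
    unfolding simple_path_def loop_free_def
  proof (intro conjI ballI impI)
    show "path p" unfolding path_def p_def
      by (rule continuous_on_compose2[OF g_continuous]) (auto intro!: continuous_intros)
    fix x y :: real assume xy: "x \<in> {0..1}" "y \<in> {0..1}" "p x = p y"
    have le: "a = b \<or> (a = 0 \<and> b = l) \<or> (a = l \<and> b = 0)" if "a \<in> {0..l}" "b \<in> {0..l}" "g a = g b" for a b
    proof -
      have i: "a' = b'" if "a' \<in> {0..<l}" "b' \<in> {0..<l}" "g a' = g b'" for a' b'
        by (rule inj_onD[OF inj that(3) that(1,2)])
      consider "a < l" "b < l" | "a = l" "b < l" | "a < l" "b = l" | "a = l" "b = l"
        using \<open>a \<in> {0..l}\<close> \<open>b \<in> {0..l}\<close> by fastforce
      then show ?thesis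
      proof cases
        case 1
        then show ?thesis using i[of a b] that by simp
      next
        case 2
        then show ?thesis using i[of b 0] that gl l by simp
      next
        case 3
        then show ?thesis using i[of a 0] that gl l by simp
      qed simp
    qed
    have "l * x \<in> {0..l}" "l * y \<in> {0..l}" using xy l by (auto simp: mult_left_le)
    from le[OF this] xy(3) l show "x = y \<or> x = 0 \<and> y = 1 \<or> x = 1 \<and> y = 0" by (auto simp: p_def)
  qed
  have loop: "pathfinish p = pathstart p" by (simp add: pathfinish_def pathstart_def p_def gl)
  note JC = Jordan_inside_outside[OF sp loop, unfolded pim]
  have sc: "simply_connected (inside \<gamma>)" using simply_connected_inside_simple_path[OF sp] pim by simp
  have cg: "compact \<gamma>" unfolding \<gamma>_def
    by (intro compact_continuous_image continuous_on_subset[OF g_continuous]) auto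
  have g\<gamma>: "g s \<in> \<gamma>" for s
  proof -
    interpret periodic_fun_simple g l by unfold_locales (rule per)
    define n where "n = \<lfloor>s / l\<rfloor>"
    have "s - n * l \<in> {0..l}"
      using floor_divide_lower[OF l, of s] floor_divide_upper[OF l, of s]
      by (auto simp: n_def algebra_simps)
    moreover have "g (s - n * l) = g s" using minus_of_int[of s n] by simp
    ultimately show ?thesis unfolding \<gamma>_def by (metis image_eqI)
  qed
  have hol: "hol_part f holomorphic_on U" "antihol_part f holomorphic_on U"
    unfolding U_def holomorphic_on_open[OF open_ball]
    using hol_part_deriv[OF adm] antihol_part_deriv[OF adm] by (auto simp: ball_def)
  have d: "deriv (hol_part f) z = hol_deriv f z" "deriv (antihol_part f) z = antihol_deriv f z" if "z \<in> U" for z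
    using DERIV_imp_deriv[OF hol_part_deriv[OF adm]] DERIV_imp_deriv[OF antihol_part_deriv[OF adm]] that
    by (auto simp: U_def)
  have J': "cmod (deriv (antihol_part f) z) < cmod (deriv (hol_part f) z)" if "z \<in> U" for z
    using J d[OF that] that by (simp add: U_def)
  have contw: "continuous_on U w" unfolding w_def
    by (intro continuous_intros holomorphic_on_imp_continuous_on hol)
  have loc: "\<exists>e>0. ball z e \<subseteq> U \<and> inj_on w (ball z e)" if "z \<in> U" for z
    unfolding w_def by (rule harmonic_locally_injective[OF oU(1) hol J' that])
  have near: "\<exists>r0. r0 < 1 \<and> (\<forall>z. r0 < cmod z \<longrightarrow> cmod z < 1 \<longrightarrow> (\<exists>q\<in>\<gamma>. dist (w z) q < \<delta>))" if "0 < \<delta>" for \<delta>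
  proof -
    have "\<forall>\<^sub>F r in at_left 1. 6 * L * ((1 - r) * ln (((1 - r)\<^sup>2 + pi\<^sup>2) / (1 - r)\<^sup>2)) < \<delta>"
      using order_tendstoD(2)[OF boundary_error_tendsto_0 that] .
    then obtain b where b: "b < 1" "\<And>r. b < r \<Longrightarrow> r < 1 \<Longrightarrow> 6 * L * ((1 - r) * ln (((1 - r)\<^sup>2 + pi\<^sup>2) / (1 - r)\<^sup>2)) < \<delta>"
      unfolding eventually_at_left_field by blast
    have "\<exists>q\<in>\<gamma>. dist (w z) q < \<delta>" if z: "max b (1/2) < cmod z" "cmod z < 1" for z
    proof -
      have "z = of_real (cmod z) * cis (Arg z)" by (metis rcis_cmod_Arg rcis_def)
      from boundary_values[OF adm _ z(2) this] b(2)[of "cmod z"] z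
      have "dist (w z) (g (f (Arg z))) < \<delta>" by (simp add: w_def dist_norm)
      then show ?thesis using g\<gamma> by blast
    qed
    then show ?thesis using b(1) by (intro exI[of _ "max b (1/2)"]) auto
  qed
  have proper: "compact {z \<in> U. w z \<in> K}" if K: "compact K" "K \<inter> \<gamma> = {}" for K
  proof -
    obtain \<delta> where \<delta>: "\<delta> > 0" "\<And>x y. x \<in> K \<Longrightarrow> y \<in> \<gamma> \<Longrightarrow> \<delta> \<le> dist x y"
      using separate_compact_closed[OF K(1) compact_imp_closed[OF cg] K(2)] by blast
    obtain r0 where r0: "r0 < 1" "\<And>z. r0 < cmod z \<Longrightarrow> cmod z < 1 \<Longrightarrow> \<exists>q\<in>\<gamma>. dist (w z) q < \<delta>"
      using near[OF \<delta>(1)] by blast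
    have "{z \<in> U. w z \<in> K} = cball 0 r0 \<inter> w -` K"
    proof (intro equalityI subsetI)
      fix z assume z: "z \<in> {z \<in> U. w z \<in> K}"
      have "\<not> r0 < cmod z"
      proof
        assume "r0 < cmod z"
        then obtain q where "q \<in> \<gamma>" "dist (w z) q < \<delta>" using r0(2)[of z] z by (auto simp: U_def)
        then show False using \<delta>(2)[of "w z" q] z by simp
      qed
      then show "z \<in> cball 0 r0 \<inter> w -` K" using z by auto
    qed (use r0(1) in \<open>auto simp: U_def\<close>)
    moreover have "continuous_on (cball 0 r0) w"
      by (rule continuous_on_subset[OF contw]) (use r0(1) in \<open>auto simp: U_def\<close>)
    then have "closed (cball 0 r0 \<inter> w -` K)"
      by (rule continuous_closed_preimage) (use compact_imp_closed[OF K(1)] in auto)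
    moreover have "bounded (cball 0 r0 \<inter> w -` K)" by (rule bounded_subset[OF bounded_cball]) auto
    ultimately show ?thesis by (simp add: compact_eq_bounded_closed)
  qed
  have bw: "bounded (w ` U)"
  proof -
    obtain r0 where r0: "r0 < 1" "\<And>z. r0 < cmod z \<Longrightarrow> cmod z < 1 \<Longrightarrow> \<exists>q\<in>\<gamma>. dist (w z) q < 1"
      using near[of 1] by auto
    obtain M where M: "\<And>q. q \<in> \<gamma> \<Longrightarrow> cmod q \<le> M" using compact_imp_bounded[OF cg] by (auto simp: bounded_iff)
    have "compact (w ` cball 0 r0)"
      by (intro compact_continuous_image continuous_on_subset[OF contw]) (use r0(1) in \<open>auto simp: U_def\<close>)
    then have "bounded (w ` cball 0 r0)" by (rule compact_imp_bounded)
    then obtain M' where "\<forall>y\<in>w ` cball 0 r0. cmod y \<le> M'" unfolding bounded_iff by blast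
    then have M': "cmod (w z) \<le> M'" if "cmod z \<le> r0" for z using that by simp
    have "cmod (w z) \<le> max M' (M + 1)" if "z \<in> U" for z
    proof (cases "cmod z \<le> r0")
      case True
      then show ?thesis using M'[of z] by simp
    next
      case False
      then obtain q where q: "q \<in> \<gamma>" "dist (w z) q < 1" using r0(2)[of z] \<open>z \<in> U\<close> by (auto simp: U_def)
      then show ?thesis using M[of q] norm_triangle_ineq2[of "w z" q] by (simp add: dist_norm)
    qed
    then show ?thesis unfolding bounded_iff by blast
  qed
  have no_out: "w z \<notin> outside \<gamma>" if "z \<in> U" for z
  proof
    assume out: "w z \<in> outside \<gamma>"
    define U' where "U' = {z \<in> U. w z \<in> outside \<gamma>}"
    have oU': "open U'"
    proof -
      have "open (U \<inter> w -` outside \<gamma>)" by (rule continuous_open_preimage[OF contw oU(1)]) (use JC in auto)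
      then show ?thesis by (simp add: U'_def Int_def vimage_def)
    qed
    have "covering_space U' w (outside \<gamma>)"
    proof (rule proper_local_homeomorphism_imp_covering_space[OF oU'])
      show "continuous_on U' w" by (rule continuous_on_subset[OF contw]) (auto simp: U'_def)
      show "U' \<noteq> {}" using out that by (auto simp: U'_def)
      fix x assume x: "x \<in> U'"
      then obtain e where e: "e > 0" "inj_on w (ball x e)" using loc[of x] by (auto simp: U'_def)
      obtain e' where e': "e' > 0" "ball x e' \<subseteq> U'" using oU' x open_contains_ball by blast
      have "inj_on w (ball x (min e e'))" by (rule inj_on_subset[OF e(2)]) auto
      then show "\<exists>e>0. ball x e \<subseteq> U' \<and> inj_on w (ball x e)"
        using e(1) e' by (intro exI[of _ "min e e'"]) auto
    next
      fix K assume K: "compact K" "K \<subseteq> outside \<gamma>"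
      have "{z \<in> U'. w z \<in> K} = {z \<in> U. w z \<in> K}" using K(2) by (auto simp: U'_def)
      moreover have "K \<inter> \<gamma> = {}" using K(2) outside_no_overlap[of \<gamma>] by blast
      ultimately show "compact {z \<in> U'. w z \<in> K}" using proper[OF K(1)] by simp
    qed (use JC in \<open>auto simp: U'_def\<close>)
    then have "w ` U' = outside \<gamma>" by (rule covering_space_imp_surjective)
    then have "bounded (outside \<gamma>)" using bounded_subset[OF bw, of "w ` U'"] by (auto simp: U'_def)
    then show False using JC by blast
  qed
  have win: "w ` U \<subseteq> inside \<gamma>"
  proof
    fix x assume x: "x \<in> w ` U"
    have "x \<notin> \<gamma>"
    proof
      assume "x \<in> \<gamma>"
      then have "x \<in> closure (outside \<gamma>)" using JC by (auto simp: frontier_def)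
      moreover have "open (w ` U)" by (rule locally_injective_open_map[OF contw loc oU(1)]) auto
      ultimately have "w ` U \<inter> outside \<gamma> \<noteq> {}"
        using x by (metis IntI disjoint_iff open_Int_closure_eq_empty)
      then show False using no_out by blast
    qed
    then show "x \<in> inside \<gamma>" using no_out x JC by blast
  qed
  have cov: "covering_space U w (inside \<gamma>)"
  proof (rule proper_local_homeomorphism_imp_covering_space[OF oU(1) _ _ contw win _ loc])
    show "compact {z \<in> U. w z \<in> K}" if "compact K" "K \<subseteq> inside \<gamma>" for K
      using proper[OF that(1)] that(2) inside_no_overlap[of \<gamma>] by blast
  qed (use JC U0 in auto)
  have injw: "inj_on w U"
    by (rule covering_space_of_simply_connected_inj[OF cov oU _ sc loc]) (use JC in auto)
  have surjw: "w ` U = inside \<gamma>" by (rule covering_space_imp_surjective[OF cov])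
  show ?thesis
    unfolding diffeomorphism_onto_def w_def[symmetric] U_def[symmetric] \<gamma>_def[symmetric]
  proof (intro conjI)
    show "bij_betw w U (inside \<gamma>)" using injw surjw by (simp add: bij_betw_def)
    show "smooth_on w U" unfolding w_def by (rule harmonic_smooth_on[OF oU(1) hol])
    show "smooth_on (the_inv_into U w) (inside \<gamma>)"
      using harmonic_inverse_smooth_on[OF oU(1) hol J'] injw surjw by (simp add: w_def)
  qed (use oU JC in auto)
qed

lemma m_tendsto_0: "(m \<longlongrightarrow> 0) (at_right 0)"
  using rho_tendsto_0[of 1] by (simp add: rho_def[abs_def])

text \<open>
On short arcs the arc length parametrization shortens distances at most by a factor of \<open>2\<close>, so the
Lipschitz bound for \<open>g \<circ> f\<close> passes to \<open>f\<close> locally. Local bounds add up along an interval.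
\<close>

lemma lipschitz_reparametrization:
  assumes fc: "continuous_on UNIV f" and M: "0 \<le> M"
    and lip: "\<And>s t. cmod (g (f s) - g (f t)) \<le> M * \<bar>s - t\<bar>"
  shows "(2 * M)-lipschitz_on UNIV f"
proof -
  obtain \<kappa> where \<kappa>: "\<kappa> > 0" "\<And>x. 0 < x \<Longrightarrow> x < \<kappa> \<Longrightarrow> m x < 1/2"
    using order_tendstoD(2)[OF m_tendsto_0, of "1/2"] unfolding eventually_at_right_field by auto
  have g_lower: "\<bar>b - a\<bar> \<le> 2 * cmod (g b - g a)" if "\<bar>b - a\<bar> < \<kappa>" for a b
  proof (cases "b = a")
    case False
    define T where "T = of_real (b - a) * g' a"
    have T: "cmod T = \<bar>b - a\<bar>" by (simp only: T_def norm_mult norm_of_real unit) simp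
    have "cmod (g b - g a - T) \<le> \<bar>b - a\<bar> * m \<bar>b - a\<bar>"
      using tangent_bound[of b a] by (simp add: T_def)
    also have "\<dots> \<le> \<bar>b - a\<bar> * (1/2)"
      using \<kappa>(2)[of "\<bar>b - a\<bar>"] that False by (intro mult_left_mono) auto
    finally have 1: "cmod (g b - g a - T) \<le> cmod T / 2" by (simp add: T)
    have "cmod T \<le> cmod (g b - g a) + cmod (g b - g a - T)"
      using norm_triangle_sub[of T "g b - g a"] by (simp only: norm_minus_commute)
    with 1 show ?thesis unfolding T[symmetric] by linarith
  qed simp
  have "\<bar>f b - f a\<bar> \<le> 2 * M * (b - a)" if "a \<le> b" for a b
    using that
  proof (induction rule: Bolzano)
    case (trans a b c)
    have "2 * M * (b - a) + 2 * M * (c - b) = 2 * M * (c - a)" by (simp add: algebra_simps)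
    then show ?case using trans by linarith
  next
    case (local x)
    have "isCont f x" using fc continuous_on_eq_continuous_at by blast
    then obtain d where d: "d > 0" "\<And>y. dist y x < d \<Longrightarrow> dist (f y) (f x) < \<kappa> / 2"
      using \<kappa>(1) unfolding continuous_at_eps_delta by (metis half_gt_zero)
    have "\<bar>f b - f a\<bar> \<le> 2 * M * (b - a)" if ab: "a \<le> x" "x \<le> b" "b - a < d" for a b
    proof -
      have "dist (f a) (f x) < \<kappa> / 2" "dist (f b) (f x) < \<kappa> / 2"
        by (rule d(2), use ab in \<open>simp add: dist_real_def\<close>)+
      then have "\<bar>f b - f a\<bar> < \<kappa>" unfolding dist_real_def by linarith
      from g_lower[OF this] lip[of b a] ab show ?thesis by simp
    qed
    then show ?case using d(1) by blast
  qed
  then have "\<bar>f s - f t\<bar> \<le> 2 * M * \<bar>s - t\<bar>" for s t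
    by (cases "s \<le> t") (metis abs_minus_commute abs_of_nonneg diff_ge_0_iff_ge, metis abs_of_nonneg diff_ge_0_iff_ge linear)
  then show ?thesis using M by (intro lipschitz_onI) (auto simp: dist_real_def)
qed

end

section \<open>Weak homeomorphisms onto a Dini smooth curve\<close>

lemma mono_of_quasi_periodic:
  fixes f :: "real \<Rightarrow> real"
  assumes T: "0 < T" and l: "0 < l" and mono: "mono_on {0..T} f" and im: "f ` {0..T} = {0..l}"
    and per: "\<And>t. f (t + T) = f t + l"
  shows "mono f" "surj f"
proof -
  define p where "p t = f t - l / T * t" for t
  have "p (t + T) = p t" for t using T per[of t] by (simp add: p_def distrib_left)
  then interpret p: periodic_fun_simple p T by unfold_locales
  have shift: "f (t + of_int n * T) = f t + of_int n * l" for t n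
  proof -
    have "l / T * (t + of_int n * T) = l / T * t + of_int n * l" using T by (simp add: distrib_left)
    then show ?thesis using p.plus_of_int[of t n] by (simp add: p_def)
  qed
  define N where "N t = \<lfloor>t / T\<rfloor>" for t
  define R where "R t = t - of_int (N t) * T" for t
  have R: "R t \<in> {0..T}" for t
    using floor_divide_lower[OF T, of t] floor_divide_upper[OF T, of t]
    by (auto simp: R_def N_def algebra_simps)
  have fR: "f t = f (R t) + of_int (N t) * l" for t using shift[of "R t" "N t"] by (simp add: R_def)
  have f0l: "0 \<le> f (R t)" "f (R t) \<le> l" for t using imageI[OF R[of t], of f] im by auto
  show "mono f"
  proof
    fix s t :: real assume st: "s \<le> t"
    then have "N s \<le> N t" using T by (simp add: N_def floor_mono divide_right_mono)
    show "f s \<le> f t"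
    proof (cases "N s = N t")
      case True
      then have "R s \<le> R t" using st by (simp add: R_def)
      then show ?thesis using mono_onD[OF mono R R, of s t] True fR[of s] fR[of t] by simp
    next
      case False
      then have "N s + 1 \<le> N t" using \<open>N s \<le> N t\<close> by simp
      then have "real_of_int (N s + 1) * l \<le> of_int (N t) * l"
        using l by (intro mult_right_mono) (simp_all only: of_int_le_iff less_imp_le)
      then have "l + of_int (N s) * l \<le> of_int (N t) * l" by (simp add: distrib_right)
      then show ?thesis using fR[of s] fR[of t] f0l[of s] f0l[of t] by linarith
    qed
  qed
  show "surj f"
  unfolding surj_def proof (intro allI)
    fix y :: real
    define n where "n = \<lfloor>y / l\<rfloor>"
    have "y - of_int n * l \<in> {0..l}"
      using floor_divide_lower[OF l, of y] floor_divide_upper[OF l, of y]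
      by (auto simp: n_def algebra_simps)
    then obtain x where "f x = y - of_int n * l" using im by (metis imageE)
    then have "f (x + of_int n * T) = y" using shift[of x n] by simp
    then show "\<exists>x. y = f x" by metis
  qed
qed

lemma cis_dist_le: "dist (cis s) (cis t) \<le> \<bar>s - t\<bar>"
proof -
  have "cis s - cis t = cis t * (exp (\<i> * of_real (s - t)) - 1)"
    by (simp only: cis_conv_exp[symmetric] right_diff_distrib cis_mult mult_1_right) simp
  then have "cmod (cis s - cis t) = 2 * \<bar>sin ((s - t) / 2)\<bar>"
    by (simp only: norm_mult norm_cis dist_exp_i_1)
  then show ?thesis using abs_sin_x_le_abs_x[of "(s - t) / 2"] by (simp add: dist_norm)
qed

text \<open>
Since \<open>h\<close> is bounded, its modulus of continuity is a finite function; beyond the range of the Dini integral,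
\<open>m(x)/x\<close> is bounded.
\<close>

lemma modulus_of_continuity_majorant:
  fixes h :: "real \<Rightarrow> complex"
  assumes bd: "\<And>s. cmod (h s) \<le> B" and dini: "dini_continuous_on UNIV h"
  obtains m where "\<And>a b. cmod (h a - h b) \<le> m \<bar>a - b\<bar>" "\<And>x y. x \<le> y \<Longrightarrow> m x \<le> m y"
    "\<And>K. 0 < K \<Longrightarrow> (\<lambda>x. m x / x) integrable_on {0..K}"
proof -
  define M where "M = modulus_of_continuity UNIV h"
  define m where "m x = enn2real (M x)" for x
  have B: "0 \<le> B" using bd[of 0] norm_ge_zero order_trans by blast
  have M2: "M x \<le> ennreal (2 * B)" for x
    unfolding M_def modulus_of_continuity_def
  proof (rule SUP_least)
    fix p :: "real \<times> real"
    have "cmod (h (fst p) - h (snd p)) \<le> 2 * B"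
      using norm_triangle_ineq4[of "h (fst p)" "h (snd p)"] bd[of "fst p"] bd[of "snd p"] by linarith
    then show "ennreal (cmod (h (fst p) - h (snd p))) \<le> ennreal (2 * B)" by (rule ennreal_leI)
  qed
  have Mfin: "M x < \<infinity>" for x using M2[of x] by (rule le_less_trans) simp
  have Mm: "M x = ennreal (m x)" for x using Mfin[of x] by (simp add: m_def)
  have m0: "0 \<le> m x" and m2: "m x \<le> 2 * B" for x
    using M2[of x] B by (simp_all add: m_def enn2real_leI)
  have Mmono: "M x \<le> M y" if "x \<le> y" for x y
    unfolding M_def modulus_of_continuity_def using that by (intro SUP_subset_mono) auto
  have mmono: "m x \<le> m y" if "x \<le> y" for x y
    unfolding m_def using Mmono[OF that] Mfin[of y] by (intro enn2real_mono) auto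
  have mb: "cmod (h a - h b) \<le> m \<bar>a - b\<bar>" for a b
  proof -
    have "ennreal (cmod (h (fst (a, b)) - h (snd (a, b)))) \<le> M \<bar>a - b\<bar>"
      unfolding M_def modulus_of_continuity_def by (rule SUP_upper) simp
    then show ?thesis using m0[of "\<bar>a - b\<bar>"] by (simp add: Mm)
  qed
  have mm[measurable]: "m \<in> borel_measurable borel"
    using mmono by (intro borel_measurable_mono monoI) auto
  obtain k where k: "0 < k" "(\<integral>\<^sup>+ t\<in>{0<..k}. M t / ennreal t \<partial>lborel) < \<infinity>"
    using dini by (auto simp: dini_continuous_on_def M_def)
  have int: "(\<lambda>x. m x / x) integrable_on {0..K}" if K: "0 < K" for K
  proof -
    define \<phi> where "\<phi> x = indicator {0<..K} x * (m x / x)" for x :: real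
    have \<phi>0: "0 \<le> \<phi> x" for x using m0[of x] by (auto simp: \<phi>_def indicator_def)
    have \<phi>m: "\<phi> \<in> borel_measurable borel" unfolding \<phi>_def by measurable
    have "(\<integral>\<^sup>+ x. ennreal (\<phi> x) \<partial>lborel) \<le>
        (\<integral>\<^sup>+ x. (M x / ennreal x) * indicator {0<..k} x + ennreal (2 * B / k) * indicator {k..K} x \<partial>lborel)"
    proof (rule nn_integral_mono)
      fix x :: real
      consider "x \<notin> {0<..K}" | "0 < x" "x \<le> k" "x \<le> K" | "k < x" "x \<le> K" by fastforce
      then show "ennreal (\<phi> x) \<le> (M x / ennreal x) * indicator {0<..k} x + ennreal (2 * B / k) * indicator {k..K} x"
      proof cases
        case 2
        then have "ennreal (\<phi> x) = M x / ennreal x" by (simp add: \<phi>_def Mm divide_ennreal m0)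
        then show ?thesis using 2 by simp
      next
        case 3
        have "m x / x \<le> 2 * B / k" using 3 k(1) m2[of x] m0[of x] B by (intro frac_le) auto
        then have "ennreal (\<phi> x) \<le> ennreal (2 * B / k)" using 3 k(1) by (intro ennreal_leI) (simp add: \<phi>_def)
        then show ?thesis using 3 k(1) by simp
      qed (auto simp: \<phi>_def)
    qed
    also have "\<dots> = (\<integral>\<^sup>+ t\<in>{0<..k}. M t / ennreal t \<partial>lborel) + ennreal (2 * B / k) * emeasure lborel {k..K}"
      by (subst nn_integral_add) (auto simp: nn_integral_cmult_indicator Mm)
    also have "\<dots> < \<infinity>"
    proof -
      have "ennreal (2 * B / k) * emeasure lborel {k..K} < \<infinity>"
        by (auto simp: emeasure_lborel_Icc_eq ennreal_mult_less_top)
      then show ?thesis using k(2) by (simp add: less_top)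
    qed
    finally have fin: "(\<integral>\<^sup>+ x. ennreal (\<phi> x) \<partial>lborel) < \<infinity>" .
    define J where "J = enn2real (\<integral>\<^sup>+ x. ennreal (\<phi> x) \<partial>lborel)"
    have "(\<phi> has_integral J) UNIV"
      by (rule nn_integral_has_integral[OF \<phi>m \<phi>0]) (use fin in \<open>auto simp: J_def\<close>)
    moreover have "\<phi> = (\<lambda>x. if x \<in> {0<..K} then m x / x else 0)" by (auto simp: \<phi>_def fun_eq_iff)
    ultimately have "((\<lambda>x. m x / x) has_integral J) {0<..K}" by (simp only: has_integral_restrict_UNIV)
    then have "(\<lambda>x. m x / x) integrable_on {0<..K}" by blast
    moreover have "{0..K} = insert 0 {0<..K}" using K by auto
    ultimately show ?thesis by (simp only: integrable_on_insert_iff)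
  qed
  show ?thesis by (rule that[OF mb mmono int])
qed

theorem theorem1:
  fixes \<gamma> :: "complex set" and l :: real
    and g :: "real \<Rightarrow> complex" and f :: "real \<Rightarrow> real" and F :: "complex \<Rightarrow> complex"
  assumes "dini_smooth_jordan_curve \<gamma> l g"
    and "weak_homeomorphism \<gamma> l g f F"
    and "\<exists>L. L-lipschitz_on (sphere 0 1) F"
  shows "(\<forall>\<tau>. T_integrand g f \<tau> absolutely_integrable_on {0..2*pi} \<and>
              T_function g f (cis \<tau>) = 1 / (2 * pi) * integral {0..2*pi} (T_integrand g f \<tau>))
       \<and> continuous_on (sphere 0 1) (T_function g f)
       \<and> (AE t in lebesgue.
            (\<lambda>s. F (cis s)) differentiable at t \<and>
            ((\<lambda>r. jacobian_det (poisson_extension F) (of_real r * cis t))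
                \<longlongrightarrow> boundary_jacobian (poisson_extension F) (cis t)) (at_left 1) \<and>
            boundary_jacobian (poisson_extension F) (cis t) =
              cmod (vector_derivative (\<lambda>s. F (cis s)) (at t)) * T_function g f (cis t))
       \<and> ((\<forall>\<zeta> \<in> sphere 0 1. T_function g f \<zeta> > 0) \<longrightarrow>
            diffeomorphism_onto (poisson_extension F) (ball 0 1) (inside \<gamma>))"
proof -
  define g' where "g' s = vector_derivative g (at s)" for s
  have arc: "0 < l" "\<And>s. g (s + l) = g s" "g ` {0..l} = \<gamma>" "inj_on g {0..<l}"
      "g C1_differentiable_on UNIV" "\<And>s. cmod (g' s) = 1"
    and dini: "dini_continuous_on UNIV g'"
    using assms(1) by (auto simp: dini_smooth_jordan_curve_def arclength_parametrization_def g'_def[abs_def])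
  have der: "(g has_vector_derivative g' s) (at s)" for s
    using arc(5) unfolding C1_differentiable_on_eq g'_def by (auto simp: vector_derivative_works)
  have g'c: "continuous_on UNIV g'"
    using dini by (simp add: dini_continuous_on_def)
  obtain m where m: "\<And>a b. cmod (g' a - g' b) \<le> m \<bar>a - b\<bar>" "\<And>x y. x \<le> y \<Longrightarrow> m x \<le> m y"
    "\<And>K. 0 < K \<Longrightarrow> (\<lambda>x. m x / x) integrable_on {0..K}"
    by (rule modulus_of_continuity_majorant[OF eq_refl[OF arc(6)] dini]) (rule that)
  have "dini_curve g g' m"
    by (rule dini_curve.intro[OF der g'c arc(6) m])
  then interpret dini_jordan g g' m l
    by (rule dini_jordan.intro) (rule dini_jordan_axioms.intro[OF arc(1,2,4)])
  have wh: "mono_on {0..2*pi} f" "f ` {0..2*pi} = {0..l}" "\<And>t. f (t + 2*pi) = f t + l" "\<And>t. F (cis t) = g (f t)"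
    using assms(2) by (auto simp: weak_homeomorphism_def)
  have mono: "mono f" and surj: "surj f"
    using mono_of_quasi_periodic[OF _ arc(1) wh(1,2,3)] by simp_all
  have fc: "continuous_on UNIV f"
    by (rule continuous_onI_mono) (use surj mono in \<open>auto dest: monoD\<close>)
  obtain M where M: "M-lipschitz_on (sphere 0 1) F" using assms(3) by blast
  have M0: "0 \<le> M" using lipschitz_on_nonneg[OF M] .
  have "cmod (g (f s) - g (f t)) \<le> M * \<bar>s - t\<bar>" for s t
  proof -
    have "dist (F (cis s)) (F (cis t)) \<le> M * dist (cis s) (cis t)" by (rule lipschitz_onD[OF M]) auto
    also have "\<dots> \<le> M * \<bar>s - t\<bar>" using M0 cis_dist_le by (intro mult_left_mono) auto
    finally show ?thesis by (simp add: wh dist_norm)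
  qed
  from lipschitz_reparametrization[OF fc M0 this] have "(2 * M)-lipschitz_on UNIV f" .
  \<comment> \<open>the summand \<open>1\<close> makes the constant positive also when \<open>M = 0\<close>\<close>
  then have lip: "(2 * M + 1)-lipschitz_on UNIV f" by (rule lipschitz_on_le) simp
  have adm: "admissible (2 * M + 1) f" using lip M0 wh(3) by (simp add: admissible_def)
  have T: "T_function g f (cis \<tau>) = radial_det f 1 \<tau>" for \<tau> by (rule T_function_eq(2)[OF adm])
  have A: "\<forall>\<tau>. T_integrand g f \<tau> absolutely_integrable_on {0..2*pi} \<and>
      T_function g f (cis \<tau>) = 1 / (2 * pi) * integral {0..2*pi} (T_integrand g f \<tau>)"
    using T_integrand_integral(1)[OF adm] T_function_eq(1)[OF adm] by blast
  have B: "continuous_on (sphere 0 1) (T_function g f)" by (rule T_function_continuous[OF adm])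
  have C: "AE t in lebesgue.
            (\<lambda>s. F (cis s)) differentiable at t \<and>
            ((\<lambda>r. jacobian_det (poisson_extension F) (of_real r * cis t))
                \<longlongrightarrow> boundary_jacobian (poisson_extension F) (cis t)) (at_left 1) \<and>
            boundary_jacobian (poisson_extension F) (cis t) =
              cmod (vector_derivative (\<lambda>s. F (cis s)) (at t)) * T_function g f (cis t)"
    using lipschitz_mono_differentiable_ae[OF mono lip]
  proof eventually_elim
    case (elim t)
    then obtain d where d: "(f has_real_derivative d) (at t)" by (auto simp: real_differentiable_def)
    have d0: "0 \<le> d"
    proof (rule tendsto_lowerbound)
      show "((\<lambda>y. (f y - f t) / (y - t)) \<longlongrightarrow> d) (at t)" using d by (simp add: has_field_derivative_iff)
      have "0 \<le> (f y - f t) / (y - t)" for y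
        using monoD[OF mono, of y t] monoD[OF mono, of t y] by (cases "y \<le> t") (auto intro: divide_nonpos_nonpos divide_nonneg_nonneg)
      then show "\<forall>\<^sub>F y in at t. 0 \<le> (f y - f t) / (y - t)" by simp
    qed simp
    have "((\<lambda>s. g (f s)) has_vector_derivative (d *\<^sub>R g' (f t))) (at t)"
      using vector_diff_chain_at[of f d t g "g' (f t)"] d der[of "f t"]
      by (simp add: o_def has_real_derivative_iff_has_vector_derivative)
    then have vd: "((\<lambda>s. F (cis s)) has_vector_derivative (d *\<^sub>R g' (f t))) (at t)" by (simp add: wh)
    have "cmod (vector_derivative (\<lambda>s. F (cis s)) (at t)) = d"
      using vector_derivative_at[OF vd] d0 by (simp add: unit)
    moreover have lim: "((\<lambda>r. jacobian_det (poisson_extension F) (of_real r * cis t)) \<longlongrightarrow> d * radial_det f 1 t) (at_left 1)"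
      by (rule jacobian_tendsto[OF adm wh(4) d])
    moreover have "boundary_jacobian (poisson_extension F) (cis t) = d * radial_det f 1 t"
      unfolding boundary_jacobian_def using tendsto_Lim[OF _ lim] by simp
    moreover have "(\<lambda>s. F (cis s)) differentiable at t"
      using vd differentiableI_vector by blast
    ultimately show ?case by (simp add: T)
  qed
  have D: "diffeomorphism_onto (poisson_extension F) (ball 0 1) (inside \<gamma>)"
    if pos: "\<forall>\<zeta> \<in> sphere 0 1. T_function g f \<zeta> > 0"
  proof (rule diffeomorphism_onto_cong)
    have "0 < radial_det f 1 \<tau>" for \<tau> using bspec[OF pos, of "cis \<tau>"] by (simp add: T)
    from jacobian_positive[OF adm mono surj this]
    show "diffeomorphism_onto (\<lambda>z. hol_part f z + cnj (antihol_part f z)) (ball 0 1) (inside \<gamma>)"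
      unfolding arc(3)[symmetric] by (rule harmonic_extension_diffeomorphism[OF adm])
    show "poisson_extension F z = hol_part f z + cnj (antihol_part f z)" if "z \<in> ball 0 1" for z
      by (rule poisson_extension_eq) (use that wh adm_cont[OF adm] in auto)
  qed simp
  show ?thesis using A B C D by blast
qed

end
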